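(* Let $m\ge 2$, let $H\le\mathrm{Sym}(m)$, and let $G\le W_H$ be a closed subgroup with commutator subgroup $G'$. Then $$\mathrm{hdim}_{W_H}(G)=\mathrm{hdim}_{W_H}(G').$$
   Context: Let $T$ be the $m$-adic rooted tree, identified with the free monoid on $\{1,\dots,m\}$ (vertices are finite words, level $n$ consists of the words of length $n$). $\mathrm{Aut}\,T$ is the group of automorphisms of the rooted tree $T$ (acting on the right), a profinite group whose topology has the level stabilizers as a base of neighbourhoods of $1$; "closed" refers to this topology. For $g\in\mathrm{Aut}\,T$ and a vertex $v$, the section $g|_v\in\mathrm{Aut}\,T$ is defined by $(vu)^g=v^g u^{g|_v}$ for all $u\in T$; $g|_v^1\in\mathrm{Sym}(m)$ denotes the permutation of $\{1,\dots,m\}$ induced by $g|_v$ on level 1. The iterated wreath product is $W_H=\{g\in\mathrm{Aut}\,T : g|_v^1\in H \text{ for all } v\in T\}$. For $K\le\mathrm{Aut}\,T$, $\mathrm{St}_K(n)$ is the subgroup of elements of $K$ fixing every vertex of level $n$. The group $W_H$ carries the metric $d(g,h)=\inf_{n}\{|W_H:\mathrm{St}_{W_H}(n)|^{-1} : gh^{-1}\in\mathrm{St}_{W_H}(n)\}$, and $\mathrm{hdim}_{W_H}$ denotes the Hausdorff dimension of Borel subsets of $W_H$ with respect to this metric (that is, with respect to the level-stabilizer filtration). For a closed subgroup $K\le W_H$ it is given by $\mathrm{hdim}_{W_H}(K)=\liminf_{n\to\infty}\frac{\log|K:\mathrm{St}_K(n)|}{\log|W_H:\mathrm{St}_{W_H}(n)|}$.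 *)

theory Defs
  imports
    "HOL-Analysis.Analysis"
    "HOL-Algebra.Generated_Groups"
    "HOL-Algebra.Sym_Groups"
begin

section \<open>The m-adic rooted tree and its automorphism group\<close>

definition tree_words :: "nat \<Rightarrow> nat list set" where
  "tree_words m = {w. set w \<subseteq> {1..m}}"

definition tree_adj :: "nat list \<Rightarrow> nat list \<Rightarrow> bool" where
  "tree_adj u v \<longleftrightarrow> (\<exists>x. v = u @ [x] \<or> u = v @ [x])"

text \<open>
  As with \<open>permutes\<close>, an automorphism is a total function that is the identity on lists that are
  not vertices of the tree, so that equality of automorphisms is equality of functions.
\<close>

definition tree_automorphism :: "nat \<Rightarrow> (nat list \<Rightarrow> nat list) \<Rightarrow> bool" where
  "tree_automorphism m g \<longleftrightarrow> g permutes tree_words m \<and> g [] = [] \<and>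
     (\<forall>u\<in>tree_words m. \<forall>v\<in>tree_words m. tree_adj (g u) (g v) \<longleftrightarrow> tree_adj u v)"

text \<open>
  Automorphisms act on the right: the product \<open>g h\<close> is ``first \<open>g\<close>, then \<open>h\<close>''.
\<close>

definition AutT :: "nat \<Rightarrow> (nat list \<Rightarrow> nat list) monoid" where
  "AutT m = \<lparr> carrier = {g. tree_automorphism m g}, mult = (\<lambda>g h. h \<circ> g), one = id \<rparr>"

definition level_stab :: "nat \<Rightarrow> (nat list \<Rightarrow> nat list) set \<Rightarrow> nat \<Rightarrow> (nat list \<Rightarrow> nat list) set" where
  "level_stab m K n = {g \<in> K. \<forall>w\<in>tree_words m. length w = n \<longrightarrow> g w = w}"

definition AutT_topology :: "nat \<Rightarrow> (nat list \<Rightarrow> nat list) topology" where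
  "AutT_topology m = topology_generated_by
     {g <#\<^bsub>AutT m\<^esub> level_stab m (carrier (AutT m)) n | g n. g \<in> carrier (AutT m)}"

text \<open>The defining property of sections is lemma \<open>tree_section\<close> below.\<close>

definition tree_section :: "(nat list \<Rightarrow> nat list) \<Rightarrow> nat list \<Rightarrow> nat list \<Rightarrow> nat list" where
  "tree_section g v = (\<lambda>u. drop (length v) (g (v @ u)))"

text \<open>
  The permutation of \<open>{1..m}\<close> induced on level 1 by the section of \<open>g\<close> at \<open>v\<close>; letters outside
  \<open>{1..m}\<close> are fixed.
\<close>

definition tree_label :: "(nat list \<Rightarrow> nat list) \<Rightarrow> nat list \<Rightarrow> nat \<Rightarrow> nat" where
  "tree_label g v = (\<lambda>x. hd (tree_section g v [x]))"

text \<open>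
  \<open>sym_group\<close> composes permutations in the opposite order to \<open>AutT\<close>; this is immaterial, as a set
  of permutations is a subgroup for one order iff it is for the other.
\<close>

definition iter_wreath :: "nat \<Rightarrow> (nat \<Rightarrow> nat) set \<Rightarrow> (nat list \<Rightarrow> nat list) monoid" where
  "iter_wreath m H =
     (AutT m)\<lparr>carrier := {g \<in> carrier (AutT m). \<forall>v\<in>tree_words m. tree_label g v \<in> H}\<rparr>"


section \<open>Hausdorff dimension\<close>

definition ediam :: "('a \<Rightarrow> 'a \<Rightarrow> real) \<Rightarrow> 'a set \<Rightarrow> ennreal" where
  "ediam d U = (SUP x\<in>U. SUP y\<in>U. ennreal (d x y))"

text \<open>
  Below, \<open>d\<close> is the distance function of a metric space with underlying set \<open>M\<close>. Finite covers are
  included, since members of a cover may be empty. The exponent \<open>s\<close> is only ever positive, so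
  sets of diameter \<open>0\<close> contribute \<open>0\<close>.
\<close>

definition hausdorff_premeasure ::
  "'a set \<Rightarrow> ('a \<Rightarrow> 'a \<Rightarrow> real) \<Rightarrow> real \<Rightarrow> real \<Rightarrow> 'a set \<Rightarrow> ennreal" where
  "hausdorff_premeasure M d s \<delta> A =
     (INF C\<in>{C :: nat \<Rightarrow> 'a set. A \<subseteq> (\<Union>i. C i) \<and> (\<forall>i. C i \<subseteq> M \<and> ediam d (C i) \<le> ennreal \<delta>)}.
        \<Sum>i. ennreal (enn2real (ediam d (C i)) powr s))"

definition hausdorff_measure ::
  "'a set \<Rightarrow> ('a \<Rightarrow> 'a \<Rightarrow> real) \<Rightarrow> real \<Rightarrow> 'a set \<Rightarrow> ennreal" where
  "hausdorff_measure M d s A = (SUP \<delta>\<in>{0<..}. hausdorff_premeasure M d s \<delta> A)"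

definition hausdorff_dim :: "'a set \<Rightarrow> ('a \<Rightarrow> 'a \<Rightarrow> real) \<Rightarrow> 'a set \<Rightarrow> ereal" where
  "hausdorff_dim M d A = (INF s\<in>{s. 0 < s \<and> hausdorff_measure M d s A = 0}. ereal s)"

definition level_index :: "nat \<Rightarrow> (nat \<Rightarrow> nat) set \<Rightarrow> nat \<Rightarrow> nat" where
  "level_index m H n =
     card (rcosets\<^bsub>iter_wreath m H\<^esub> (level_stab m (carrier (iter_wreath m H)) n))"

text \<open>
  If \<open>H\<close> is trivial then so is the iterated wreath product, all indices are \<open>1\<close>, and this formula
  gives the only point distance \<open>1\<close> from itself; in all other cases it is a metric.
\<close>

definition wreath_dist ::
  "nat \<Rightarrow> (nat \<Rightarrow> nat) set \<Rightarrow> (nat list \<Rightarrow> nat list) \<Rightarrow> (nat list \<Rightarrow> nat list) \<Rightarrow> real" where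
  "wreath_dist m H g h =
     (INF n\<in>{n. g \<otimes>\<^bsub>iter_wreath m H\<^esub> inv\<^bsub>iter_wreath m H\<^esub> h
                \<in> level_stab m (carrier (iter_wreath m H)) n}. 1 / real (level_index m H n))"

definition wreath_hdim :: "nat \<Rightarrow> (nat \<Rightarrow> nat) set \<Rightarrow> (nat list \<Rightarrow> nat list) set \<Rightarrow> ereal" where
  "wreath_hdim m H A = hausdorff_dim (carrier (iter_wreath m H)) (wreath_dist m H) A"


section \<open>Basic facts\<close>

lemma tree_words_append [simp]:
  "u @ v \<in> tree_words m \<longleftrightarrow> u \<in> tree_words m \<and> v \<in> tree_words m"
  by (auto simp: tree_words_def)

lemma Cons_tree_words [simp]:
  "x # w \<in> tree_words m \<longleftrightarrow> x \<in> {1..m} \<and> w \<in> tree_words m"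
  by (auto simp: tree_words_def)

lemma Nil_tree_words [simp]: "[] \<in> tree_words m"
  by (simp add: tree_words_def)

lemma tree_automorphism_child:
  assumes g: "tree_automorphism m g" and "w @ [x] \<in> tree_words m"
  shows "\<exists>y. g (w @ [x]) = g w @ [y]"
  using assms(2)
proof (induction w arbitrary: x rule: rev_induct)
  case Nil
  have "tree_adj [] [x]" by (simp add: tree_adj_def)
  then have "tree_adj (g []) (g [x])"
    using g Nil Nil_tree_words unfolding tree_automorphism_def append_Nil by blast
  then show ?case using g by (auto simp: tree_adj_def tree_automorphism_def)
next
  case (snoc z u)
  have inj: "inj g" using g permutes_inj unfolding tree_automorphism_def by blast
  obtain y' where y': "g (u @ [z]) = g u @ [y']"
    using snoc.IH[of z] snoc.prems tree_words_append by blast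
  have w: "u @ [z] \<in> tree_words m" "(u @ [z]) @ [x] \<in> tree_words m" using snoc.prems by auto
  have "tree_adj (u @ [z]) ((u @ [z]) @ [x])" by (auto simp: tree_adj_def)
  then have "tree_adj (g (u @ [z])) (g ((u @ [z]) @ [x]))"
    using g w unfolding tree_automorphism_def by blast
  then consider y where "g ((u @ [z]) @ [x]) = g (u @ [z]) @ [y]"
    | y where "g (u @ [z]) = g ((u @ [z]) @ [x]) @ [y]"
    by (auto simp: tree_adj_def)
  then show ?case
  proof cases
    case 2
    then have "g ((u @ [z]) @ [x]) = g u" using y' by simp
    then have "(u @ [z]) @ [x] = u" using inj by (meson injD)
    then show ?thesis by simp
  qed blast
qed

lemma tree_automorphism_outside:
  assumes "tree_automorphism m g" and "v \<notin> tree_words m"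
  shows "g v = v"
  using assms permutes_not_in unfolding tree_automorphism_def by metis

lemma tree_automorphism_length:
  assumes "tree_automorphism m g" shows "length (g v) = length v"
proof (cases "v \<in> tree_words m")
  case True
  then show ?thesis
  proof (induction v rule: rev_induct)
    case Nil
    then show ?case using assms by (simp add: tree_automorphism_def)
  next
    case (snoc x v)
    then show ?case using tree_automorphism_child[OF assms, of v x] by auto
  qed
next
  case False
  then show ?thesis using tree_automorphism_outside[OF assms] by simp
qed

lemma tree_section:
  assumes g: "tree_automorphism m g" and v: "v \<in> tree_words m" and u: "u \<in> tree_words m"
  shows "g (v @ u) = g v @ tree_section g v u"
proof -
  from u have "\<exists>t. g (v @ u) = g v @ t"
  proof (induction u rule: rev_induct)
    case (snoc x u)
    then obtain t where "g (v @ u) = g v @ t" by auto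
    moreover have "\<exists>y. g ((v @ u) @ [x]) = g (v @ u) @ [y]"
      using snoc.prems v by (intro tree_automorphism_child[OF g]) simp
    ultimately show ?case by auto
  qed simp
  then obtain t where t: "g (v @ u) = g v @ t" by blast
  then have "drop (length v) (g (v @ u)) = t"
    using tree_automorphism_length[OF g, of v] by simp
  then show ?thesis using t by (simp add: tree_section_def)
qed

lemma tree_automorphism_words:
  assumes "tree_automorphism m g"
  shows "g v \<in> tree_words m \<longleftrightarrow> v \<in> tree_words m"
  using assms by (simp add: tree_automorphism_def permutes_in_image)

lemma finite_tree_level: "finite {w \<in> tree_words m. length w = n}"
  using finite_lists_length_eq[of "{1..m}" n] by (simp add: tree_words_def)

lemma tree_automorphism_section:
  assumes g: "tree_automorphism m g" and v: "v \<in> tree_words m"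
  shows "tree_automorphism m (tree_section g v)"
proof -
  let ?s = "tree_section g v"
  have inj: "inj g" using g permutes_inj unfolding tree_automorphism_def by blast
  have len: "length (?s u) = length u" for u
    using tree_automorphism_length[OF g, of "v @ u"] by (simp add: tree_section_def)
  have mem: "?s u \<in> tree_words m" if "u \<in> tree_words m" for u
    using tree_automorphism_words[OF g, of "v @ u"] tree_section[OF g v that] that v by simp
  have inj_s: "inj_on ?s (tree_words m)"
  proof (rule inj_onI)
    fix x y assume xy: "x \<in> tree_words m" "y \<in> tree_words m" "?s x = ?s y"
    then have "g (v @ x) = g (v @ y)" by (simp add: tree_section[OF g v])
    then show "x = y" using inj by (simp add: inj_eq)
  qed
  have "?s ` tree_words m = tree_words m"
  proof (intro equalityI subsetI)
    fix w assume w: "w \<in> tree_words m"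
    let ?L = "{u \<in> tree_words m. length u = length w}"
    have "?s ` ?L = ?L"
    proof (rule endo_inj_surj[OF finite_tree_level])
      show "?s ` ?L \<subseteq> ?L" using len mem by auto
      show "inj_on ?s ?L" using inj_s by (rule inj_on_subset) auto
    qed
    then have "w \<in> ?s ` ?L" using w by simp
    then show "w \<in> ?s ` tree_words m" by blast
  qed (use mem in auto)
  then have "bij_betw ?s (tree_words m) (tree_words m)" using inj_s by (simp add: bij_betw_def)
  moreover have "?s u = u" if "u \<notin> tree_words m" for u
    using tree_automorphism_outside[OF g, of "v @ u"] that by (simp add: tree_section_def)
  ultimately have "?s permutes tree_words m" by (rule bij_imp_permutes)
  moreover have "?s [] = []" using len[of "[]"] by simp
  moreover have "tree_adj (?s u) (?s w) \<longleftrightarrow> tree_adj u w"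
    if "u \<in> tree_words m" "w \<in> tree_words m" for u w
  proof -
    have cancel: "tree_adj (a @ x) (a @ y) \<longleftrightarrow> tree_adj x y" for a x y
      by (auto simp: tree_adj_def)
    have "tree_adj (g (v @ u)) (g (v @ w)) \<longleftrightarrow> tree_adj (v @ u) (v @ w)"
      using g that v unfolding tree_automorphism_def by simp
    then show ?thesis using that by (simp add: tree_section[OF g v] cancel)
  qed
  ultimately show ?thesis by (simp add: tree_automorphism_def)
qed

lemma tree_automorphism_comp:
  assumes g: "tree_automorphism m g" and h: "tree_automorphism m h"
  shows "tree_automorphism m (h \<circ> g)"
proof -
  have "h \<circ> g permutes tree_words m"
    using g h permutes_compose unfolding tree_automorphism_def by blast
  moreover have "h (g []) = []" using g h by (simp add: tree_automorphism_def)
  moreover have "tree_adj (h (g u)) (h (g v)) \<longleftrightarrow> tree_adj u v"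
    if "u \<in> tree_words m" "v \<in> tree_words m" for u v
  proof -
    have "g u \<in> tree_words m" "g v \<in> tree_words m"
      using that tree_automorphism_words[OF g] by auto
    then have "tree_adj (h (g u)) (h (g v)) \<longleftrightarrow> tree_adj (g u) (g v)"
      using h unfolding tree_automorphism_def by blast
    also have "\<dots> \<longleftrightarrow> tree_adj u v" using g that unfolding tree_automorphism_def by blast
    finally show ?thesis .
  qed
  ultimately show ?thesis by (simp add: tree_automorphism_def)
qed

lemma tree_automorphism_inv:
  assumes g: "tree_automorphism m g"
  shows "tree_automorphism m (inv' g)"
proof -
  have p: "g permutes tree_words m" using g by (simp add: tree_automorphism_def)
  have r: "g (inv' g x) = x" for x using permutes_inverses[OF p] by simp
  have "inv' g [] = []" using g permutes_inv_eq[OF p] by (simp add: tree_automorphism_def)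
  moreover have "tree_adj (inv' g u) (inv' g v) \<longleftrightarrow> tree_adj u v"
    if "u \<in> tree_words m" "v \<in> tree_words m" for u v
  proof -
    have "inv' g u \<in> tree_words m" "inv' g v \<in> tree_words m"
      using that permutes_in_image[OF permutes_inv[OF p]] by auto
    then have "tree_adj (g (inv' g u)) (g (inv' g v)) \<longleftrightarrow> tree_adj (inv' g u) (inv' g v)"
      using g unfolding tree_automorphism_def by blast
    then show ?thesis by (simp add: r)
  qed
  ultimately show ?thesis using permutes_inv[OF p] by (simp add: tree_automorphism_def)
qed

lemma group_AutT: "group (AutT m)"
proof (rule groupI)
  fix g assume "g \<in> carrier (AutT m)"
  then have g: "tree_automorphism m g" by (simp add: AutT_def)
  then have "g \<circ> inv' g = id" unfolding tree_automorphism_def using permutes_inv_o(1) by blast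
  then show "\<exists>h\<in>carrier (AutT m). h \<otimes>\<^bsub>AutT m\<^esub> g = \<one>\<^bsub>AutT m\<^esub>"
    using tree_automorphism_inv[OF g] by (auto simp: AutT_def)
next
  show "\<one>\<^bsub>AutT m\<^esub> \<in> carrier (AutT m)"
    by (simp add: AutT_def tree_automorphism_def permutes_id)
qed (simp_all add: AutT_def tree_automorphism_comp comp_assoc)

lemma inv_AutT:
  assumes "g \<in> carrier (AutT m)" shows "inv\<^bsub>AutT m\<^esub> g = inv' g"
proof (rule group.inv_equality[OF group_AutT])
  have g: "tree_automorphism m g" using assms by (simp add: AutT_def)
  then have "g \<circ> inv' g = id" unfolding tree_automorphism_def using permutes_inv_o(1) by blast
  then show "inv' g \<otimes>\<^bsub>AutT m\<^esub> g = \<one>\<^bsub>AutT m\<^esub>" by (simp add: AutT_def)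
  show "inv' g \<in> carrier (AutT m)" using tree_automorphism_inv[OF g] by (simp add: AutT_def)
qed (rule assms)

lemma tree_label_permutes:
  assumes g: "tree_automorphism m g" and v: "v \<in> tree_words m"
  shows "tree_label g v permutes {1..m}"
proof -
  let ?s = "tree_section g v"
  have s: "tree_automorphism m ?s" by (rule tree_automorphism_section[OF g v])
  have one: "?s [x] = [tree_label g v x]" for x
    using tree_automorphism_length[OF s, of "[x]"] 
    by (cases "?s [x]") (auto simp: tree_label_def)
  have mem: "tree_label g v x \<in> {1..m} \<longleftrightarrow> x \<in> {1..m}" for x
    using tree_automorphism_words[OF s, of "[x]"] by (simp add: one tree_words_def)
  have inj: "inj (tree_label g v)"
  proof (rule injI)
    fix x y assume "tree_label g v x = tree_label g v y"
    then have "?s [x] = ?s [y]" by (simp add: one)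
    moreover have "inj ?s" using s permutes_inj unfolding tree_automorphism_def by blast
    ultimately show "x = y" by (simp add: inj_eq)
  qed
  have "inj_on (tree_label g v) {1..m}" using inj by (simp add: inj_on_def)
  moreover have "tree_label g v ` {1..m} \<subseteq> {1..m}" using mem by blast
  ultimately have "tree_label g v ` {1..m} = {1..m}" by (intro endo_inj_surj) simp_all
  then have "bij_betw (tree_label g v) {1..m} {1..m}"
    using inj by (simp add: bij_betw_def inj_on_def)
  moreover have "tree_label g v x = x" if "x \<notin> {1..m}" for x
  proof -
    have "[x] \<notin> tree_words m" using that by (simp add: tree_words_def)
    then have "?s [x] = [x]" by (rule tree_automorphism_outside[OF s])
    then show ?thesis by (simp add: tree_label_def)
  qed
  ultimately show ?thesis by (rule bij_imp_permutes)
qed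

lemma tree_label:
  assumes g: "tree_automorphism m g" and v: "v @ [x] \<in> tree_words m"
  shows "g (v @ [x]) = g v @ [tree_label g v x]"
proof -
  have v': "v \<in> tree_words m" "[x] \<in> tree_words m" using v by auto
  have "length (tree_section g v [x]) = 1"
    using tree_automorphism_length[OF tree_automorphism_section[OF g v'(1)], of "[x]"] by simp
  then show ?thesis
    using tree_section[OF g v'] by (cases "tree_section g v [x]") (auto simp: tree_label_def)
qed

lemma tree_label_comp:
  assumes g: "tree_automorphism m g" and h: "tree_automorphism m h" and v: "v \<in> tree_words m"
  shows "tree_label (h \<circ> g) v = tree_label h (g v) \<circ> tree_label g v"
proof
  fix x
  have gv: "g v \<in> tree_words m" using v tree_automorphism_words[OF g] by simp
  have hg: "tree_automorphism m (h \<circ> g)" by (rule tree_automorphism_comp[OF g h])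
  show "tree_label (h \<circ> g) v x = (tree_label h (g v) \<circ> tree_label g v) x"
  proof (cases "x \<in> {1..m}")
    case True
    then have vx: "v @ [x] \<in> tree_words m" using v by (simp add: tree_words_def)
    have "g v @ [tree_label g v x] \<in> tree_words m"
      using tree_automorphism_words[OF g, of "v @ [x]"] vx tree_label[OF g vx] by simp
    then show ?thesis using tree_label[OF hg vx] tree_label[OF g vx] tree_label[OF h] by simp
  next
    case False
    then show ?thesis
      by (simp add: permutes_not_in[OF tree_label_permutes[OF hg v]]
          permutes_not_in[OF tree_label_permutes[OF g v]]
          permutes_not_in[OF tree_label_permutes[OF h gv]])
  qed
qed

lemma tree_label_inv:
  assumes g: "tree_automorphism m g" and v: "v \<in> tree_words m"
  shows "tree_label (inv' g) v = inv' (tree_label g (inv' g v))"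
proof -
  have p: "g permutes tree_words m" using g by (simp add: tree_automorphism_def)
  have ig: "tree_automorphism m (inv' g)" by (rule tree_automorphism_inv[OF g])
  have iv: "inv' g v \<in> tree_words m" using v tree_automorphism_words[OF ig] by simp
  have "tree_label g (inv' g v) \<circ> tree_label (inv' g) v = tree_label (g \<circ> inv' g) v"
    by (rule tree_label_comp[OF ig g v, symmetric])
  also have "\<dots> = id"
    using permutes_inv_o(1)[OF p] by (simp add: tree_label_def tree_section_def fun_eq_iff)
  finally have c: "tree_label g (inv' g v) \<circ> tree_label (inv' g) v = id" .
  have b: "bij (tree_label g (inv' g v))" using tree_label_permutes[OF g iv] permutes_bij by blast
  show ?thesis
    using c b by (metis bij_def comp_assoc comp_id id_comp inv_o_cancel)
qed

lemma subgroup_iter_wreath: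
  assumes H: "subgroup H (sym_group m)"
  shows "subgroup (carrier (iter_wreath m H)) (AutT m)"
proof (rule group.subgroupI[OF group_AutT])
  have Hp: "p permutes {1..m}" if "p \<in> H" for p
    using subgroup.mem_carrier[OF H that] by (simp add: sym_group_def)
  have H1: "id \<in> H" using subgroup.one_closed[OF H] by (simp add: sym_group_def)
  have Hm: "p \<circ> q \<in> H" if "p \<in> H" "q \<in> H" for p q
    using subgroup.m_closed[OF H that] by (simp add: sym_group_def)
  have Hi: "inv' p \<in> H" if "p \<in> H" for p
    using subgroup.m_inv_closed[OF H that] sym_group_inv_equality[of p m] Hp[OF that]
    by (simp add: sym_group_def)
  have "tree_label id v = id" for v
    by (simp add: tree_label_def tree_section_def fun_eq_iff)
  then have "id \<in> carrier (iter_wreath m H)"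
    using H1 group.is_monoid[OF group_AutT[of m], THEN monoid.one_closed]
    by (simp add: iter_wreath_def AutT_def)
  then show "carrier (iter_wreath m H) \<noteq> {}" by blast
  show "carrier (iter_wreath m H) \<subseteq> carrier (AutT m)" by (auto simp: iter_wreath_def)
  fix g assume g: "g \<in> carrier (iter_wreath m H)"
  then have ga: "tree_automorphism m g" by (simp add: iter_wreath_def AutT_def)
  show "inv\<^bsub>AutT m\<^esub> g \<in> carrier (iter_wreath m H)"
    using g Hi tree_automorphism_inv[OF ga] tree_automorphism_words[OF tree_automorphism_inv[OF ga]]
      inv_AutT[of g m]
    by (simp add: iter_wreath_def AutT_def tree_label_inv[OF ga])
  fix h assume h: "h \<in> carrier (iter_wreath m H)"
  then have ha: "tree_automorphism m h" by (simp add: iter_wreath_def AutT_def)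
  show "g \<otimes>\<^bsub>AutT m\<^esub> h \<in> carrier (iter_wreath m H)"
    using g h Hm tree_automorphism_comp[OF ga ha] tree_automorphism_words[OF ga]
    by (simp add: iter_wreath_def AutT_def tree_label_comp[OF ga ha])
qed

lemma group_iter_wreath:
  assumes "subgroup H (sym_group m)" shows "group (iter_wreath m H)"
  using subgroup.subgroup_is_group[OF subgroup_iter_wreath[OF assms] group_AutT]
  by (simp add: iter_wreath_def)

end

theory Submission
  imports Defs
begin

text \<open>
  Since \<open>G'\<close> need not be closed, we look for compact subsets of \<open>G'\<close> of nearly full dimension. They
  consist of the products of the commutators \<open>[g, x\<^sub>g]\<close>, where \<open>g\<close> ranges over a fixed finite set of
  elements of \<open>G\<close> and the \<open>x\<^sub>g\<close> vary in a level stabilizer. It suffices that, for every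
  \<open>\<eta> > 0\<close> and some such set, each of these products taken modulo \<open>St N\<close> has at least
  \<open>|St N : St (N + 1)| \<cdot> |H|^(-\<eta> m^N)\<close> extensions modulo \<open>St (N + 1)\<close> for all large \<open>N\<close>: then no
  cover of these products is light, since one may avoid it by choosing one extension after the other.

  To count extensions, order a level \<open>n\<close> of the tree. The order of \<open>St N / St (N + 1)\<close> is the
  product over the vertices \<open>w\<close> of level \<open>n\<close> of the numbers \<open>l(w)\<close> of different actions below \<open>w\<close>
  of elements that act trivially below all vertices preceding \<open>w\<close>. If \<open>g\<close> maps \<open>w'\<close> to \<open>w\<close> compatibly with the order, then
  commutators with \<open>g\<close> realise \<open>l(w')\<close> different leading actions below \<open>w\<close>, so at most the factor
  \<open>l(w) / l(w')\<close> is lost there. Using the cycles of suitable elements of \<open>St n\<^sub>1\<close>, \<open>St n\<^sub>2\<close>, \<open>\<dots>\<close>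
  for \<open>n\<^sub>1 < n\<^sub>2 < \<dots>\<close>, the order is built such that most vertices with infinite orbit have many such
  predecessors \<open>w'\<close> in independent directions. As \<open>ln l\<close> is monotone, a second
  moment estimate, as for the total influence of a monotone function on a cube, shows that the
  average loss is small. Vertices with finite orbit hardly contribute, because deep below them most
  vertices are fixed by a level stabilizer.
\<close>

section \<open>Orderings of cycles and monotone functions on graphs\<close>

text \<open>Only closed subgroups have their dimension given by the lower limit, so for
  \<open>G'\<close> covers are treated directly; for \<open>G\<close> the upper bound by cylinders
  is enough. The loss \<open>|H|^(-\<eta> m^N)\<close> is harmless because the index in the wreath
  product grows by at least \<open>|H|^(m^N)\<close> in the same step: all losses together cost at
  most a factor \<open>index^\<eta>\<close>, hidden between two exponents.

  The obstacle is that a commutator \<open>g x g^-1 x^-1\<close> contains \<open>x\<close> twice,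
  and the copies might cancel. The order keeps them apart: \<open>x\<close> is trivial below all
  vertices preceding \<open>w'\<close>, and \<open>w\<close> precedes \<open>w'\<close>, so below
  \<open>w\<close> only the copy conjugated by \<open>g\<close> is seen. The price is
  \<open>l(w')\<close> in place of \<open>l(w)\<close>. A single \<open>w'\<close> may be bad, but a
  monotone function with values in \<open>[0, C]\<close> on a cube has differences along its
  \<open>k\<close> directions that add up, on average over the vertices, to order
  \<open>C sqrt k\<close>; the best direction loses order \<open>C / sqrt k\<close>. Level
  \<open>n\<close> and the elements \<open>g\<close> are fixed before \<open>N\<close>, so one order
  has to serve the functions \<open>ln l\<close> of all layers \<open>N\<close>.\<close>

lemma card_ge_fibers:
  assumes "finite A" and "f ` A = B" and "\<And>b. b \<in> B \<Longrightarrow> c \<le> card {a \<in> A. f a = b}"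
  shows "c * card B \<le> card A"
proof -
  have B: "finite B" using assms(1,2) by blast
  have "c * card B = (\<Sum>b\<in>B. c)" by simp
  also have "\<dots> \<le> (\<Sum>b\<in>B. card {a \<in> A. f a = b})" by (rule sum_mono) (rule assms(3))
  also have "\<dots> = card A"
    using sum.group[OF assms(1) B, of f "\<lambda>_. 1::nat"] assms(2) by simp
  finally show ?thesis .
qed

lemma card_le_fibers:
  assumes "finite A" and "f ` A = B" and "\<And>b. b \<in> B \<Longrightarrow> card {a \<in> A. f a = b} \<le> c"
  shows "card A \<le> c * card B"
proof -
  have B: "finite B" using assms(1,2) by blast
  have "card A = (\<Sum>b\<in>B. card {a \<in> A. f a = b})"
    using sum.group[OF assms(1) B, of f "\<lambda>_. 1::nat"] assms(2) by simp
  also have "\<dots> \<le> (\<Sum>b\<in>B. c)" by (rule sum_mono) (rule assms(3))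
  also have "\<dots> = c * card B" by simp
  finally show ?thesis .
qed

lemma restrict_image_eqI:
  assumes "p \<in> (\<lambda>y. restrict y A) ` S" and "q \<in> (\<lambda>y. restrict y A) ` T" and "\<And>v. v \<in> A \<Longrightarrow> p v = q v"
  shows "p = q"
  using assms by (intro extensionalityI[of p A q]) auto

text \<open>List the cycles of \<open>h\<close> one after the other, each in the order in which
  \<open>h\<close> runs through it. Then \<open>h\<close> respects the order up to any point that is
  not last in its cycle, and at least half of a nontrivial cycle is not last. The counter
  \<open>j\<close> makes the inverse of \<open>h ^^ j y\<close> at \<open>y\<close> and that of
  \<open>h ^^ j (h y)\<close> at \<open>h y\<close> the same point, as edges of a
  \<open>scheme\<close> will require.\<close>

lemma cycle_ordering:
  fixes h :: "'a \<Rightarrow> 'a"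
  assumes "finite Y" and "h ` Y = Y"
  shows "\<exists>(R :: 'a \<Rightarrow> nat) Y0 (j :: 'a \<Rightarrow> nat).
    inj_on R Y \<and> Y0 \<subseteq> Y \<and>
    (\<forall>y\<in>Y0. R y < R (h y) \<and> j (h y) = Suc (j y) \<and> (\<forall>x\<in>Y. R x < R y \<longrightarrow> R (h x) < R (h y))) \<and>
    card {y \<in> Y. h y \<noteq> y} \<le> 2 * card Y0"
  using assms
proof (induction "card Y" arbitrary: Y rule: less_induct)
  case less
  show ?case
  proof (cases "Y = {}")
    case True
    then show ?thesis by (intro exI[of _ "\<lambda>_. 0"] exI[of _ "{}"]) auto
  next
    case False
    then obtain y0 where y0: "y0 \<in> Y" by blast
    have injh: "inj_on h Y"
      using less.prems by (metis eq_card_imp_inj_on)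
    have mem: "(h ^^ i) y0 \<in> Y" for i
      using y0 less.prems(2) by (induction i) auto
    have cancel: "y0 = (h ^^ k) y0" if "(h ^^ i) y0 = (h ^^ (i + k)) y0" for i k
      using that
    proof (induction i)
      case (Suc i)
      have "h ((h ^^ i) y0) = h ((h ^^ (i + k)) y0)" using Suc.prems by simp
      then have "(h ^^ i) y0 = (h ^^ (i + k)) y0" using injh mem by (metis inj_onD)
      then show ?case by (rule Suc.IH)
    qed simp
    have "\<not> inj (\<lambda>i. (h ^^ i) y0)"
    proof
      assume "inj (\<lambda>i. (h ^^ i) y0)"
      moreover have "range (\<lambda>i. (h ^^ i) y0) \<subseteq> Y" using mem by blast
      ultimately show False
        using less.prems(1) by (metis finite_subset finite_imageD infinite_UNIV_nat)
    qed
    then obtain i i' where ii: "i < i'" "(h ^^ i) y0 = (h ^^ i') y0"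
      unfolding inj_def by (metis linorder_neqE_nat)
    then have "0 < i' - i \<and> (h ^^ (i' - i)) y0 = y0" using cancel[of i "i' - i"] by simp
    then have ex: "\<exists>n. 0 < n \<and> (h ^^ n) y0 = y0" by blast
    define l where "l = (LEAST n. 0 < n \<and> (h ^^ n) y0 = y0)"
    have l: "0 < l" "(h ^^ l) y0 = y0" using LeastI_ex[OF ex] unfolding l_def by auto
    have lmin: "(h ^^ n) y0 \<noteq> y0" if "0 < n" "n < l" for n
      using not_less_Least[of n "\<lambda>n. 0 < n \<and> (h ^^ n) y0 = y0"] that unfolding l_def by auto
    define c where "c = (\<lambda>i. (h ^^ i) y0) ` {..<l}"
    have injc: "inj_on (\<lambda>i. (h ^^ i) y0) {..<l}"
    proof (rule linorder_inj_onI')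
      fix i j assume ij: "i \<in> {..<l}" "j \<in> {..<l}" "i < j"
      show "(h ^^ i) y0 \<noteq> (h ^^ j) y0"
      proof
        assume "(h ^^ i) y0 = (h ^^ j) y0"
        then have "(h ^^ (j - i)) y0 = y0" using cancel[of i "j - i"] ij by simp
        moreover have "0 < j - i" "j - i < l" using ij by auto
        ultimately show False using lmin by blast
      qed
    qed
    define ix where "ix = the_inv_into {..<l} (\<lambda>i. (h ^^ i) y0)"
    have ix: "ix ((h ^^ i) y0) = i" if "i < l" for i
      unfolding ix_def using the_inv_into_f_f[OF injc] that by simp
    have hc: "h ` c = c"
    proof (rule endo_inj_surj)
      show "finite c" by (simp add: c_def)
      show "h ` c \<subseteq> c"
      proof
        fix x assume "x \<in> h ` c"
        then obtain i where i: "i < l" "x = (h ^^ Suc i) y0" by (auto simp: c_def)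
        show "x \<in> c"
        proof (cases "Suc i < l")
          case True then show ?thesis using i unfolding c_def by blast
        next
          case False
          then have "Suc i = l" using i by simp
          then have "x = (h ^^ 0) y0" using i l by (metis funpow_0)
          then show ?thesis using l unfolding c_def by blast
        qed
      qed
      show "inj_on h c" using injh mem by (auto simp: c_def inj_on_def)
    qed
    have cY: "c \<subseteq> Y" using mem by (auto simp: c_def)
    define Y' where "Y' = Y - c"
    have hY': "h ` Y' = Y'"
      unfolding Y'_def using inj_on_image_set_diff[OF injh _ cY, of Y] hc less.prems(2) by auto
    have "y0 \<in> c" unfolding c_def using l(1) by (metis funpow_0 imageI lessThan_iff)
    then have "Y' \<subset> Y" unfolding Y'_def using y0 by blast
    then have lt: "card Y' < card Y" using less.prems(1) by (simp add: psubset_card_mono)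
    have finY': "finite Y'" unfolding Y'_def using less.prems(1) by simp
    obtain R' Y0' j' where IH: "inj_on (R' :: 'a \<Rightarrow> nat) Y'" "Y0' \<subseteq> Y'"
      "\<forall>y\<in>Y0'. R' y < R' (h y) \<and> j' (h y) = Suc (j' y) \<and> (\<forall>x\<in>Y'. R' x < R' y \<longrightarrow> R' (h x) < R' (h y))"
      "card {y \<in> Y'. h y \<noteq> y} \<le> 2 * card Y0'"
      using less.hyps[OF lt finY' hY'] by blast
    \<comment> \<open>The cycle \<open>c\<close> of \<open>y0\<close> takes the first
      \<open>l\<close> ranks and the rest follows with shifted ranks, so comparisons across the two
      parts are automatic.\<close>
    define R where "R y = (if y \<in> c then ix y else l + R' y)" for y
    define j where "j y = (if y \<in> c then ix y else j' y)" for y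
    \<comment> \<open>The last point of the cycle is left out, since \<open>h\<close> wraps it
      around to rank 0.\<close>
    define c0 where "c0 = (\<lambda>i. (h ^^ i) y0) ` {..<l - 1}"
    define Y0 where "Y0 = Y0' \<union> c0"
    have c0c: "c0 \<subseteq> c" by (auto simp: c0_def c_def)
    have ixc: "ix y < l" if "y \<in> c" for y using that ix by (auto simp: c_def)
    have inj_ix: "inj_on ix c" by (rule inj_onI) (auto simp: c_def ix)
    have hY'mem: "h x \<in> Y'" if "x \<in> Y'" for x using that hY' by blast
    have hcmem: "h x \<in> c" if "x \<in> c" for x using that hc by blast
    have "inj_on R Y"
    proof (rule inj_onI)
      fix x y assume xy: "x \<in> Y" "y \<in> Y" "R x = R y"
      then show "x = y"
        using ixc[of x] ixc[of y] inj_onD[OF inj_ix, of x y] inj_onD[OF IH(1), of x y]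
        by (auto simp: R_def Y'_def split: if_splits)
    qed
    moreover have "Y0 \<subseteq> Y" using IH(2) c0c cY unfolding Y0_def Y'_def by blast
    moreover have "R y < R (h y) \<and> j (h y) = Suc (j y) \<and> (\<forall>x\<in>Y. R x < R y \<longrightarrow> R (h x) < R (h y))"
      if "y \<in> Y0" for y
    proof (cases "y \<in> c0")
      case True
      then obtain i where i: "i < l - 1" "y = (h ^^ i) y0" by (auto simp: c0_def)
      then have hy: "h y = (h ^^ Suc i) y0" by simp
      have yc: "y \<in> c" "h y \<in> c" using True c0c hcmem by auto
      have r: "ix y = i" "ix (h y) = Suc i" using ix[of i] ix[of "Suc i"] i hy by auto
      have "R (h x) < R (h y)" if "x \<in> Y" "R x < R y" for x
      proof (cases "x \<in> c")
        case True
        then obtain k where k: "k < l" "x = (h ^^ k) y0" by (auto simp: c_def)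
        then have "k < i" using that(2) True yc r ix[of k] by (simp add: R_def)
        then have "ix (h x) = Suc k" using ix[of "Suc k"] k i by simp
        then show ?thesis using hcmem[OF True] yc r \<open>k < i\<close> by (simp add: R_def)
      next
        case False
        then show ?thesis using that(2) yc r i by (simp add: R_def)
      qed
      then show ?thesis using yc r by (simp add: R_def j_def)
    next
      case False
      then have y: "y \<in> Y0'" "y \<in> Y'" using that IH(2) unfolding Y0_def by auto
      then have ny: "y \<notin> c" "h y \<notin> c" using hY'mem[of y] by (auto simp: Y'_def)
      have "R (h x) < R (h y)" if "x \<in> Y" "R x < R y" for x
      proof (cases "x \<in> c")
        case True
        then show ?thesis using hcmem[OF True] ixc[of "h x"] ny by (simp add: R_def)
      next
        case False
        then have "x \<in> Y'" using that by (simp add: Y'_def)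
        moreover then have "h x \<notin> c" using hY'mem by (auto simp: Y'_def)
        ultimately show ?thesis using False that(2) ny bspec[OF IH(3) y(1)] by (simp add: R_def)
      qed
      then show ?thesis using ny bspec[OF IH(3) y(1)] by (simp add: R_def j_def)
    qed
    moreover have "card {y \<in> Y. h y \<noteq> y} \<le> 2 * card Y0"
    proof -
      have fin: "finite c0" "finite Y0'" using less.prems(1) IH(2)
        by (auto simp: c0_def Y'_def intro: finite_subset[of Y0' Y])
      have "card c0 = l - 1" unfolding c0_def
        using inj_on_subset[OF injc] by (subst card_image) auto
      moreover have "card Y0 = card Y0' + card c0" unfolding Y0_def
        using fin IH(2) c0c by (intro card_Un_disjoint) (auto simp: Y'_def)
      \<comment> \<open>A fixed point contributes to neither side; for \<open>l\<close> at least 2,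
        \<open>l\<close> is at most \<open>2 * (l - 1)\<close>.\<close>
      moreover have "card {y \<in> c. h y \<noteq> y} \<le> 2 * (l - 1)"
      proof (cases "l = 1")
        case True
        then have "{y \<in> c. h y \<noteq> y} = {}" using l by (auto simp: c_def)
        then show ?thesis by (simp only: card.empty)
      next
        case False
        have "card {y \<in> c. h y \<noteq> y} \<le> card c" by (rule card_mono) (auto simp: c_def)
        also have "\<dots> = l" unfolding c_def using injc by (simp add: card_image)
        finally show ?thesis using False l(1) by linarith
      qed
      moreover have "card {y \<in> Y. h y \<noteq> y} \<le> card ({y \<in> c. h y \<noteq> y} \<union> {y \<in> Y'. h y \<noteq> y})"
        using less.prems(1) by (intro card_mono) (auto simp: Y'_def c_def)
      moreover have "card ({y \<in> c. h y \<noteq> y} \<union> {y \<in> Y'. h y \<noteq> y}) \<le>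
          card {y \<in> c. h y \<noteq> y} + card {y \<in> Y'. h y \<noteq> y}" by (rule card_Un_le)
      ultimately show ?thesis using IH(4) by linarith
    qed
    ultimately show ?thesis by blast
  qed
qed

section \<open>Degrees in a graph and the differences of a function along its edges\<close>

definition preds :: "('a \<times> 'a) set \<Rightarrow> 'a \<Rightarrow> 'a set" where
  "preds E u = {u'. (u', u) \<in> E}"

definition succs :: "('a \<times> 'a) set \<Rightarrow> 'a \<Rightarrow> 'a set" where
  "succs E u = {u'. (u, u') \<in> E}"

text \<open>The coefficient of \<open>f u\<close> when the differences of \<open>f\<close> along all
  edges are summed by parts; on a directed cube it is a sum of signs, one for each
  direction.\<close>

definition excess :: "('a \<times> 'a) set \<Rightarrow> 'a \<Rightarrow> real" where
  "excess E u = real (card (preds E u)) - real (card (succs E u))"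

text \<open>The default 0 is \<open>ln 1\<close>: without a predecessor only one action below the
  vertex is guaranteed.\<close>

definition best_pred :: "('a \<times> 'a) set \<Rightarrow> ('a \<Rightarrow> real) \<Rightarrow> 'a \<Rightarrow> real" where
  "best_pred E f u = (if preds E u = {} then 0 else Max (f ` preds E u))"

lemma sum_preds_diff:
  fixes f :: "'a \<Rightarrow> real"
  assumes "finite X" and "E \<subseteq> X \<times> X"
  shows "(\<Sum>u\<in>X. \<Sum>u'\<in>preds E u. f u - f u') = (\<Sum>u\<in>X. f u * excess E u)"
proof -
  have fin: "finite (preds E u)" for u
    using assms by (auto simp: preds_def intro: finite_subset[of _ X])
  have "(\<Sum>u\<in>X. \<Sum>u'\<in>preds E u. f u') = (\<Sum>u\<in>X. \<Sum>u'\<in>{u'\<in>X. (u', u) \<in> E}. f u')"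
    using assms(2) by (intro sum.cong) (auto simp: preds_def)
  also have "\<dots> = (\<Sum>u'\<in>X. \<Sum>u\<in>{u\<in>X. (u', u) \<in> E}. f u')"
    using assms(1) by (rule sum.swap_restrict[OF _ assms(1)])
  also have "\<dots> = (\<Sum>u'\<in>X. real (card (succs E u')) * f u')"
    using assms(2) by (intro sum.cong) (auto simp: succs_def intro!: arg_cong[where f=card])
  finally show ?thesis
    by (simp add: sum_subtractf excess_def algebra_simps)
qed

text \<open>
  A vertex with at least \<open>k\<close> predecessors loses at most the average of \<open>f u - f u'\<close> over its
  predecessors \<open>u'\<close>, and the sum of all \<open>f u - f u'\<close> is small by the second moment bound on \<open>excess\<close>.
\<close>

lemma sum_loss_le:
  fixes f :: "'a \<Rightarrow> real" and d r :: real and C :: real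
  assumes X: "finite X" and E: "E \<subseteq> X \<times> X"
    and f0: "\<And>u. u \<in> X \<Longrightarrow> 0 \<le> f u" and fC: "\<And>u. u \<in> X \<Longrightarrow> f u \<le> C"
    and mono: "\<And>u u'. (u', u) \<in> E \<Longrightarrow> f u' \<le> f u"
    and Z: "Z \<subseteq> X" and r: "r > 0" and C: "C \<ge> 0"
    and sq: "(\<Sum>u\<in>X. (excess E u)\<^sup>2) \<le> r * card X"
    and d: "k > 0"
  shows "(\<Sum>u\<in>X. f u - best_pred E f u) \<le>
    (\<Sum>u\<in>Z. f u) + C * 2 ^ k * (\<Sum>u\<in>X - Z. (1/2) ^ card (preds E u)) + C / k * sqrt r * card X"
proof -
  have fin: "finite (preds E u)" for u
    using X E by (auto simp: preds_def intro: finite_subset[of _ X])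
  have pX: "preds E u \<subseteq> X" for u using E by (auto simp: preds_def)
  let ?S = "\<lambda>u. \<Sum>u'\<in>preds E u. f u - f u'"
  have S0: "0 \<le> ?S u" for u by (rule sum_nonneg) (auto simp: preds_def mono)
  have bp0: "0 \<le> best_pred E f u" for u
  proof (cases "preds E u = {}")
    case False
    then obtain u' where u': "u' \<in> preds E u" by blast
    then have "f u' \<le> Max (f ` preds E u)" using fin by auto
    moreover have "0 \<le> f u'" using u' pX f0 by blast
    ultimately show ?thesis by (simp add: best_pred_def)
  qed (simp add: best_pred_def)
  have pt: "f u - best_pred E f u \<le>
      (if u \<in> Z then f u else 0) + (if u \<in> Z then 0 else C * 2 ^ k * (1/2) ^ card (preds E u)) + ?S u / k"
    if u: "u \<in> X" for u
  proof (cases "k \<le> card (preds E u)")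
    case True
    then have ne: "preds E u \<noteq> {}" using d by auto
    have ge: "f u' \<le> best_pred E f u" if "u' \<in> preds E u" for u'
      using that fin ne by (auto simp: best_pred_def)
    have le: "best_pred E f u \<le> f u"
      using ne fin by (auto simp: best_pred_def preds_def mono)
    have "real k * (f u - best_pred E f u) \<le> real (card (preds E u)) * (f u - best_pred E f u)"
      using True le by (intro mult_right_mono) auto
    also have "\<dots> = (\<Sum>u'\<in>preds E u. f u - best_pred E f u)" by simp
    also have "\<dots> \<le> ?S u" by (rule sum_mono) (use ge in auto)
    finally have "f u - best_pred E f u \<le> ?S u / k" using d by (simp add: field_simps)
    then show ?thesis using f0[OF u] C by (auto simp: add_increasing)
  next
    case False
    \<comment> \<open>With fewer than \<open>k\<close> predecessors all of \<open>f u\<close> may be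
      lost. The factor formed here is at least 1 and bounds the number of such vertices by the
      potential.\<close>
    have "(1::real) \<le> 2 ^ (k - card (preds E u))" by simp
    also have "\<dots> = 2 ^ k * (1/2) ^ card (preds E u)"
      using False by (simp add: power_diff power_one_over)
    finally have "C * 1 \<le> C * (2 ^ k * (1/2) ^ card (preds E u))" using C by (intro mult_left_mono)
    then have "f u \<le> C * 2 ^ k * (1/2) ^ card (preds E u)" using fC[OF u] by (simp add: mult.assoc)
    moreover have "0 \<le> ?S u / k" using S0 by simp
    ultimately show ?thesis using bp0[of u] by auto
  qed
  have "(\<Sum>u\<in>X. f u - best_pred E f u) \<le> (\<Sum>u\<in>X. (if u \<in> Z then f u else 0) +
      (if u \<in> Z then 0 else C * 2 ^ k * (1/2) ^ card (preds E u)) + ?S u / k)"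
    by (rule sum_mono) (rule pt)
  also have "\<dots> = (\<Sum>u\<in>X. if u \<in> Z then f u else 0) +
      (\<Sum>u\<in>X. if u \<in> Z then 0 else C * 2 ^ k * (1/2) ^ card (preds E u)) + (\<Sum>u\<in>X. ?S u) / k"
    by (simp add: sum.distrib sum_divide_distrib)
  also have "(\<Sum>u\<in>X. if u \<in> Z then f u else 0) = (\<Sum>u\<in>Z. f u)"
    using X Z by (simp add: sum.If_cases Int_absorb1)
  also have "(\<Sum>u\<in>X. if u \<in> Z then 0 else C * 2 ^ k * (1/2) ^ card (preds E u)) =
      C * 2 ^ k * (\<Sum>u\<in>X - Z. (1/2) ^ card (preds E u))"
    using X by (simp add: sum.If_cases sum_distrib_left Diff_eq)
  also have "(\<Sum>u\<in>X. ?S u) / k \<le> C / k * sqrt r * card X"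
  proof -
    \<comment> \<open>The inequality of the arithmetic and geometric means, scaled by
      \<open>sqrt r\<close>, takes the place of Cauchy-Schwarz for the mean absolute excess.\<close>
    have ab: "\<bar>e\<bar> \<le> (e\<^sup>2 / sqrt r + sqrt r) / 2" for e :: real
    proof -
      have "0 \<le> (\<bar>e\<bar> - sqrt r)\<^sup>2" by simp
      then have "2 * \<bar>e\<bar> * sqrt r \<le> e\<^sup>2 + sqrt r * sqrt r"
        by (simp add: power2_eq_square algebra_simps)
      then show ?thesis using r by (simp add: field_simps)
    qed
    have "(\<Sum>u\<in>X. ?S u) = (\<Sum>u\<in>X. f u * excess E u)" by (rule sum_preds_diff[OF X E])
    also have "\<dots> \<le> (\<Sum>u\<in>X. C * ((excess E u)\<^sup>2 / sqrt r + sqrt r) / 2)"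
    proof (rule sum_mono)
      fix u assume u: "u \<in> X"
      have "f u * excess E u \<le> f u * \<bar>excess E u\<bar>" using f0[OF u] by (intro mult_left_mono) auto
      also have "\<dots> \<le> C * ((excess E u)\<^sup>2 / sqrt r + sqrt r) / 2"
        using mult_mono[OF fC[OF u] ab[of "excess E u"]] C by simp
      finally show "f u * excess E u \<le> C * ((excess E u)\<^sup>2 / sqrt r + sqrt r) / 2" .
    qed
    also have "\<dots> = C / 2 * ((\<Sum>u\<in>X. (excess E u)\<^sup>2) / sqrt r + card X * sqrt r)"
      by (simp add: sum_distrib_left[symmetric] sum_divide_distrib[symmetric] sum.distrib)
    also have "\<dots> \<le> C / 2 * ((r * card X) / sqrt r + card X * sqrt r)"
      using C r sq by (intro mult_left_mono add_right_mono divide_right_mono) auto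
    also have "\<dots> = C * sqrt r * card X" using r by (simp add: field_simps)
    finally have "(\<Sum>u\<in>X. ?S u) / k \<le> C * sqrt r * card X / k" using d by (intro divide_right_mono) auto
    then show ?thesis by simp
  qed
  finally show ?thesis by simp
qed

section \<open>Groups of tree automorphisms\<close>

definition level :: "nat \<Rightarrow> nat \<Rightarrow> nat list set" where
  "level m n = {w \<in> tree_words m. length w = n}"

definition below :: "nat \<Rightarrow> nat \<Rightarrow> nat list \<Rightarrow> nat list set" where
  "below m n u = {v \<in> level m n. take (length u) v = u}"

lemma finite_level [simp]: "finite (level m n)"
  unfolding level_def by (rule finite_tree_level)

lemma finite_below [simp]: "finite (below m n u)"
  unfolding below_def by simp

lemma card_level: "card (level m n) = m ^ n"
  using card_lists_length_eq[of "{1..m}" n] by (simp add: level_def tree_words_def)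

lemma take_tree_words: "v \<in> tree_words m \<Longrightarrow> take k v \<in> tree_words m"
  unfolding tree_words_def using set_take_subset by fastforce

lemma take_level: "v \<in> level m n' \<Longrightarrow> n \<le> n' \<Longrightarrow> take n v \<in> level m n"
  by (simp add: level_def take_tree_words)

lemma below_level: "v \<in> below m n' u \<Longrightarrow> v \<in> level m n'"
  by (simp add: below_def)

lemma below_iff: "u \<in> level m n \<Longrightarrow> v \<in> below m n' u \<longleftrightarrow> v \<in> level m n' \<and> take n v = u"
  by (auto simp: below_def level_def)

lemma card_below:
  assumes "u \<in> level m n" and "n \<le> n'"
  shows "card (below m n' u) = m ^ (n' - n)"
proof -
  have "bij_betw ((@) u) (level m (n' - n)) (below m n' u)"
    unfolding bij_betw_def
  proof
    show "(@) u ` level m (n' - n) = below m n' u"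
    proof (intro equalityI subsetI)
      fix v assume v: "v \<in> below m n' u"
      then have eq: "v = u @ drop n v" and len: "length v = n'" and w: "v \<in> tree_words m"
        using assms by (auto simp: below_def level_def) (metis append_take_drop_id)
      have "u @ drop n v \<in> tree_words m" using eq w by simp
      then have "drop n v \<in> level m (n' - n)" using len by (simp add: level_def)
      then show "v \<in> (@) u ` level m (n' - n)" using eq by (rule rev_image_eqI)
    next
      fix v assume "v \<in> (@) u ` level m (n' - n)"
      then show "v \<in> below m n' u" using assms by (auto simp: below_def level_def)
    qed
  qed (simp add: inj_on_def)
  from bij_betw_same_card[OF this] show ?thesis by (simp add: card_level)
qed

lemma sum_level_below:
  fixes f :: "nat list \<Rightarrow> 'b::comm_monoid_add"
  assumes "n \<le> n'"
  shows "(\<Sum>v\<in>level m n'. f v) = (\<Sum>u\<in>level m n. \<Sum>v\<in>below m n' u. f v)"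
proof -
  have "(\<Sum>u\<in>level m n. \<Sum>v\<in>{v\<in>level m n'. take n v = u}. f v) = (\<Sum>v\<in>level m n'. f v)"
    by (rule sum.group) (use assms take_level in auto)
  then show ?thesis by (simp add: below_def level_def)
qed

text \<open>Maps are composed from right to left here, opposite to the product of
  \<open>AutT\<close>; a set closed under composition and inverses is a subgroup for either
  order.\<close>

locale tree_group =
  fixes m :: nat and G :: "(nat list \<Rightarrow> nat list) set"
  assumes aut: "g \<in> G \<Longrightarrow> tree_automorphism m g"
    and id_mem: "id \<in> G"
    and comp_mem: "g \<in> G \<Longrightarrow> h \<in> G \<Longrightarrow> g \<circ> h \<in> G"
    and inv_mem: "g \<in> G \<Longrightarrow> inv' g \<in> G"
begin

abbreviation St :: "nat \<Rightarrow> (nat list \<Rightarrow> nat list) set" where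
  "St \<equiv> level_stab m G"

lemma bij_mem: "g \<in> G \<Longrightarrow> bij g"
  using aut permutes_bij unfolding tree_automorphism_def by blast

lemma inv_left [simp]: "g \<in> G \<Longrightarrow> inv' g (g v) = v"
  using bij_mem by (simp add: bij_is_inj)

lemma inv_right [simp]: "g \<in> G \<Longrightarrow> g (inv' g v) = v"
  using bij_mem by (simp add: bij_is_surj surj_f_inv_f)

lemma inv_inv [simp]: "g \<in> G \<Longrightarrow> inv' (inv' g) = g"
  using bij_mem by (simp add: inv_inv_eq)

lemma inv_eq_iff: "g \<in> G \<Longrightarrow> inv' g x = y \<longleftrightarrow> x = g y"
  by auto

lemma eq_iff: "g \<in> G \<Longrightarrow> g x = g y \<longleftrightarrow> x = y"
  using inv_left by metis

lemma length_eq: "g \<in> G \<Longrightarrow> length (g v) = length v"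
  using aut tree_automorphism_length by blast

lemma words_iff: "g \<in> G \<Longrightarrow> g v \<in> tree_words m \<longleftrightarrow> v \<in> tree_words m"
  using aut tree_automorphism_words by blast

lemma level_iff: "g \<in> G \<Longrightarrow> g v \<in> level m n \<longleftrightarrow> v \<in> level m n"
  by (simp add: level_def length_eq words_iff)

lemmas act_simps = eq_iff length_eq words_iff level_iff

lemma take_act:
  assumes g: "g \<in> G" and v: "v \<in> tree_words m"
  shows "take k (g v) = g (take k v)"
proof (cases "k \<le> length v")
  case True
  have "take k v @ drop k v \<in> tree_words m" using v by simp
  then have "take k v \<in> tree_words m" "drop k v \<in> tree_words m"
    unfolding tree_words_append by auto
  then have "g (take k v @ drop k v) = g (take k v) @ tree_section g (take k v) (drop k v)"
    by (rule tree_section[OF aut[OF g]])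
  then show ?thesis using True g by (simp add: length_eq)
qed (use g in \<open>simp add: length_eq\<close>)

lemma take_act_level: "g \<in> G \<Longrightarrow> v \<in> level m n \<Longrightarrow> take k (g v) = g (take k v)"
  by (simp add: take_act level_def)

lemma below_act:
  assumes "g \<in> G"
  shows "g v \<in> below m n' (g u) \<longleftrightarrow> v \<in> below m n' u"
  using assms by (auto simp: below_def take_act_level act_simps)

lemma bij_betw_below:
  assumes "g \<in> G"
  shows "bij_betw g (below m n' u) (below m n' (g u))"
  unfolding bij_betw_def
proof
  show "inj_on g (below m n' u)" using assms by (simp add: inj_on_def eq_iff)
  show "g ` below m n' u = below m n' (g u)"
  proof (intro equalityI subsetI)
    fix v assume v: "v \<in> below m n' (g u)"
    then have "inv' g v \<in> below m n' u"
      using below_act[OF assms, of "inv' g v"] assms by simp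
    then show "v \<in> g ` below m n' u" using assms by (intro image_eqI[of _ _ "inv' g v"]) auto
  qed (use assms below_act in auto)
qed

lemma St_mem: "g \<in> St n \<Longrightarrow> g \<in> G"
  by (simp add: level_stab_def)

lemma St_id [simp]: "id \<in> St n"
  by (simp add: level_stab_def id_mem)

lemma St_fix: "g \<in> St n \<Longrightarrow> v \<in> level m n \<Longrightarrow> g v = v"
  by (simp add: level_stab_def level_def)

lemma St_fix_inv: "g \<in> St n \<Longrightarrow> v \<in> level m n \<Longrightarrow> inv' g v = v"
  using St_fix St_mem inv_left by metis

lemma St_I: "g \<in> G \<Longrightarrow> (\<And>v. v \<in> level m n \<Longrightarrow> g v = v) \<Longrightarrow> g \<in> St n"
  by (auto simp: level_stab_def level_def)

lemma St_comp: "g \<in> St n \<Longrightarrow> h \<in> St n \<Longrightarrow> g \<circ> h \<in> St n"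
  by (auto simp: level_stab_def comp_mem)

lemma St_inv: "g \<in> St n \<Longrightarrow> inv' g \<in> St n"
  by (rule St_I) (simp_all add: St_mem inv_mem St_fix_inv)

lemma St_conj:
  assumes "g \<in> G" "y \<in> St n"
  shows "g \<circ> y \<circ> inv' g \<in> St n"
  using assms by (intro St_I) (simp_all add: comp_mem inv_mem St_mem St_fix level_iff)

lemma St_pow: "g \<in> St n \<Longrightarrow> g ^^ k \<in> St n"
proof (induction k)
  case 0 then show ?case by (metis St_id funpow_0 eq_id_iff)
next
  case (Suc k) then show ?case by (simp only: funpow.simps St_comp)
qed

lemma comp_inv:
  assumes "g \<in> G" "h \<in> G" shows "inv' (g \<circ> h) = inv' h \<circ> inv' g"
  using assms by (simp add: bij_mem o_inv_distrib)

lemma level_extend: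
  assumes "m \<ge> 1" "v \<in> level m k" "k \<le> n" shows "\<exists>w\<in>level m n. take k w = v"
proof (rule bexI)
  show "v @ replicate (n - k) 1 \<in> level m n" using assms by (auto simp: level_def tree_words_def)
  show "take k (v @ replicate (n - k) 1) = v" using assms by (simp add: level_def)
qed

lemma level_fix_take:
  assumes g: "g \<in> G" and v: "v \<in> level m n" and fx: "g v = v"
  shows "g (take k v) = take k v"
  using take_act_level[OF g v, of k] fx by simp

lemma St_antimono:
  assumes "k \<le> n" shows "St n \<subseteq> St k"
proof
  fix g assume g: "g \<in> St n"
  show "g \<in> St k"
  proof (rule St_I)
    fix v assume v: "v \<in> level m k"
    show "g v = v"
    \<comment> \<open>Extending \<open>v\<close> down to level \<open>n\<close> needs a
      letter.\<close>
    proof (cases "m = 0")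
      case True
      then have "v = []" using v by (auto simp: level_def tree_words_def)
      then show ?thesis using St_mem[OF g] by (metis length_eq length_0_conv)
    next
      case False
      then obtain w where w: "w \<in> level m n" "take k w = v"
        using level_extend[OF _ v assms] by auto
      then show ?thesis using level_fix_take[OF St_mem[OF g] w(1) St_fix[OF g w(1)], of k] by simp
    qed
  qed (use g St_mem in blast)
qed

section \<open>Vertices fixed by a level stabilizer\<close>

definition fixed :: "nat \<Rightarrow> nat \<Rightarrow> nat list set" where
  "fixed k n = {v \<in> level m n. \<forall>g\<in>St k. g v = v}"

definition moved_below :: "nat \<Rightarrow> nat \<Rightarrow> nat list \<Rightarrow> nat list set" where
  "moved_below k n u = below m n u - fixed k n"

text \<open>\<open>St k\<close> is normal in \<open>G\<close>, so \<open>G\<close> permutes its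
  fixed vertices.\<close>

lemma fixed_act:
  assumes g: "g \<in> G" shows "g v \<in> fixed k n \<longleftrightarrow> v \<in> fixed k n"
proof -
  have *: "g v \<in> fixed k n" if "g \<in> G" "v \<in> fixed k n" for g v
  proof -
    have "y (g v) = g v" if y: "y \<in> St k" for y
    proof -
      have "inv' g \<circ> y \<circ> inv' (inv' g) \<in> St k" using St_conj[OF inv_mem y] \<open>g \<in> G\<close> by blast
      then have "inv' g (y (g v)) = v" using \<open>v \<in> fixed k n\<close> \<open>g \<in> G\<close> by (auto simp: fixed_def)
      then show ?thesis using \<open>g \<in> G\<close> by (simp add: inv_eq_iff)
    qed
    then show ?thesis using that by (simp add: fixed_def level_iff)
  qed
  from *[OF g, of v] *[OF inv_mem[OF g], of "g v"] g show ?thesis by auto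
qed

text \<open>Averaging over the finite group induced by \<open>St k\<close>: each moved point is moved by at
  least half of the group.\<close>

lemma exists_mover:
  "\<exists>h\<in>St k. card (moved_below k n u) \<le> 2 * card {z \<in> below m n u. h z \<noteq> z}"
proof -
  let ?Y = "below m n (u :: nat list)"
  define L where "L = moved_below k n u"
  define Q where "Q = (\<lambda>g. restrict g ?Y) ` St k"
  have Ly: "L \<subseteq> ?Y" unfolding L_def moved_below_def by blast
  have finL: "finite L" using Ly by (rule finite_subset) simp
  have "Q \<subseteq> PiE ?Y (\<lambda>_. level m n)"
  proof
    fix q assume "q \<in> Q"
    then obtain g where g: "g \<in> St k" "q = restrict g ?Y" by (auto simp: Q_def)
    have "g x \<in> level m n" if "x \<in> ?Y" for x
      using below_level[OF that] level_iff[OF St_mem[OF g(1)]] by blast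
    then show "q \<in> PiE ?Y (\<lambda>_. level m n)" using g(2) by auto
  qed
  then have finQ: "finite Q" by (rule finite_subset) (auto intro: finite_PiE)
  have half: "card Q \<le> 2 * card {q \<in> Q. q z \<noteq> z}" if z: "z \<in> L" for z
  proof -
    obtain g0 where g0: "g0 \<in> St k" "g0 z \<noteq> z"
      using z below_level unfolding L_def moved_below_def fixed_def by blast
    have zY: "z \<in> ?Y" using z Ly by blast
    \<comment> \<open>Composing with an element that moves \<open>z\<close> sends the actions fixing
      \<open>z\<close> injectively to actions moving \<open>z\<close>.\<close>
    have "card {q \<in> Q. q z = z} \<le> card {q \<in> Q. q z \<noteq> z}"
    proof (rule card_inj_on_le)
      show "inj_on (\<lambda>q. restrict (g0 \<circ> q) ?Y) {q \<in> Q. q z = z}"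
      proof (rule inj_onI)
        fix q q' assume q: "q \<in> {q \<in> Q. q z = z}" "q' \<in> {q \<in> Q. q z = z}"
          and eq: "restrict (g0 \<circ> q) ?Y = restrict (g0 \<circ> q') ?Y"
        have "q x = q' x" if "x \<in> ?Y" for x
          using fun_cong[OF eq, of x] that eq_iff[OF St_mem[OF g0(1)]] by simp
        moreover have "q \<in> extensional ?Y" "q' \<in> extensional ?Y" using q by (auto simp: Q_def)
        ultimately show "q = q'" using extensionalityI by blast
      qed
      show "(\<lambda>q. restrict (g0 \<circ> q) ?Y) ` {q \<in> Q. q z = z} \<subseteq> {q \<in> Q. q z \<noteq> z}"
      proof
        fix p assume "p \<in> (\<lambda>q. restrict (g0 \<circ> q) ?Y) ` {q \<in> Q. q z = z}"
        then obtain q where q: "q \<in> Q" "q z = z" "p = restrict (g0 \<circ> q) ?Y" by blast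
        then obtain g where g: "g \<in> St k" "q = restrict g ?Y" by (auto simp: Q_def)
        have "p = restrict (g0 \<circ> g) ?Y" unfolding q(3) g(2) by (rule restrict_ext) simp
        then have "p \<in> Q" unfolding Q_def using St_comp[OF g0(1) g(1)] by blast
        moreover have "p z = g0 z" using zY q by simp
        ultimately show "p \<in> {q \<in> Q. q z \<noteq> z}" using g0(2) by simp
      qed
    qed (use finQ in simp)
    moreover have "card Q = card {q \<in> Q. q z = z} + card {q \<in> Q. q z \<noteq> z}"
    proof -
      have "Q = {q \<in> Q. q z = z} \<union> {q \<in> Q. q z \<noteq> z}" by blast
      then show ?thesis using finQ by (metis (no_types, lifting) card_Un_disjoint disjoint_iff finite_Un mem_Collect_eq)
    qed
    ultimately show ?thesis by linarith
  qed
  have ne: "Q \<noteq> {}" unfolding Q_def using St_id by blast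
  \<comment> \<open>Double counting of the pairs of a vertex and an action that moves it.\<close>
  have "\<exists>q\<in>Q. card L \<le> 2 * card {z \<in> L. q z \<noteq> z}"
  proof (rule ccontr)
    assume "\<not> ?thesis"
    then have lt: "\<And>q. q \<in> Q \<Longrightarrow> 2 * card {z \<in> L. q z \<noteq> z} < card L" by auto
    have "card L * card Q = (\<Sum>z\<in>L. card Q)" by simp
    also have "\<dots> \<le> (\<Sum>z\<in>L. 2 * card {q \<in> Q. q z \<noteq> z})" by (rule sum_mono) (rule half)
    also have "\<dots> = 2 * (\<Sum>z\<in>L. \<Sum>q\<in>{q \<in> Q. q z \<noteq> z}. 1)" by (simp add: sum_distrib_left)
    also have "\<dots> = 2 * (\<Sum>q\<in>Q. \<Sum>z\<in>{z \<in> L. q z \<noteq> z}. 1)"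
      using sum.swap_restrict[OF finL finQ, of "\<lambda>_ _. 1::nat"] by simp
    also have "\<dots> = (\<Sum>q\<in>Q. 2 * card {z \<in> L. q z \<noteq> z})" by (simp add: sum_distrib_left)
    also have "\<dots> < (\<Sum>q\<in>Q. card L)" using finQ ne lt by (rule sum_strict_mono)
    finally show False by simp
  qed
  then obtain h where h: "h \<in> St k" "card L \<le> 2 * card {z \<in> L. restrict h ?Y z \<noteq> z}"
    by (auto simp: Q_def)
  have "card {z \<in> L. restrict h ?Y z \<noteq> z} \<le> card {z \<in> ?Y. h z \<noteq> z}"
    using Ly by (intro card_mono) auto
  then show ?thesis using h unfolding L_def by (intro bexI[of _ h]) auto
qed

end

section \<open>Ordered levels with many predecessors\<close>

lemma lex_less_iff:
  fixes a b c d B :: nat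
  assumes "c < B" "d < B"
  shows "a * B + c < b * B + d \<longleftrightarrow> a < b \<or> a = b \<and> c < d"
proof -
  have *: "a * B + c < b * B + d" if "a < b" "c < B" for a b c d :: nat
  proof -
    have "a * B + c < Suc a * B" using that(2) by simp
    also have "\<dots> \<le> b * B" using that(1) by (intro mult_right_mono) auto
    finally show ?thesis by simp
  qed
  show ?thesis using *[of a b c d] *[of b a d c] assms by (cases a b rule: linorder_cases) auto
qed

context tree_group
begin

text \<open>
  The edge \<open>(u', u)\<close> is realised by \<open>t u \<circ> inv' (t u')\<close>, which maps \<open>u'\<close> to \<open>u\<close> and pulls the vertices
  preceding \<open>u\<close> back to vertices preceding \<open>u'\<close>.
\<close>

definition scheme ::
  "nat \<Rightarrow> (nat list \<Rightarrow> nat) \<Rightarrow> (nat list \<Rightarrow> nat list \<Rightarrow> nat list) \<Rightarrow> (nat list \<times> nat list) set \<Rightarrow> bool" where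
  "scheme n pos t E \<longleftrightarrow> inj_on pos (level m n) \<and> t ` level m n \<subseteq> G \<and> E \<subseteq> level m n \<times> level m n \<and>
    (\<forall>(u', u)\<in>E. inv' (t u') u' = inv' (t u) u \<and> pos u < pos u' \<and>
      (\<forall>x\<in>level m n. pos (t u (inv' (t u') x)) < pos u \<longrightarrow> pos x < pos u'))"

lemma exists_trivial_scheme: "\<exists>pos t. scheme n pos t {}"
proof -
  obtain pos :: "nat list \<Rightarrow> nat" where "inj_on pos (level m n)"
    using finite_imp_inj_to_nat_seg[OF finite_level] by blast
  then have "scheme n pos (\<lambda>_. id) {}" by (auto simp: scheme_def id_mem)
  then show ?thesis by blast
qed

text \<open>The factor 4 collects two halvings: one element moves at least half of what
  \<open>St n\<close> moves, and at least half of that is not last in its cycle.\<close>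

lemma block_ordering:
  assumes r: "r \<in> level m n"
  shows "\<exists>h (R :: nat list \<Rightarrow> nat) Y0 (j :: nat list \<Rightarrow> nat). h \<in> St n \<and> inj_on R (below m n' r) \<and>
    Y0 \<subseteq> below m n' r \<and>
    (\<forall>y\<in>Y0. R y < R (h y) \<and> j (h y) = Suc (j y) \<and>
      (\<forall>x\<in>below m n' r. R x < R y \<longrightarrow> R (h x) < R (h y))) \<and>
    card (moved_below n n' r) \<le> 4 * card Y0"
proof -
  obtain h where h: "h \<in> St n"
    "card (moved_below n n' r) \<le> 2 * card {z \<in> below m n' r. h z \<noteq> z}"
    using exists_mover by blast
  have "h ` below m n' r = below m n' r"
    using bij_betw_below[OF St_mem[OF h(1)], of n' r] St_fix[OF h(1) r] by (simp add: bij_betw_def)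
  from cycle_ordering[OF finite_below this] obtain R Y0 j where
    "inj_on (R :: nat list \<Rightarrow> nat) (below m n' r)" "Y0 \<subseteq> below m n' r"
    "\<forall>y\<in>Y0. R y < R (h y) \<and> (j :: nat list \<Rightarrow> nat) (h y) = Suc (j y) \<and>
      (\<forall>x\<in>below m n' r. R x < R y \<longrightarrow> R (h x) < R (h y))"
    "card {y \<in> below m n' r. h y \<noteq> y} \<le> 2 * card Y0"
    by blast
  then show ?thesis using h by (intro exI[of _ h] exI[of _ R] exI[of _ Y0] exI[of _ j]) simp
qed

text \<open>Locally the new graph is the product of the old one with paths along the cycles inside a
  block: a vertex keeps its old neighbours, lifted, and gains at most one predecessor and one
  successor. The element \<open>h\<close> is chosen for the base point \<open>inv' (t u) u\<close>
  and not for \<open>u\<close>: base points agree along edges, so blocks joined by an edge are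
  ordered alike. In each block as many predecessors as successors are gained, so the excess changes
  by a term of mean zero and its second moment grows by at most 1 per vertex; gaining a predecessor
  halves the potential of a vertex.\<close>

lemma refine_scheme:
  assumes S: "scheme n pos t E" and nn: "n \<le> n'"
  shows "\<exists>pos' t' E'. scheme n' pos' t' E' \<and>
    (\<Sum>v\<in>level m n'. (excess E' v)\<^sup>2) \<le> m ^ (n' - n) * (\<Sum>u\<in>level m n. (excess E u)\<^sup>2) + m ^ n' \<and>
    (\<forall>u\<in>level m n. (\<Sum>v\<in>below m n' u. (1/2) ^ card (preds E' v)) \<le>
      (1/2) ^ card (preds E u) * (m ^ (n' - n) - card (moved_below n n' u) / 8 :: real))"
proof -
  have inj_pos: "inj_on pos (level m n)" and tG: "\<And>u. u \<in> level m n \<Longrightarrow> t u \<in> G"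
    and EX: "E \<subseteq> level m n \<times> level m n"
    using S by (auto simp: scheme_def)
  have Ert: "inv' (t u') u' = inv' (t u) u" and Elt: "pos u < pos u'"
    and Epos: "\<And>x. x \<in> level m n \<Longrightarrow> pos (t u (inv' (t u') x)) < pos u \<Longrightarrow> pos x < pos u'"
    if "(u', u) \<in> E" for u u'
    using S that by (auto simp: scheme_def)
  have "\<forall>r. \<exists>h (R :: nat list \<Rightarrow> nat) Y0 (j :: nat list \<Rightarrow> nat). r \<in> level m n \<longrightarrow>
    h \<in> St n \<and> inj_on R (below m n' r) \<and> Y0 \<subseteq> below m n' r \<and>
    (\<forall>y\<in>Y0. R y < R (h y) \<and> j (h y) = Suc (j y) \<and>
      (\<forall>x\<in>below m n' r. R x < R y \<longrightarrow> R (h x) < R (h y))) \<and>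
    card (moved_below n n' r) \<le> 4 * card Y0"
    using block_ordering by blast
  from this[unfolded choice_iff] obtain h R Y0 j where hRYj: "\<forall>r. r \<in> level m n \<longrightarrow>
    h r \<in> St n \<and> inj_on (R r :: nat list \<Rightarrow> nat) (below m n' r) \<and> Y0 r \<subseteq> below m n' r \<and>
    (\<forall>y\<in>Y0 r. R r y < R r (h r y) \<and> (j r :: nat list \<Rightarrow> nat) (h r y) = Suc (j r y) \<and>
      (\<forall>x\<in>below m n' r. R r x < R r y \<longrightarrow> R r (h r x) < R r (h r y))) \<and>
    card (moved_below n n' r) \<le> 4 * card (Y0 r)"
    by blast
  have h: "h r \<in> St n" and R: "inj_on (R r) (below m n' r)" and Y0: "Y0 r \<subseteq> below m n' r"
    and Y0card: "card (moved_below n n' r) \<le> 4 * card (Y0 r)"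
    and Y0R: "\<And>y. y \<in> Y0 r \<Longrightarrow> R r y < R r (h r y)"
    and Y0j: "\<And>y. y \<in> Y0 r \<Longrightarrow> j r (h r y) = Suc (j r y)"
    and Y0mono: "\<And>y x. y \<in> Y0 r \<Longrightarrow> x \<in> below m n' r \<Longrightarrow> R r x < R r y \<Longrightarrow> R r (h r x) < R r (h r y)"
    if "r \<in> level m n" for r
    using hRYj that by blast+
  have hG: "h r \<in> G" if "r \<in> level m n" for r using h[OF that] St_mem by blast
  have hpG: "h r ^^ k \<in> G" if "r \<in> level m n" for r k using St_pow[OF h[OF that]] St_mem by blast
  have hb: "h r z \<in> below m n' r" if "r \<in> level m n" "z \<in> below m n' r" for r z
    using below_act[OF hG, of r z n' r] St_fix[OF h] that by metis
  \<comment> \<open>\<open>rt u\<close> is the base point of \<open>u\<close>, and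
    \<open>z v\<close> is \<open>v\<close> carried into the block of the base point;
    \<open>take n v\<close> and \<open>z v\<close> are product coordinates on level
    \<open>n'\<close>.\<close>
  define rt where "rt u = inv' (t u) u" for u
  define z where "z v = inv' (t (take n v)) v" for v
  have rt: "rt u \<in> level m n" if "u \<in> level m n" for u
    unfolding rt_def using that level_iff[OF inv_mem[OF tG[OF that]]] by simp
  have t_rt: "t u (rt u) = u" if "u \<in> level m n" for u
    unfolding rt_def using tG[OF that] by simp
  have take: "take n v \<in> level m n" if "v \<in> level m n'" for v using take_level[OF that nn] .
  have t_below: "t u y \<in> below m n' u \<longleftrightarrow> y \<in> below m n' (rt u)" if "u \<in> level m n" for u y
    using below_act[OF tG[OF that], of y n' "rt u"] t_rt[OF that] by simp
  have z_eq: "z (t u y) = y" "take n (t u y) = u" if "u \<in> level m n" "y \<in> below m n' (rt u)" for u y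
  proof -
    have "t u y \<in> below m n' u" using t_below that by simp
    then show "take n (t u y) = u" using that(1) below_iff by blast
    then show "z (t u y) = y" unfolding z_def using tG[OF that(1)] by simp
  qed
  have t_z: "t (take n v) (z v) = v" if "v \<in> level m n'" for v
    unfolding z_def using tG[OF take[OF that]] by simp
  have z_below: "z v \<in> below m n' (rt (take n v))" if "v \<in> level m n'" for v
    using t_below[OF take[OF that], of "z v"] t_z[OF that] below_iff[OF take[OF that]] that by simp
  have "finite (\<Union>r\<in>level m n. R r ` below m n' r)" by simp
  then obtain B where B0: "\<forall>k\<in>(\<Union>r\<in>level m n. R r ` below m n' r). k < B"
    unfolding finite_nat_set_iff_bounded by blast
  have B: "R r y < B" if "r \<in> level m n" "y \<in> below m n' r" for r y using B0 that by blast
  \<comment> \<open>Lexicographic: blocks keep their order from level \<open>n\<close>, and inside a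
    block the ranks of the base block decide; \<open>B\<close> exceeds all of these.\<close>
  define pos' where "pos' v = pos (take n v) * B + R (rt (take n v)) (z v)" for v
  \<comment> \<open>The power of \<open>h\<close> accounts for the position on the cycle, so both
    ends of a new edge return to the same point; at the ends of a lifted edge the powers are equal
    and cancel.\<close>
  define t' where "t' v = t (take n v) \<circ> (h (rt (take n v)) ^^ j (rt (take n v)) (z v))" for v
  define E' where "E' = {(v', v). v' \<in> level m n' \<and> v \<in> level m n' \<and>
     ((take n v', take n v) \<in> E \<and> z v' = z v \<or>
      take n v' = take n v \<and> z v \<in> Y0 (rt (take n v)) \<and> z v' = h (rt (take n v)) (z v))}"
  have pos'_less: "pos' x < pos' y \<longleftrightarrow> pos (take n x) < pos (take n y) \<or>
      take n x = take n y \<and> R (rt (take n x)) (z x) < R (rt (take n x)) (z y)"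
    if "x \<in> level m n'" "y \<in> level m n'" for x y
  proof -
    have "pos' x < pos' y \<longleftrightarrow> pos (take n x) < pos (take n y) \<or>
        pos (take n x) = pos (take n y) \<and> R (rt (take n x)) (z x) < R (rt (take n y)) (z y)"
      unfolding pos'_def using that by (intro lex_less_iff B rt take z_below)
    moreover have "pos (take n x) = pos (take n y) \<longleftrightarrow> take n x = take n y"
      using inj_on_eq_iff[OF inj_pos take take] that by blast
    ultimately show ?thesis by auto
  qed
  have scheme': "scheme n' pos' t' E'"
    unfolding scheme_def
  proof (intro conjI ballI)
    show "inj_on pos' (level m n')"
    proof (rule inj_onI)
      fix x y assume xy: "x \<in> level m n'" "y \<in> level m n'" "pos' x = pos' y"
      have nl: "\<not> pos' x < pos' y" "\<not> pos' y < pos' x" using xy(3) by auto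
      have "pos (take n x) = pos (take n y)"
        using nl unfolding pos'_less[OF xy(1,2)] pos'_less[OF xy(2,1)] by linarith
      then have tk: "take n x = take n y" using inj_on_eq_iff[OF inj_pos take take] xy by blast
      have "R (rt (take n x)) (z x) = R (rt (take n x)) (z y)"
        using nl tk unfolding pos'_less[OF xy(1,2)] pos'_less[OF xy(2,1)] by auto
      then have "z x = z y"
        using inj_onD[OF R[OF rt[OF take[OF xy(1)]]]] z_below[OF xy(1)] z_below[OF xy(2)] tk by simp
      then show "x = y" using t_z[OF xy(1)] t_z[OF xy(2)] tk by metis
    qed
    show "t' ` level m n' \<subseteq> G"
      unfolding t'_def using comp_mem[OF tG[OF take] hpG[OF rt[OF take]]] by blast
    show "E' \<subseteq> level m n' \<times> level m n'" by (auto simp: E'_def)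
    fix e assume "e \<in> E'"
    then obtain v' v where e: "e = (v', v)" and v: "v' \<in> level m n'" "v \<in> level m n'"
      and or: "(take n v', take n v) \<in> E \<and> z v' = z v \<or>
        take n v' = take n v \<and> z v \<in> Y0 (rt (take n v)) \<and> z v' = h (rt (take n v)) (z v)"
      by (auto simp: E'_def)
    define u where "u = take n v"
    define u' where "u' = take n v'"
    define r where "r = rt u"
    have u: "u \<in> level m n" "u' \<in> level m n" using take v unfolding u_def u'_def by auto
    have rl: "r \<in> level m n" using rt u r_def by simp
    have tu: "t u \<in> G" "t u' \<in> G" using tG u by auto
    have inv_t': "inv' (t' w) = inv' (h (rt (take n w)) ^^ j (rt (take n w)) (z w)) \<circ> inv' (t (take n w))"
      if "w \<in> level m n'" for w
      unfolding t'_def using comp_inv[OF tG[OF take[OF that]] hpG[OF rt[OF take[OF that]]]] .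
    have "inv' (t' v') v' = inv' (t' v) v \<and> pos' v < pos' v' \<and>
      (\<forall>x\<in>level m n'. pos' (t' v (inv' (t' v') x)) < pos' v \<longrightarrow> pos' x < pos' v')"
      using or
    proof
      assume c: "(take n v', take n v) \<in> E \<and> z v' = z v"
      then have E: "(u', u) \<in> E" and zz: "z v' = z v" by (auto simp: u_def u'_def)
      have r': "rt u' = r" using Ert[OF E] by (simp add: rt_def r_def)
      have "inv' (t' v') v' = inv' (h r ^^ j r (z v)) (z v)"
        using inv_t'[OF v(1)] zz r' by (simp add: u'_def[symmetric] z_def)
      moreover have "inv' (t' v) v = inv' (h r ^^ j r (z v)) (z v)"
        using inv_t'[OF v(2)] by (simp add: u_def[symmetric] r_def z_def)
      moreover have "pos' v < pos' v'"
        using Elt[OF E] pos'_less[OF v(2,1)] by (simp add: u_def u'_def)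
      moreover have "pos' x < pos' v'" if x: "x \<in> level m n'" "pos' (t' v (inv' (t' v') x)) < pos' v" for x
      proof -
        define y where "y = take n x"
        define gx where "gx = t u (inv' (t u') x)"
        have "t' v (inv' (t' v') x) = gx"
          using inv_t'[OF v(1)] zz r' hpG[OF rl] by (simp add: t'_def gx_def u_def[symmetric] u'_def[symmetric] r_def[symmetric])
        then have lt: "pos' gx < pos' v" using x(2) by simp
        have gxl: "gx \<in> level m n'"
          unfolding gx_def using level_iff[OF tu(1)] level_iff[OF inv_mem[OF tu(2)]] x(1) by simp
        have tk: "take n gx = t u (inv' (t u') y)"
          unfolding gx_def y_def using take_act_level[OF tu(1)] take_act_level[OF inv_mem[OF tu(2)] x(1)]
            level_iff[OF inv_mem[OF tu(2)]] x(1) by simp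
        have yl: "y \<in> level m n" using take[OF x(1)] y_def by simp
        from lt have "pos (take n gx) < pos u \<or> take n gx = u \<and> R (rt u) (z gx) < R (rt u) (z v)"
          using pos'_less[OF gxl v(2)] by (auto simp: u_def)
        then show ?thesis
        proof
          assume "pos (take n gx) < pos u"
          then have "pos y < pos u'" using Epos[OF E yl] tk by simp
          then show ?thesis using pos'_less[OF x(1) v(1)] by (simp add: y_def u'_def)
        next
          assume a: "take n gx = u \<and> R (rt u) (z gx) < R (rt u) (z v)"
          then have "inv' (t u') y = rt u" using tk tu(1) inv_eq_iff[OF tu(1), of u "inv' (t u') y"] by (simp add: rt_def)
          then have "y = t u' (rt u')" using inv_eq_iff[OF tu(2)] r' r_def by simp
          then have yu: "y = u'" using t_rt u by simp
          have "z gx = inv' (t u) gx" using a by (simp add: z_def)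
          also have "\<dots> = inv' (t u') x" using tu by (simp add: gx_def)
          also have "\<dots> = z x" using yu by (simp add: z_def y_def)
          finally have "R r (z x) < R r (z v')" using a zz by (simp add: r_def)
          then show ?thesis using pos'_less[OF x(1) v(1)] yu r' by (simp add: y_def u'_def)
        qed
      qed
      ultimately show ?thesis by simp
    next
      assume c: "take n v' = take n v \<and> z v \<in> Y0 (rt (take n v)) \<and> z v' = h (rt (take n v)) (z v)"
      then have uu: "u' = u" and zv: "z v \<in> Y0 r" and zz: "z v' = h r (z v)"
        by (auto simp: u_def u'_def r_def)
      note hr = hG[OF rl]
      have jj: "j r (z v') = Suc (j r (z v))" using Y0j[OF rl zv] zz by simp
      have pw: "inv' (h r ^^ Suc k) = inv' (h r ^^ k) \<circ> inv' (h r)" for k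
        using comp_inv[OF hr hpG[OF rl]] by simp
      have "inv' (t' v') v' = inv' (h r ^^ Suc (j r (z v))) (z v')"
        using inv_t'[OF v(1)] jj by (simp add: u'_def[symmetric] uu r_def[symmetric] z_def del: funpow.simps)
      also have "\<dots> = inv' (h r ^^ j r (z v)) (z v)" unfolding pw zz using hr by simp
      also have "\<dots> = inv' (t' v) v"
        using inv_t'[OF v(2)] by (simp add: u_def[symmetric] r_def[symmetric] z_def)
      finally have 1: "inv' (t' v') v' = inv' (t' v) v" .
      have 2: "pos' v < pos' v'"
        using Y0R[OF rl zv] zz uu pos'_less[OF v(2,1)] by (simp add: u_def[symmetric] u'_def[symmetric] r_def)
      have 3: "pos' x < pos' v'" if x: "x \<in> level m n'" "pos' (t' v (inv' (t' v') x)) < pos' v" for x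
      proof -
        define y where "y = take n x"
        define q where "q = inv' (h r) (inv' (t u) x)"
        define gx where "gx = t u q"
        have "t' v (inv' (t' v') x) = t u ((h r ^^ j r (z v)) (inv' (h r ^^ Suc (j r (z v))) (inv' (t u) x)))"
          using inv_t'[OF v(1)] jj uu
          by (simp add: t'_def u_def[symmetric] u'_def[symmetric] r_def[symmetric] del: funpow.simps)
        also have "\<dots> = gx" unfolding pw gx_def q_def using hpG[OF rl] by simp
        finally have lt: "pos' gx < pos' v" using x(2) by simp
        have yl: "y \<in> level m n" using take[OF x(1)] y_def by simp
        have ql: "q \<in> level m n'"
          unfolding q_def using level_iff[OF inv_mem[OF hr]] level_iff[OF inv_mem[OF tu(1)]] x(1) by simp
        then have gxl: "gx \<in> level m n'" unfolding gx_def using level_iff[OF tu(1)] by simp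
        have tx: "inv' (t u) x \<in> level m n'" using level_iff[OF inv_mem[OF tu(1)]] x(1) by simp
        have "take n q = inv' (h r) (inv' (t u) y)"
          unfolding q_def y_def using take_act_level[OF inv_mem[OF hr] tx] take_act_level[OF inv_mem[OF tu(1)] x(1)] by simp
        \<comment> \<open>\<open>h r\<close> fixes level \<open>n\<close>, so pulling back along a
          new edge preserves every block.\<close>
        also have "\<dots> = inv' (t u) y"
          using St_fix_inv[OF h[OF rl]] level_iff[OF inv_mem[OF tu(1)]] yl by simp
        finally have tk: "take n gx = y"
          unfolding gx_def using take_act_level[OF tu(1) ql] tu(1) by simp
        from lt have "pos y < pos u \<or> y = u \<and> R r (z gx) < R r (z v)"
          using pos'_less[OF gxl v(2)] tk by (auto simp: u_def r_def)
        then show ?thesis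
        proof
          assume "pos y < pos u"
          then show ?thesis using pos'_less[OF x(1) v(1)] uu by (simp add: y_def u'_def)
        next
          assume a: "y = u \<and> R r (z gx) < R r (z v)"
          have "z gx = q" using a tk tu(1) by (simp add: z_def gx_def)
          moreover have "q \<in> below m n' r" using z_below[OF gxl] a tk calculation by (simp add: r_def)
          ultimately have "R r (h r q) < R r (h r (z v))" using Y0mono[OF rl zv] a by simp
          moreover have "h r q = z x" unfolding q_def using hr a by (simp add: z_def y_def)
          ultimately show ?thesis using pos'_less[OF x(1) v(1)] a uu zz by (simp add: y_def[symmetric] u'_def[symmetric] r_def)
        qed
      qed
      from 1 2 3 show ?thesis by blast
    qed
    then show "case e of (v', v) \<Rightarrow> inv' (t' v') v' = inv' (t' v) v \<and> pos' v < pos' v' \<and>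
      (\<forall>x\<in>level m n'. pos' (t' v (inv' (t' v') x)) < pos' v \<longrightarrow> pos' x < pos' v')"
      by (simp add: e)
  qed
  have noself: "(u, u) \<notin> E" for u using Elt by blast
  \<comment> \<open>Each old neighbour has exactly one lift with the same coordinate
    \<open>z\<close>. The new direction adds at most one neighbour, which is different from these
    because \<open>u\<close> is not its own neighbour.\<close>
  have card_lift: "card {w \<in> level m n'. take n w \<in> A \<and> z w = z v \<or> take n w = u \<and> z v \<in> Y \<and> z w = y} =
      card A + of_bool (z v \<in> Y)"
    if v: "v \<in> level m n'" and u: "u = take n v" and A: "A \<subseteq> level m n" "u \<notin> A"
      and rtA: "\<And>u'. u' \<in> A \<Longrightarrow> rt u' = rt u" and y: "z v \<in> Y \<Longrightarrow> y \<in> below m n' (rt u)"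
    for u v A Y y
  proof -
    have ul: "u \<in> level m n" using take v u by simp
    define P where "P = (\<lambda>u'. t u' (z v)) ` A"
    define Q where "Q = (if z v \<in> Y then {t u y} else {})"
    have lift: "z (t w x) = x \<and> take n (t w x) = w \<and> t w x \<in> level m n'"
      if "w \<in> level m n" "x \<in> below m n' (rt w)" for w x
      using z_eq[OF that] t_below[OF that(1), of x] that below_level by blast
    have zA: "z v \<in> below m n' (rt u')" if "u' \<in> A" for u' using z_below[OF v] rtA[OF that] u by simp
    have "{w \<in> level m n'. take n w \<in> A \<and> z w = z v \<or> take n w = u \<and> z v \<in> Y \<and> z w = y} = P \<union> Q"
    proof (intro equalityI subsetI)
      fix w assume "w \<in> {w \<in> level m n'. take n w \<in> A \<and> z w = z v \<or> take n w = u \<and> z v \<in> Y \<and> z w = y}"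
      then have w: "w \<in> level m n'" and or: "take n w \<in> A \<and> z w = z v \<or> take n w = u \<and> z v \<in> Y \<and> z w = y"
        by auto
      from or show "w \<in> P \<union> Q"
      proof
        assume a: "take n w \<in> A \<and> z w = z v"
        then have "w = t (take n w) (z v)" using t_z[OF w] by simp
        then show ?thesis using a unfolding P_def by blast
      next
        assume "take n w = u \<and> z v \<in> Y \<and> z w = y"
        then show ?thesis using t_z[OF w] by (auto simp: Q_def)
      qed
    next
      fix w assume "w \<in> P \<union> Q"
      then consider u' where "u' \<in> A" "w = t u' (z v)" | "z v \<in> Y" "w = t u y"
        by (auto simp: P_def Q_def split: if_splits)
      then show "w \<in> {w \<in> level m n'. take n w \<in> A \<and> z w = z v \<or> take n w = u \<and> z v \<in> Y \<and> z w = y}"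
      proof cases
        case 1
        then show ?thesis using lift[OF subsetD[OF A(1) 1(1)] zA[OF 1(1)]] by simp
      next
        case 2
        then show ?thesis using lift[OF ul y[OF 2(1)]] by simp
      qed
    qed
    moreover have "P \<inter> Q = {}"
    proof -
      have "take n w \<in> A" if "w \<in> P" for w using that lift zA A(1) by (auto simp: P_def)
      moreover have "take n w = u" if "w \<in> Q" for w
        using that lift[OF ul y] by (auto simp: Q_def split: if_splits)
      ultimately show ?thesis using A(2) by blast
    qed
    moreover have "card P = card A"
      unfolding P_def
    proof (rule card_image, rule inj_onI)
      fix w w' assume w: "w \<in> A" "w' \<in> A" "t w (z v) = t w' (z v)"
      then show "w = w'" using lift[OF subsetD[OF A(1) w(1)] zA[OF w(1)]] lift[OF subsetD[OF A(1) w(2)] zA[OF w(2)]] by metis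
    qed
    moreover have "card Q = of_bool (z v \<in> Y)" by (simp add: Q_def)
    moreover have "finite A" using A(1) by (rule finite_subset) simp
    then have "finite P" "finite Q" by (auto simp: P_def Q_def)
    ultimately show ?thesis by (simp add: card_Un_disjoint)
  qed
  have card_preds: "card (preds E' v) = card (preds E u) + of_bool (z v \<in> Y0 (rt u))"
    if v: "v \<in> level m n'" and u: "u = take n v" for u v
  proof -
    have rl: "rt u \<in> level m n" using rt take v u by simp
    have eq: "preds E' v = {w \<in> level m n'. take n w \<in> preds E u \<and> z w = z v \<or>
        take n w = u \<and> z v \<in> Y0 (rt u) \<and> z w = h (rt u) (z v)}"
      using v by (auto simp: preds_def E'_def u)
    show ?thesis
      unfolding eq
    proof (rule card_lift[OF v u])
      show "rt u' = rt u" if "u' \<in> preds E u" for u' using that Ert by (auto simp: preds_def rt_def)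
      show "h (rt u) (z v) \<in> below m n' (rt u)" using hb[OF rl] z_below[OF v] u by simp
      show "preds E u \<subseteq> level m n" unfolding preds_def using EX by blast
      show "u \<notin> preds E u" unfolding preds_def using noself by simp
    qed
  qed
  have card_succs: "card (succs E' v) = card (succs E u) + of_bool (z v \<in> h (rt u) ` Y0 (rt u))"
    if v: "v \<in> level m n'" and u: "u = take n v" for u v
  proof -
    have rl: "rt u \<in> level m n" using rt take v u by simp
    have inv: "inv' (h (rt u)) (h (rt u) y) = y" for y using hG[OF rl] by simp
    have fine: "y \<in> Y0 (rt u) \<and> z v = h (rt u) y \<longleftrightarrow> z v \<in> h (rt u) ` Y0 (rt u) \<and> y = inv' (h (rt u)) (z v)" for y
      using inv by (metis (no_types, lifting) image_iff)
    have eq: "succs E' v = {w \<in> level m n'. take n w \<in> succs E u \<and> z w = z v \<or>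
        take n w = u \<and> z v \<in> h (rt u) ` Y0 (rt u) \<and> z w = inv' (h (rt u)) (z v)}"
    proof (intro equalityI subsetI CollectI)
      fix w assume "w \<in> succs E' v"
      then have "w \<in> level m n'" and "(u, take n w) \<in> E \<and> z v = z w \<or>
          u = take n w \<and> z w \<in> Y0 (rt (take n w)) \<and> z v = h (rt (take n w)) (z w)"
        by (auto simp: succs_def E'_def u)
      then show "w \<in> level m n' \<and> (take n w \<in> succs E u \<and> z w = z v \<or>
          take n w = u \<and> z v \<in> h (rt u) ` Y0 (rt u) \<and> z w = inv' (h (rt u)) (z v))"
        unfolding fine[symmetric] by (auto simp: succs_def)
    qed (use v in \<open>auto simp: succs_def E'_def u fine[unfolded u, symmetric]\<close>)
    show ?thesis
      unfolding eq
    proof (rule card_lift[OF v u])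
      show "rt u' = rt u" if "u' \<in> succs E u" for u' using that Ert by (auto simp: succs_def rt_def)
      show "inv' (h (rt u)) (z v) \<in> below m n' (rt u)" if zv: "z v \<in> h (rt u) ` Y0 (rt u)"
      proof -
        obtain y where "y \<in> Y0 (rt u)" "z v = h (rt u) y" using zv by blast
        then show ?thesis using Y0[OF rl] inv by (simp add: subset_iff)
      qed
      show "succs E u \<subseteq> level m n" unfolding succs_def using EX by blast
      show "u \<notin> succs E u" unfolding succs_def using noself by simp
    qed
  qed
  have sum_z: "(\<Sum>v\<in>below m n' u. f (z v)) = (\<Sum>y\<in>below m n' (rt u). f y)"
    if u: "u \<in> level m n" for f :: "nat list \<Rightarrow> real" and u
  proof (rule sum.reindex_bij_witness[where i = "t u" and j = z])
    fix v assume "v \<in> below m n' u"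
    then have v: "v \<in> level m n'" "take n v = u" using below_iff[OF u] by auto
    then show "t u (z v) = v" "z v \<in> below m n' (rt u)" using t_z z_below by auto
  next
    fix y assume "y \<in> below m n' (rt u)"
    then show "z (t u y) = y" "t u y \<in> below m n' u" using z_eq(1)[OF u] t_below[OF u] by auto
  qed simp
  have belowD: "v \<in> level m n'" "take n v = u" if "v \<in> below m n' u" "u \<in> level m n" for u v
    using that below_iff by auto
  have sum_Y: "(\<Sum>y\<in>below m n' r. of_bool (y \<in> A) :: real) = card A"
    if "A \<subseteq> below m n' r" for r A
    using that by (simp add: Int_absorb1)
  have sq: "(\<Sum>v\<in>below m n' u. (excess E' v)\<^sup>2) \<le> m ^ (n' - n) * (excess E u)\<^sup>2 + m ^ (n' - n)"
    if u: "u \<in> level m n" for u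
  proof -
    define r where "r = rt u"
    have rl: "r \<in> level m n" using rt u r_def by simp
    let ?s = "\<lambda>y. of_bool (y \<in> Y0 r) - of_bool (y \<in> h r ` Y0 r) :: real"
    have hY: "h r ` Y0 r \<subseteq> below m n' r" using hb[OF rl] Y0[OF rl] by blast
    have "card (h r ` Y0 r) = card (Y0 r)"
      using eq_iff[OF hG[OF rl]] by (intro card_image) (simp add: inj_on_def)
    \<comment> \<open>As many vertices of the block gain a predecessor as gain a successor, so the
      cross term of the square vanishes below.\<close>
    then have s0: "(\<Sum>y\<in>below m n' r. ?s y) = 0"
      unfolding sum_subtractf sum_Y[OF Y0[OF rl]] sum_Y[OF hY] by simp
    have "(\<Sum>v\<in>below m n' u. (excess E' v)\<^sup>2) = (\<Sum>v\<in>below m n' u. (excess E u + ?s (z v))\<^sup>2)"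
    proof (rule sum.cong)
      fix v assume "v \<in> below m n' u"
      note v = belowD[OF this u]
      show "(excess E' v)\<^sup>2 = (excess E u + ?s (z v))\<^sup>2"
        unfolding excess_def card_preds[OF v(1) v(2)[symmetric]] card_succs[OF v(1) v(2)[symmetric]]
        by (intro arg_cong[where f = "\<lambda>x. x\<^sup>2"]) (simp add: r_def)
    qed simp
    also have "\<dots> = (\<Sum>y\<in>below m n' r. (excess E u + ?s y)\<^sup>2)"
      using sum_z[OF u, of "\<lambda>y. (excess E u + ?s y)\<^sup>2"] by (simp add: r_def)
    also have "\<dots> \<le> (\<Sum>y\<in>below m n' r. (excess E u)\<^sup>2 + 2 * excess E u * ?s y + 1)"
      by (rule sum_mono) (auto simp: power2_eq_square algebra_simps)
    also have "\<dots> = card (below m n' r) * (excess E u)\<^sup>2 + 2 * excess E u * (\<Sum>y\<in>below m n' r. ?s y) + card (below m n' r)"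
      by (simp add: sum.distrib sum_distrib_left)
    finally show ?thesis using s0 card_below[OF rl nn] by simp
  qed
  have "(\<Sum>v\<in>level m n'. (excess E' v)\<^sup>2) = (\<Sum>u\<in>level m n. \<Sum>v\<in>below m n' u. (excess E' v)\<^sup>2)"
    by (rule sum_level_below[OF nn])
  also have "\<dots> \<le> (\<Sum>u\<in>level m n. m ^ (n' - n) * (excess E u)\<^sup>2 + m ^ (n' - n))"
    by (rule sum_mono) (rule sq)
  also have "\<dots> = m ^ (n' - n) * (\<Sum>u\<in>level m n. (excess E u)\<^sup>2) + card (level m n) * m ^ (n' - n)"
    by (simp add: sum.distrib sum_distrib_left)
  also have "card (level m n) * m ^ (n' - n) = m ^ n'"
    using nn by (simp add: card_level power_add[symmetric])
  finally have 1: "(\<Sum>v\<in>level m n'. (excess E' v)\<^sup>2) \<le> m ^ (n' - n) * (\<Sum>u\<in>level m n. (excess E u)\<^sup>2) + m ^ n'"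
    by simp
  have 2: "(\<Sum>v\<in>below m n' u. (1/2) ^ card (preds E' v)) \<le>
      (1/2) ^ card (preds E u) * (m ^ (n' - n) - card (moved_below n n' u) / 8 :: real)"
    if u: "u \<in> level m n" for u
  proof -
    define r where "r = rt u"
    have rl: "r \<in> level m n" using rt u r_def by simp
    \<comment> \<open>\<open>G\<close> preserves the fixed vertices, so a block and its base block
      have equally many moved ones.\<close>
    have "moved_below n n' u = t u ` moved_below n n' r"
    proof (intro equalityI subsetI)
      fix v assume v: "v \<in> moved_below n n' u"
      then have vb: "v \<in> below m n' u" "v \<notin> fixed n n'" by (auto simp: moved_below_def)
      note v' = belowD[OF vb(1) u]
      have tz: "v = t u (z v)" using t_z[OF v'(1)] v'(2) by simp
      moreover have "z v \<notin> fixed n n'" using fixed_act[OF tG[OF u], of "z v" n n'] vb(2) tz by simp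
      moreover have "z v \<in> below m n' r" using z_below[OF v'(1)] v'(2) by (simp add: r_def)
      ultimately show "v \<in> t u ` moved_below n n' r" unfolding moved_below_def by blast
    next
      fix v assume "v \<in> t u ` moved_below n n' r"
      then show "v \<in> moved_below n n' u"
        using t_below[OF u] fixed_act[OF tG[OF u]] by (auto simp: moved_below_def r_def)
    qed
    then have live: "card (moved_below n n' u) = card (moved_below n n' r)"
      using eq_iff[OF tG[OF u]] by (simp add: card_image inj_on_def)
    have half: "(1/2) ^ (of_bool (y \<in> Y0 r) :: nat) = 1 - of_bool (y \<in> Y0 r) / (2::real)" for y
      by simp
    have "(\<Sum>v\<in>below m n' u. (1/2) ^ card (preds E' v) :: real) =
        (\<Sum>v\<in>below m n' u. (1/2) ^ card (preds E u) * (1/2) ^ (of_bool (z v \<in> Y0 r) :: nat))"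
    proof (rule sum.cong)
      fix v assume "v \<in> below m n' u"
      note v = belowD[OF this u]
      show "(1/2) ^ card (preds E' v) = (1/2) ^ card (preds E u) * (1/2 :: real) ^ (of_bool (z v \<in> Y0 r) :: nat)"
        unfolding card_preds[OF v(1) v(2)[symmetric]] by (simp add: r_def power_add)
    qed simp
    also have "\<dots> = (\<Sum>y\<in>below m n' r. (1/2) ^ card (preds E u) * (1/2) ^ (of_bool (y \<in> Y0 r) :: nat))"
      using sum_z[OF u, of "\<lambda>y. (1/2) ^ card (preds E u) * (1/2) ^ (of_bool (y \<in> Y0 r) :: nat)"] by (simp add: r_def)
    also have "\<dots> = (1/2) ^ card (preds E u) * (\<Sum>y\<in>below m n' r. 1 - of_bool (y \<in> Y0 r) / 2)"
      unfolding half by (simp add: sum_distrib_left)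
    also have "(\<Sum>y\<in>below m n' r. 1 - of_bool (y \<in> Y0 r) / (2::real)) = card (below m n' r) - card (Y0 r) / 2"
      using sum_Y[OF Y0[OF rl]] by (simp add: sum_subtractf sum_divide_distrib[symmetric])
    also have "(1/2) ^ card (preds E u) * (card (below m n' r) - card (Y0 r) / 2 :: real)
        \<le> (1/2) ^ card (preds E u) * (m ^ (n' - n) - card (moved_below n n' u) / 8)"
      using Y0card[OF rl] live card_below[OF rl nn] by (intro mult_left_mono) auto
    finally show ?thesis .
  qed
  show ?thesis using scheme' 1 2 by blast
qed

section \<open>Density of the vertices fixed by a level stabilizer\<close>

definition fixed_frac :: "nat \<Rightarrow> nat \<Rightarrow> real" where
  "fixed_frac k n = card (fixed k n) / m ^ n"

lemma fixed_level: "fixed k n \<subseteq> level m n"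
  by (auto simp: fixed_def)

lemma finite_fixed [simp]: "finite (fixed k n)"
  using fixed_level finite_level by (rule finite_subset)

lemma fixed_mono: "k \<le> k' \<Longrightarrow> fixed k n \<subseteq> fixed k' n"
  using St_antimono by (auto simp: fixed_def)

lemma take_fixed:
  assumes "v \<in> fixed k n'" and "n \<le> n'"
  shows "take n v \<in> fixed k n"
proof -
  have v: "v \<in> level m n'" using assms(1) by (simp add: fixed_def)
  have "g (take n v) = take n v" if "g \<in> St k" for g
    using assms(1) that level_fix_take[OF St_mem[OF that] v] by (simp add: fixed_def)
  then show ?thesis using take_level[OF v assms(2)] by (simp add: fixed_def)
qed

lemma card_over_fixed:
  assumes nn: "n \<le> n'"
  shows "card ({v \<in> level m n'. take n v \<in> fixed k n} - fixed k n') + card (fixed k n') =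
    m ^ (n' - n) * card (fixed k n)"
proof -
  have sub: "fixed k n' \<subseteq> {v \<in> level m n'. take n v \<in> fixed k n}"
    using take_fixed[OF _ nn] fixed_level by blast
  have bl: "below m n' u = {v \<in> level m n'. take n v = u}" if "u \<in> fixed k n" for u
    using that fixed_level below_iff by blast
  have "{v \<in> level m n'. take n v \<in> fixed k n} = (\<Union>u\<in>fixed k n. below m n' u)"
    by (auto simp: bl)
  also have "card \<dots> = (\<Sum>u\<in>fixed k n. card (below m n' u))"
    by (intro card_UN_disjoint) (auto simp: bl)
  also have "\<dots> = (\<Sum>u\<in>fixed k n. m ^ (n' - n))"
    using card_below[OF subsetD[OF fixed_level] nn] by (intro sum.cong) auto
  finally have "card {v \<in> level m n'. take n v \<in> fixed k n} = m ^ (n' - n) * card (fixed k n)" by simp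
  moreover have "card (fixed k n') \<le> card {v \<in> level m n'. take n v \<in> fixed k n}"
    using sub by (intro card_mono) auto
  ultimately show ?thesis using card_Diff_subset[OF finite_fixed sub] by simp
qed

lemma card_over_fixed_frac:
  assumes nn: "n \<le> n'" and m: "m > 0"
  shows "real (card ({v \<in> level m n'. take n v \<in> fixed k n} - fixed k n')) =
    real m ^ n' * (fixed_frac k n - fixed_frac k n')"
proof -
  have pw: "real m ^ n' = real m ^ (n' - n) * real m ^ n" using nn by (simp add: power_add[symmetric])
  have "real (card ({v \<in> level m n'. take n v \<in> fixed k n} - fixed k n')) + card (fixed k n') =
      m ^ (n' - n) * card (fixed k n)"
    using arg_cong[OF card_over_fixed[OF nn, of k], of real] by simp
  moreover have "real m ^ n' * fixed_frac k n = m ^ (n' - n) * card (fixed k n)"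
    unfolding pw fixed_frac_def using m by simp
  moreover have "real m ^ n' * fixed_frac k n' = card (fixed k n')"
    unfolding fixed_frac_def using m by simp
  ultimately show ?thesis by (simp add: right_diff_distrib)
qed

lemma fixed_frac_antimono:
  assumes "m > 0" "n \<le> n'" shows "fixed_frac k n' \<le> fixed_frac k n"
proof -
  have "0 \<le> real m ^ n' * (fixed_frac k n - fixed_frac k n')"
    unfolding card_over_fixed_frac[OF assms(2,1), of k, symmetric] by simp
  moreover have "0 < real m ^ n'" using assms(1) by simp
  ultimately show ?thesis by (simp only: zero_le_mult_iff) linarith
qed

lemma fixed_frac_bounds: "0 \<le> fixed_frac k n" "m > 0 \<Longrightarrow> fixed_frac k n \<le> 1"
proof -
  show "0 \<le> fixed_frac k n" by (simp add: fixed_frac_def)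
  assume m: "m > 0"
  have "card (fixed k n) \<le> m ^ n" using card_mono[OF finite_level fixed_level] by (simp add: card_level)
  then have "real (card (fixed k n)) \<le> real m ^ n" by (simp flip: of_nat_power)
  then show "fixed_frac k n \<le> 1" using m by (simp add: fixed_frac_def)
qed

text \<open>For each \<open>k\<close> the density decreases with the level to a limit
  \<open>p k\<close>, and \<open>p\<close> is bounded by 1. If \<open>p a\<close> is within
  \<epsilon> of its supremum, then no \<open>St k\<close> fixes, deep enough, noticeably more than
  \<open>St a\<close>: almost all vertices not fixed by \<open>St a\<close> are still moved by
  arbitrarily deep stabilizers.\<close>

lemma fixed_frac_stabilise:
  assumes m: "m > 0" and e: "\<epsilon> > 0"
  shows "\<exists>a n0. a \<le> n0 \<and> (\<forall>n. fixed_frac a n0 \<le> fixed_frac a n + \<epsilon>) \<and>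
    (\<forall>k. \<exists>n\<ge>k. \<forall>n'. fixed_frac k n \<le> fixed_frac a n' + 2 * \<epsilon>)"
proof -
  define p where "p k = (INF n. fixed_frac k n)" for k
  have bdd: "bdd_below (range (fixed_frac k))" for k
    using fixed_frac_bounds(1) by (auto intro: bdd_belowI[of _ 0])
  have ple: "p k \<le> fixed_frac k n" for k n unfolding p_def using bdd by (rule cINF_lower) simp
  have near: "\<exists>n\<ge>k'. fixed_frac k n < p k + \<epsilon>" for k k'
  proof -
    have "(INF n. fixed_frac k n) < p k + \<epsilon>" using e by (simp add: p_def)
    then obtain n where "fixed_frac k n < p k + \<epsilon>"
      using cINF_less_iff[OF _ bdd] by blast
    then show ?thesis
      using fixed_frac_antimono[OF m, of n "max n k'" k] by (intro exI[of _ "max n k'"]) auto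
  qed
  have bddp: "bdd_above (range p)"
    using order_trans[OF ple fixed_frac_bounds(2)[OF m]] by (auto intro: bdd_aboveI[of _ 1])
  have "(SUP k. p k) - \<epsilon> < (SUP k. p k)" using e by simp
  then obtain a where a: "(SUP k. p k) - \<epsilon> < p a" using less_cSUP_iff[OF _ bddp] by blast
  obtain n0 where n0: "n0 \<ge> a" "fixed_frac a n0 < p a + \<epsilon>" using near by blast
  have "\<exists>n\<ge>k. \<forall>n'. fixed_frac k n \<le> fixed_frac a n' + 2 * \<epsilon>" for k
  proof -
    obtain n where n: "n \<ge> k" "fixed_frac k n < p k + \<epsilon>" using near by blast
    have "p k \<le> (SUP k. p k)" using bddp by (rule cSUP_upper2) auto
    then have "fixed_frac k n \<le> fixed_frac a n' + 2 * \<epsilon>" for n' using n a ple[of a n'] by linarith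
    then show ?thesis using n by blast
  qed
  moreover have "fixed_frac a n0 \<le> fixed_frac a n + \<epsilon>" for n using n0(2) ple[of a n] by linarith
  ultimately show ?thesis using n0(1) by blast
qed

text \<open>The potential \<open>\<Sum>(1/2)^card (preds E u)\<close> measures how many vertices have few predecessors.
  Vertices fixed by \<open>St a\<close> are left out, since no element used here moves them.\<close>

lemma exists_scheme:
  assumes m: "m > 0" and e: "\<epsilon> > 0" and an0: "a \<le> n0"
    and st: "\<And>n. fixed_frac a n0 \<le> fixed_frac a n + \<epsilon>"
    and nxt: "\<And>k. \<exists>n\<ge>k. \<forall>n'. fixed_frac k n \<le> fixed_frac a n' + 2 * \<epsilon>"
  shows "\<exists>n pos t E. n0 \<le> n \<and> scheme n pos t E \<and>
    (\<Sum>v\<in>level m n. (excess E v)\<^sup>2) \<le> real r * m ^ n \<and>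
    (\<Sum>v\<in>level m n - fixed a n. (1/2) ^ card (preds E v)) \<le> ((7/8) ^ r + 16 * \<epsilon>) * real m ^ n"
proof (induction r)
  case 0
  obtain pos t where "scheme n0 pos t {}" using exists_trivial_scheme by blast
  moreover have "(\<Sum>v\<in>level m n0 - fixed a n0. (1/2) ^ card (preds {} v)) \<le> (1 + 16 * \<epsilon>) * real m ^ n0"
  proof -
    have "card (level m n0 - fixed a n0) \<le> m ^ n0"
      using card_mono[OF finite_level, of "level m n0 - fixed a n0" m n0] by (simp add: card_level)
    then have "real (card (level m n0 - fixed a n0)) \<le> real m ^ n0" by (simp flip: of_nat_power)
    also have "\<dots> \<le> (1 + 16 * \<epsilon>) * real m ^ n0" using e by (simp add: algebra_simps)
    finally show ?thesis by (simp add: preds_def)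
  qed
  ultimately show ?case
    by (intro exI[of _ n0] exI[of _ pos] exI[of _ t] exI[of _ "{}"]) (simp add: excess_def preds_def succs_def)
next
  case (Suc r)
  then obtain n pos t E where n: "n0 \<le> n" and S: "scheme n pos t E"
    and sq: "(\<Sum>v\<in>level m n. (excess E v)\<^sup>2) \<le> real r * m ^ n"
    and pot: "(\<Sum>v\<in>level m n - fixed a n. (1/2) ^ card (preds E v)) \<le> ((7/8) ^ r + 16 * \<epsilon>) * real m ^ n"
    by blast
  \<comment> \<open>Deep enough that \<open>St n\<close>, from which the next cycles are taken,
    fixes hardly more than \<open>St a\<close>.\<close>
  obtain n' where n': "n \<le> n'" "\<And>l. fixed_frac n n' \<le> fixed_frac a l + 2 * \<epsilon>" using nxt by blast
  have pw: "real m ^ n' = real m ^ (n' - n) * real m ^ n" using n'(1) by (simp add: power_add[symmetric])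
  obtain pos' t' E' where S': "scheme n' pos' t' E'"
    and sq': "(\<Sum>v\<in>level m n'. (excess E' v)\<^sup>2) \<le> m ^ (n' - n) * (\<Sum>u\<in>level m n. (excess E u)\<^sup>2) + m ^ n'"
    and pot': "\<forall>u\<in>level m n. (\<Sum>v\<in>below m n' u. (1/2) ^ card (preds E' v)) \<le>
      (1/2) ^ card (preds E u) * (m ^ (n' - n) - card (moved_below n n' u) / 8 :: real)"
    using refine_scheme[OF S n'(1)] by blast
  have "(\<Sum>v\<in>level m n'. (excess E' v)\<^sup>2) \<le> real m ^ (n' - n) * (real r * m ^ n) + m ^ n'"
    using sq' mult_left_mono[OF sq, of "real m ^ (n' - n)"] by simp
  also have "\<dots> = real (Suc r) * m ^ n'" by (simp add: pw algebra_simps)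
  finally have sq'': "(\<Sum>v\<in>level m n'. (excess E' v)\<^sup>2) \<le> real (Suc r) * m ^ n'" .
  let ?F = "fixed a n" and ?F' = "fixed a n'"
  \<comment> \<open>The induction says nothing about \<open>A\<close>, the vertices below
    \<open>fixed a n\<close> that are no longer fixed; by \<open>st\<close> they are few, and they
    count fully. Vertices of \<open>Bd\<close> are fixed by \<open>St n\<close> though not by
    \<open>St a\<close>; each is missing from \<open>moved_below\<close> and costs at most
    1/8.\<close>
  define A where "A = {v \<in> level m n'. take n v \<in> ?F} - ?F'"
  define Bd where "Bd = fixed n n' - ?F'"
  have bl: "below m n' u = {v \<in> level m n'. take n v = u}" if "u \<in> level m n - ?F" for u
    using that below_iff by blast
  have disj: "v \<notin> ?F'" if "u \<in> level m n - ?F" "v \<in> below m n' u" for u v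
    using that take_fixed[OF _ n'(1), of v a] by (auto simp: bl)
  have "level m n' - ?F' = A \<union> (\<Union>u\<in>level m n - ?F. below m n' u)"
    using disj take_level[OF _ n'(1), of _ m] by (auto simp: A_def bl)
  moreover have "A \<inter> (\<Union>u\<in>level m n - ?F. below m n' u) = {}"
    by (auto simp: A_def bl)
  ultimately have "(\<Sum>v\<in>level m n' - ?F'. (1/2) ^ card (preds E' v) :: real) =
      (\<Sum>v\<in>A. (1/2) ^ card (preds E' v)) + (\<Sum>v\<in>(\<Union>u\<in>level m n - ?F. below m n' u). (1/2) ^ card (preds E' v))"
    by (simp add: sum.union_disjoint A_def)
  also have "(\<Sum>v\<in>(\<Union>u\<in>level m n - ?F. below m n' u). (1/2) ^ card (preds E' v) :: real) =
      (\<Sum>u\<in>level m n - ?F. \<Sum>v\<in>below m n' u. (1/2) ^ card (preds E' v))"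
    by (rule sum.UNION_disjoint) (auto simp: bl)
  also have "(\<Sum>v\<in>A. (1/2) ^ card (preds E' v) :: real) \<le> (\<Sum>v\<in>A. 1)"
    by (rule sum_mono) (simp add: power_le_one)
  also have "(\<Sum>v\<in>A. 1) = real m ^ n' * (fixed_frac a n - fixed_frac a n')"
    using card_over_fixed_frac[OF n'(1) m, of a] by (simp add: A_def)
  also have "\<dots> \<le> real m ^ n' * \<epsilon>"
    using st[of n'] fixed_frac_antimono[OF m n, of a] by (intro mult_left_mono) auto
  also have "(\<Sum>u\<in>level m n - ?F. \<Sum>v\<in>below m n' u. (1/2) ^ card (preds E' v)) \<le>
      (\<Sum>u\<in>level m n - ?F. 7/8 * real m ^ (n' - n) * (1/2) ^ card (preds E u) + card (below m n' u \<inter> Bd) / 8)"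
  proof (rule sum_mono)
    fix u assume u: "u \<in> level m n - ?F"
    let ?w = "(1/2) ^ card (preds E u) :: real"
    have "card (below m n' u) = card (moved_below n n' u \<union> (below m n' u \<inter> fixed n n'))"
      unfolding moved_below_def by (rule arg_cong[where f = card]) blast
    also have "\<dots> = card (moved_below n n' u) + card (below m n' u \<inter> fixed n n')"
      unfolding moved_below_def by (rule card_Un_disjoint) auto
    finally have "card (below m n' u) = card (moved_below n n' u) + card (below m n' u \<inter> fixed n n')" .
    moreover have "below m n' u \<inter> fixed n n' = below m n' u \<inter> Bd"
      using disj[OF u] by (auto simp: Bd_def)
    ultimately have "real m ^ (n' - n) = card (moved_below n n' u) + card (below m n' u \<inter> Bd)"
      using arg_cong[OF card_below[of u m n n'], of real] u n'(1) by simp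
    then have "?w * (m ^ (n' - n) - card (moved_below n n' u) / 8) =
        7/8 * m ^ (n' - n) * ?w + ?w * (card (below m n' u \<inter> Bd) / 8)"
      by (simp add: field_simps)
    also have "\<dots> \<le> 7/8 * m ^ (n' - n) * ?w + 1 * (card (below m n' u \<inter> Bd) / 8)"
      by (intro add_left_mono mult_right_mono) (simp_all add: power_le_one)
    finally have "?w * (m ^ (n' - n) - card (moved_below n n' u) / 8) \<le>
        7/8 * real m ^ (n' - n) * ?w + card (below m n' u \<inter> Bd) / 8" by simp
    with pot' u show "(\<Sum>v\<in>below m n' u. (1/2) ^ card (preds E' v)) \<le>
        7/8 * real m ^ (n' - n) * ?w + card (below m n' u \<inter> Bd) / 8"
      by (meson DiffD1 order_trans)
  qed
  also have "\<dots> = 7/8 * real m ^ (n' - n) * (\<Sum>u\<in>level m n - ?F. (1/2) ^ card (preds E u)) +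
      real (\<Sum>u\<in>level m n - ?F. card (below m n' u \<inter> Bd)) / 8"
    by (simp add: sum.distrib sum_distrib_left sum_divide_distrib)
  also have "(\<Sum>u\<in>level m n - ?F. card (below m n' u \<inter> Bd)) = card (\<Union>u\<in>level m n - ?F. below m n' u \<inter> Bd)"
    by (rule card_UN_disjoint[symmetric]) (auto simp: bl)
  also have "real (card (\<Union>u\<in>level m n - ?F. below m n' u \<inter> Bd)) \<le> card Bd"
    by (simp, rule card_mono) (auto simp: Bd_def)
  also have "real (card Bd) = real m ^ n' * (fixed_frac n n' - fixed_frac a n')"
  proof -
    have sub: "?F' \<subseteq> fixed n n'" by (rule fixed_mono) (use an0 n in simp)
    have "card (fixed n n') = card Bd + card ?F'"
      unfolding Bd_def using card_Diff_subset[OF finite_fixed sub] card_mono[OF finite_fixed sub] by simp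
    then show ?thesis using m by (simp add: fixed_frac_def right_diff_distrib)
  qed
  also have "\<dots> \<le> real m ^ n' * (2 * \<epsilon>)"
    using n'(2)[of n'] by (intro mult_left_mono) auto
  also have "7/8 * real m ^ (n' - n) * (\<Sum>u\<in>level m n - ?F. (1/2) ^ card (preds E u)) \<le>
      7/8 * real m ^ (n' - n) * (((7/8) ^ r + 16 * \<epsilon>) * real m ^ n)"
    by (rule mult_left_mono[OF pot]) simp
  also have "\<dots> = (7/8) ^ Suc r * real m ^ n' + 14 * \<epsilon> * real m ^ n'" by (simp add: pw field_simps)
  finally have "(\<Sum>v\<in>level m n' - ?F'. (1/2) ^ card (preds E' v)) \<le>
      real m ^ n' * \<epsilon> + ((7/8) ^ Suc r * real m ^ n' + 14 * \<epsilon> * real m ^ n' + real m ^ n' * (2 * \<epsilon>) / 8)"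
    by (simp add: algebra_simps)
  \<comment> \<open>7/8 of the old error \<open>16 * \<epsilon>\<close> and the new errors
    \<epsilon> and \<open>2 * \<epsilon> / 8\<close> add up to less than
    \<open>16 * \<epsilon>\<close>.\<close>
  also have "\<dots> \<le> ((7/8) ^ Suc r + 16 * \<epsilon>) * real m ^ n'" using e by (simp add: algebra_simps)
  finally show ?case using S' sq'' n n'(1) by (meson order_trans)
qed

end

section \<open>Counting products of commutators level by level\<close>

definition commutator :: "('a \<Rightarrow> 'a) \<Rightarrow> ('a \<Rightarrow> 'a) \<Rightarrow> 'a \<Rightarrow> 'a" where
  "commutator g x = g \<circ> x \<circ> inv' g \<circ> inv' x"

fun comm_prod :: "('e \<Rightarrow> 'a \<Rightarrow> 'a) \<Rightarrow> ('e \<Rightarrow> 'a \<Rightarrow> 'a) \<Rightarrow> 'e list \<Rightarrow> 'a \<Rightarrow> 'a" where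
  "comm_prod \<gamma> x [] = id"
| "comm_prod \<gamma> x (e # es) = commutator (\<gamma> e) (x e) \<circ> comm_prod \<gamma> x es"

lemma comm_prod_append: "comm_prod \<gamma> x (es @ fs) = comm_prod \<gamma> x es \<circ> comm_prod \<gamma> x fs"
  by (induction es) (simp_all add: comp_assoc)

lemma comm_prod_cong: "(\<And>e. e \<in> set es \<Longrightarrow> x e = y e) \<Longrightarrow> comm_prod \<gamma> x es = comm_prod \<gamma> y es"
  by (induction es) simp_all

context tree_group
begin

lemma finite_restrict_image:
  assumes "S \<subseteq> G" and "A \<subseteq> level m n"
  shows "finite ((\<lambda>g. restrict g A) ` S)"
proof (rule finite_subset)
  show "(\<lambda>g. restrict g A) ` S \<subseteq> PiE A (\<lambda>_. level m n)"
  proof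
    fix q assume "q \<in> (\<lambda>g. restrict g A) ` S"
    then obtain g where g: "g \<in> G" "q = restrict g A" using assms(1) by blast
    have "g v \<in> level m n" if "v \<in> A" for v using level_iff[OF g(1)] assms(2) that by blast
    then show "q \<in> PiE A (\<lambda>_. level m n)" using g(2) by auto
  qed
  show "finite (PiE A (\<lambda>_. level m n))"
    using assms(2) by (intro finite_PiE) (auto intro: finite_subset)
qed

lemma commutator_mem: "g \<in> G \<Longrightarrow> x \<in> G \<Longrightarrow> commutator g x \<in> G"
  unfolding commutator_def by (intro comp_mem inv_mem)

lemma commutator_St: "g \<in> G \<Longrightarrow> x \<in> St n \<Longrightarrow> commutator g x \<in> St n"
  unfolding commutator_def by (intro St_comp[of "g \<circ> x \<circ> inv' g"] St_conj St_inv)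

lemma comm_prod_mem:
  "(\<And>e. e \<in> set es \<Longrightarrow> \<gamma> e \<in> G \<and> x e \<in> G) \<Longrightarrow> comm_prod \<gamma> x es \<in> G"
proof (induction es)
  case Nil show ?case by (simp only: comm_prod.simps id_mem)
next
  case (Cons e es)
  then show ?case by (simp only: comm_prod.simps) (intro comp_mem commutator_mem; simp)
qed

lemma comm_prod_St:
  "(\<And>e. e \<in> set es \<Longrightarrow> \<gamma> e \<in> G \<and> x e \<in> St n) \<Longrightarrow> comm_prod \<gamma> x es \<in> St n"
proof (induction es)
  case Nil show ?case by (simp only: comm_prod.simps St_id)
next
  case (Cons e es)
  then show ?case by (simp only: comm_prod.simps) (intro St_comp commutator_St; simp)
qed

lemma commutator_agree:
  assumes g: "g \<in> G" and x: "x \<in> G" "y \<in> G" and xy: "\<And>v. v \<in> level m n \<Longrightarrow> x v = y v"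
    and v: "v \<in> level m n"
  shows "commutator g x v = commutator g y v"
proof -
  have "inv' x v = inv' y v"
    using xy[of "inv' y v"] level_iff[OF inv_mem[OF x(2)]] v x by (metis inv_left inv_right)
  moreover have "inv' g (inv' y v) \<in> level m n"
    using level_iff[OF inv_mem[OF g]] level_iff[OF inv_mem[OF x(2)]] v by blast
  ultimately show ?thesis using xy by (simp add: commutator_def)
qed

lemma comm_prod_agree:
  assumes "\<And>e. e \<in> set es \<Longrightarrow> \<gamma> e \<in> G \<and> x e \<in> G \<and> y e \<in> G"
    and "\<And>e v. e \<in> set es \<Longrightarrow> v \<in> level m n \<Longrightarrow> x e v = y e v" and "v \<in> level m n"
  shows "comm_prod \<gamma> x es v = comm_prod \<gamma> y es v"
  using assms
proof (induction es)
  case (Cons e es)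
  have "comm_prod \<gamma> y es v \<in> level m n"
    using level_iff[OF comm_prod_mem[of es \<gamma> y]] Cons.prems by simp
  then have "commutator (\<gamma> e) (x e) (comm_prod \<gamma> y es v) = commutator (\<gamma> e) (y e) (comm_prod \<gamma> y es v)"
    using Cons.prems by (intro commutator_agree) auto
  then show ?case using Cons by simp
qed simp

section \<open>Leading actions and the order of one layer\<close>

definition front_stab :: "nat \<Rightarrow> (nat list \<Rightarrow> nat) \<Rightarrow> nat \<Rightarrow> nat list \<Rightarrow> (nat list \<Rightarrow> nat list) set" where
  "front_stab n pos N w = {y \<in> St N. \<forall>w'\<in>level m n. pos w' < pos w \<longrightarrow> (\<forall>v\<in>below m (Suc N) w'. y v = v)}"

text \<open>This is \<open>l(w)\<close> for the layer from level \<open>N\<close> to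
  \<open>Suc N\<close>: the order of the factor at \<open>w\<close> when \<open>St N\<close> is
  filtered by the order of level \<open>n\<close>. The level \<open>n\<close> stays fixed while
  \<open>N\<close> grows.\<close>

definition lead_card :: "nat \<Rightarrow> (nat list \<Rightarrow> nat) \<Rightarrow> nat \<Rightarrow> nat list \<Rightarrow> nat" where
  "lead_card n pos N w = card ((\<lambda>y. restrict y (below m (Suc N) w)) ` front_stab n pos N w)"

definition front :: "nat \<Rightarrow> (nat list \<Rightarrow> nat) \<Rightarrow> nat \<Rightarrow> nat \<Rightarrow> nat list set" where
  "front n pos N k = {v \<in> level m (Suc N). pos (take n v) < k}"

lemma front_stab_St: "y \<in> front_stab n pos N w \<Longrightarrow> y \<in> St N"
  by (simp add: front_stab_def)

lemma id_front_stab: "id \<in> front_stab n pos N w"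
  by (simp add: front_stab_def)

lemma finite_lead: "finite ((\<lambda>y. restrict y (below m (Suc N) w)) ` front_stab n pos N w)"
  using St_mem by (intro finite_restrict_image[of _ _ "Suc N"]) (auto simp: front_stab_def below_def)

lemma lead_card_pos: "lead_card n pos N w > 0"
  unfolding lead_card_def using finite_lead id_front_stab by (metis card_gt_0_iff empty_iff image_is_empty)

lemma front_Suc:
  assumes "n \<le> Suc N"
  shows "w \<in> level m n \<Longrightarrow> inj_on pos (level m n) \<Longrightarrow> pos w = k \<Longrightarrow>
      front n pos N (Suc k) = front n pos N k \<union> below m (Suc N) w"
    and "(\<And>w. w \<in> level m n \<Longrightarrow> pos w \<noteq> k) \<Longrightarrow> front n pos N (Suc k) = front n pos N k"
proof -
  assume w: "w \<in> level m n" "inj_on pos (level m n)" "pos w = k"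
  have eq: "take n v = w \<longleftrightarrow> pos (take n v) = k" if "v \<in> level m (Suc N)" for v
    using inj_on_eq_iff[OF w(2) take_level[OF that assms] w(1)] w(3) by auto
  show "front n pos N (Suc k) = front n pos N k \<union> below m (Suc N) w"
  proof (rule Set.set_eqI)
    fix v
    show "v \<in> front n pos N (Suc k) \<longleftrightarrow> v \<in> front n pos N k \<union> below m (Suc N) w"
    proof (cases "v \<in> level m (Suc N)")
      case True
      then show ?thesis
        by (simp add: front_def below_iff[OF w(1)] less_Suc_eq eq[OF True])
    qed (simp add: front_def below_def)
  qed
next
  assume "\<And>w. w \<in> level m n \<Longrightarrow> pos w \<noteq> k"
  then show "front n pos N (Suc k) = front n pos N k"
    using take_level[OF _ assms, of _ m] by (auto simp: front_def less_Suc_eq)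
qed

lemma prod_front_Suc:
  fixes c :: "nat list \<Rightarrow> nat"
  shows "w \<in> level m n \<Longrightarrow> inj_on pos (level m n) \<Longrightarrow> pos w = k \<Longrightarrow>
      (\<Prod>w\<in>{w \<in> level m n. pos w < Suc k}. c w) = c w * (\<Prod>w\<in>{w \<in> level m n. pos w < k}. c w)"
    and "(\<And>w. w \<in> level m n \<Longrightarrow> pos w \<noteq> k) \<Longrightarrow>
      (\<Prod>w\<in>{w \<in> level m n. pos w < Suc k}. c w) = (\<Prod>w\<in>{w \<in> level m n. pos w < k}. c w)"
proof -
  assume w: "w \<in> level m n" "inj_on pos (level m n)" "pos w = k"
  have "{w \<in> level m n. pos w < Suc k} = insert w {w \<in> level m n. pos w < k}"
    using w by (auto simp: less_Suc_eq dest: inj_onD)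
  then show "(\<Prod>w\<in>{w \<in> level m n. pos w < Suc k}. c w) = c w * (\<Prod>w\<in>{w \<in> level m n. pos w < k}. c w)"
    using w(3) by simp
next
  assume "\<And>w. w \<in> level m n \<Longrightarrow> pos w \<noteq> k"
  then have "{w \<in> level m n. pos w < Suc k} = {w \<in> level m n. pos w < k}"
    by (auto simp: less_Suc_eq)
  then show "(\<Prod>w\<in>{w \<in> level m n. pos w < Suc k}. c w) = (\<Prod>w\<in>{w \<in> level m n. pos w < k}. c w)"
    by simp
qed

lemma take_St:
  assumes "y \<in> St n" "v \<in> level m N" "n \<le> N"
  shows "take n (y v) = take n v"
  using take_act_level[OF St_mem[OF assms(1)] assms(2)] St_fix[OF assms(1) take_level[OF assms(2,3)]] by simp

text \<open>Two elements of \<open>St N\<close> that act alike before \<open>w\<close> differ by an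
  element of \<open>front_stab\<close>, so an action on the vertices before \<open>w\<close> extends
  to those below \<open>w\<close> in at most \<open>lead_card\<close> ways.\<close>

lemma card_St_front_le:
  assumes inj: "inj_on pos (level m n)" and nN: "n \<le> N"
  shows "card ((\<lambda>y. restrict y (front n pos N k)) ` St N) \<le> (\<Prod>w\<in>{w \<in> level m n. pos w < k}. lead_card n pos N w)"
proof (induction k)
  case 0
  have "(\<lambda>y. restrict y (front n pos N 0)) ` St N = {\<lambda>_. undefined}"
    by (auto simp: front_def restrict_def intro!: image_eqI[OF _ St_id])
  then show ?case by (simp only: card.empty card.insert) simp
next
  case (Suc k)
  have nN': "n \<le> Suc N" using nN by simp
  show ?case
  \<comment> \<open>Positions need not be consecutive; an unoccupied one changes nothing.\<close>
  proof (cases "\<exists>w\<in>level m n. pos w = k")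
    case False
    then show ?thesis
      using Suc.IH front_Suc(2)[OF nN', of pos k] prod_front_Suc(2)[of n pos k "lead_card n pos N"] by auto
  next
    case True
    then obtain w where w: "w \<in> level m n" "pos w = k" by blast
    let ?A = "(\<lambda>y. restrict y (front n pos N (Suc k))) ` St N"
    let ?B = "(\<lambda>y. restrict y (front n pos N k)) ` St N"
    let ?f = "\<lambda>q. restrict q (front n pos N k)"
    note fr = front_Suc(1)[OF nN' w(1) inj w(2)]
    have finA: "finite ?A"
      using St_mem by (intro finite_restrict_image[of _ _ "Suc N"]) (auto simp: front_def)
    have comp: "?f (restrict y (front n pos N (Suc k))) = ?f y" for y
      unfolding fr by (rule restrict_ext) simp
    have "?f ` ?A = ?B" unfolding image_image comp ..
    moreover have "card {q \<in> ?A. ?f q = b} \<le> lead_card n pos N w" if "b \<in> ?B" for b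
    proof -
      from that obtain y0 where y0: "y0 \<in> St N" "b = ?f y0" by blast
      note y0G = St_mem[OF y0(1)]
      show ?thesis
        unfolding lead_card_def
      proof (rule card_inj_on_le[OF _ _ finite_lead])
        let ?g = "\<lambda>q. restrict (inv' y0 \<circ> q) (below m (Suc N) w)"
        show "inj_on ?g {q \<in> ?A. ?f q = b}"
        proof (rule inj_onI)
          fix p q assume p: "p \<in> {q \<in> ?A. ?f q = b}" and q: "q \<in> {q \<in> ?A. ?f q = b}" and eq: "?g p = ?g q"
          have "p v = q v" if "v \<in> front n pos N (Suc k)" for v
          proof (cases "v \<in> front n pos N k")
            case True
            have "?f p = ?f q" using p q by simp
            from fun_cong[OF this, of v] show ?thesis using True by simp
          next
            case False
            then have "v \<in> below m (Suc N) w" using that fr by simp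
            then have "inv' y0 (p v) = inv' y0 (q v)" using fun_cong[OF eq, of v] by simp
            then show ?thesis using eq_iff[OF inv_mem[OF y0G]] by simp
          qed
          then show "p = q" by (rule restrict_image_eqI[rotated 2]) (use p q in blast)+
        qed
        show "?g ` {q \<in> ?A. ?f q = b} \<subseteq> (\<lambda>y. restrict y (below m (Suc N) w)) ` front_stab n pos N w"
        proof
          fix p assume "p \<in> ?g ` {q \<in> ?A. ?f q = b}"
          then obtain y where y: "y \<in> St N" "?f (restrict y (front n pos N (Suc k))) = b"
            "p = ?g (restrict y (front n pos N (Suc k)))" by blast
          have yb: "?f y = ?f y0" using y(2) unfolding comp y0(2) .
          have "inv' y0 \<circ> y \<in> front_stab n pos N w"
            unfolding front_stab_def
          proof (intro CollectI conjI ballI impI)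
            show "inv' y0 \<circ> y \<in> St N" using St_comp[OF St_inv[OF y0(1)] y(1)] .
            fix w' v assume w': "w' \<in> level m n" "pos w' < pos w" "v \<in> below m (Suc N) w'"
            then have "v \<in> front n pos N k" using w(2) by (auto simp: front_def below_iff)
            then have "y v = y0 v" using fun_cong[OF yb, of v] by simp
            then show "(inv' y0 \<circ> y) v = v" using y0G by simp
          qed
          moreover have "p = restrict (inv' y0 \<circ> y) (below m (Suc N) w)"
            unfolding y(3) by (rule restrict_ext) (simp add: fr)
          ultimately show "p \<in> (\<lambda>y. restrict y (below m (Suc N) w)) ` front_stab n pos N w" by blast
        qed
      qed
    qed
    ultimately have "card ?A \<le> lead_card n pos N w * card ?B" by (rule card_le_fibers[OF finA])
    also have "\<dots> \<le> lead_card n pos N w * (\<Prod>w\<in>{w \<in> level m n. pos w < k}. lead_card n pos N w)"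
      by (rule mult_le_mono2[OF Suc.IH])
    finally show ?thesis unfolding prod_front_Suc(1)[OF w(1) inj w(2)] .
  qed
qed

section \<open>Extending products of commutators by one level\<close>

definition shifts :: "'e list \<Rightarrow> ('e \<Rightarrow> nat list \<Rightarrow> nat list) \<Rightarrow> nat \<Rightarrow> ('e \<Rightarrow> nat list \<Rightarrow> nat list) set" where
  "shifts es x N = {x'. \<forall>e\<in>set es. \<exists>y\<in>St N. x' e = x e \<circ> y}"

text \<open>For \<open>\<gamma>\<close> and \<open>x\<close> in \<open>G\<close>, shifting by
  \<open>St N\<close> does not change the product on level \<open>N\<close>; so these are extensions
  to level \<open>Suc N\<close> of a single action on level \<open>N\<close>.\<close>

abbreviation children ::
  "('e \<Rightarrow> nat list \<Rightarrow> nat list) \<Rightarrow> 'e list \<Rightarrow> ('e \<Rightarrow> nat list \<Rightarrow> nat list) \<Rightarrow> nat \<Rightarrow> (nat list \<Rightarrow> nat list) set"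
  where "children \<gamma> es x N \<equiv> (\<lambda>x'. restrict (comm_prod \<gamma> x' es) (level m (Suc N))) ` shifts es x N"

text \<open>
  For an edge \<open>e\<close> from \<open>w'\<close> to \<open>w\<close>, replacing \<open>x e\<close> by \<open>x e \<circ> s\<close>, where \<open>s\<close> acts trivially below the
  vertices preceding \<open>w'\<close>, changes the product below \<open>w\<close> according to the action of \<open>s\<close> below \<open>w'\<close>,
  and does not change it below the vertices preceding \<open>w\<close>.
\<close>

lemma card_comm_prod_front_ge:
  assumes S: "scheme n pos t E" and nN: "n \<le> N" and es: "set es = E" "distinct es"
    and \<gamma>: "\<And>u' u. (u', u) \<in> E \<Longrightarrow> \<gamma> (u', u) = t u \<circ> inv' (t u')"
    and x: "\<And>e. e \<in> E \<Longrightarrow> x e \<in> St n"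
    and c: "\<And>w. w \<in> level m n \<Longrightarrow> c w = 1 \<or> (\<exists>w'\<in>preds E w. c w = lead_card n pos N w')"
  shows "(\<Prod>w\<in>{w \<in> level m n. pos w < k}. c w) \<le>
    card ((\<lambda>x'. restrict (comm_prod \<gamma> x' es) (front n pos N k)) ` shifts es x N)"
proof (induction k)
  have x_shift: "x \<in> shifts es x N" unfolding shifts_def by (auto intro!: bexI[OF _ St_id])
  case 0
  have "(\<lambda>x'. restrict (comm_prod \<gamma> x' es) (front n pos N 0)) ` shifts es x N = {\<lambda>_. undefined}"
    by (auto simp: front_def restrict_def intro!: image_eqI[OF _ x_shift])
  then show ?case by (simp only: card.empty card.insert) simp
next
  case (Suc k)
  have nN': "n \<le> Suc N" using nN by simp
  have inj: "inj_on pos (level m n)" using S by (simp add: scheme_def)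
  have EX: "E \<subseteq> level m n \<times> level m n" using S by (simp add: scheme_def)
  have \<gamma>G: "\<gamma> e \<in> G" if "e \<in> E" for e
  proof -
    obtain u' u where e: "e = (u', u)" by force
    have "t u \<in> G" "t u' \<in> G" using S that EX e by (auto simp: scheme_def)
    then show ?thesis using \<gamma>[of u' u] that e comp_mem inv_mem by simp
  qed
  have shSt: "x' e \<in> St n" if sh: "x' \<in> shifts es x N" "e \<in> E" for x' e
  proof -
    obtain y where "y \<in> St N" "x' e = x e \<circ> y" using sh unfolding shifts_def es(1) by blast
    then show ?thesis using St_comp[OF x[OF sh(2)]] St_antimono[OF nN] by auto
  qed
  let ?A = "(\<lambda>x'. restrict (comm_prod \<gamma> x' es) (front n pos N (Suc k))) ` shifts es x N"
  let ?B = "(\<lambda>x'. restrict (comm_prod \<gamma> x' es) (front n pos N k)) ` shifts es x N"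
  let ?f = "\<lambda>q. restrict q (front n pos N k)"
  have finA: "finite ?A"
  proof -
    have "(\<lambda>x'. comm_prod \<gamma> x' es) ` shifts es x N \<subseteq> G"
      using comm_prod_mem[of es \<gamma>] \<gamma>G shSt St_mem es(1) by blast
    then have "finite ((\<lambda>g. restrict g (front n pos N (Suc k))) ` (\<lambda>x'. comm_prod \<gamma> x' es) ` shifts es x N)"
      by (rule finite_restrict_image[of _ _ "Suc N"]) (auto simp: front_def)
    then show ?thesis by (simp add: image_image)
  qed
  have sub: "front n pos N k \<subseteq> front n pos N (Suc k)" by (auto simp: front_def)
  have comp: "?f (restrict y (front n pos N (Suc k))) = ?f y" for y
    by (rule restrict_ext) (use sub in auto)
  have AB: "?f ` ?A = ?B" unfolding image_image comp ..
  have leAB: "card ?B \<le> card ?A" using card_image_le[OF finA, of ?f] AB by simp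
  show ?case
  proof (cases "\<exists>w\<in>level m n. pos w = k")
    case False
    then have "(\<Prod>w\<in>{w \<in> level m n. pos w < Suc k}. c w) = (\<Prod>w\<in>{w \<in> level m n. pos w < k}. c w)"
      by (intro prod_front_Suc(2)) auto
    then show ?thesis using Suc.IH leAB by linarith
  next
    case True
    then obtain w where w: "w \<in> level m n" "pos w = k" by blast
    note fr = front_Suc(1)[OF nN' w(1) inj w(2)]
    have "c w * card ?B \<le> card ?A"
    proof (cases "c w = 1")
      case True
      then show ?thesis using leAB by simp
    next
      case False
      then obtain w' where e: "(w', w) \<in> E" and cw: "c w = lead_card n pos N w'"
        using c[OF w(1)] by (auto simp: preds_def)
      define e where "e = (w', w)"
      have eE: "e \<in> E" using e by (simp add: e_def)
      define g where "g = \<gamma> e"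
      have gG: "g \<in> G" using \<gamma>G[OF eE] by (simp add: g_def)
      have w': "w' \<in> level m n" using EX e by auto
      have tG: "t w \<in> G" "t w' \<in> G" using S w' w(1) by (auto simp: scheme_def)
      have g_eq: "g = t w \<circ> inv' (t w')" using \<gamma>[OF e] by (simp add: g_def e_def)
      have rt: "inv' (t w') w' = inv' (t w) w" and plt: "pos w < pos w'"
        and order: "\<And>y. y \<in> level m n \<Longrightarrow> pos (g y) < pos w \<Longrightarrow> pos y < pos w'"
        using S e by (auto simp: scheme_def g_eq)
      have gw: "g w' = w" using rt tG by (simp add: g_eq)
      obtain as bs where split: "es = as @ e # bs" using eE es(1) split_list[of e es] by blast
      have nin: "e \<notin> set as" "e \<notin> set bs" using split es(2) by auto
      have "c w \<le> card {q \<in> ?A. ?f q = b}" if "b \<in> ?B" for b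
      proof -
        from that obtain x' where x': "x' \<in> shifts es x N" "b = ?f (comm_prod \<gamma> x' es)" by blast
        \<comment> \<open>Only the factor of the edge \<open>e\<close> will vary. \<open>P\<close>
          and \<open>Q\<close> collect the other factors; being in \<open>St n\<close> they preserve
          the blocks below level \<open>n\<close>.\<close>
        define P where "P = comm_prod \<gamma> x' as"
        define Q where "Q = comm_prod \<gamma> x' bs"
        have PQ: "P \<in> St n" "Q \<in> St n" unfolding P_def Q_def
          using split es(1) \<gamma>G shSt[OF x'(1)] by (auto intro!: comm_prod_St)
        have xe: "x' e \<in> St n" using shSt[OF x'(1) eE] .
        note xeG = St_mem[OF xe]
        let ?V = "\<lambda>s. P \<circ> commutator g (x' e \<circ> s) \<circ> Q"
        have upd: "comm_prod \<gamma> (x'(e := x' e \<circ> s)) es = ?V s" for s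
        proof -
          have "comm_prod \<gamma> (x'(e := x' e \<circ> s)) as = P" "comm_prod \<gamma> (x'(e := x' e \<circ> s)) bs = Q"
            unfolding P_def Q_def using nin by (auto intro: comm_prod_cong)
          then show ?thesis unfolding split comm_prod_append by (simp add: g_def comp_assoc)
        qed
        have upd_id: "comm_prod \<gamma> x' es = ?V id" using upd[of id] by simp
        have upd_sh: "x'(e := x' e \<circ> s) \<in> shifts es x N" if "s \<in> St N" for s
        proof -
          obtain y where "y \<in> St N" "x' e = x e \<circ> y" using x'(1) eE unfolding shifts_def es(1) by blast
          then have "y \<circ> s \<in> St N" "x' e \<circ> s = x e \<circ> (y \<circ> s)" using St_comp that by (auto simp: comp_assoc)
          then show ?thesis using x'(1) by (auto simp: shifts_def)
        qed
        \<comment> \<open>In the commutator \<open>s\<close> occurs once conjugated and once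
          inverted. Up to and including \<open>w\<close> the inverse acts trivially, since these
          vertices precede \<open>w'\<close>; only the conjugated copy remains.\<close>
        have V: "?V s v = P (g (x' e (s (inv' g (inv' (x' e) (Q v))))))"
          if s: "s \<in> front_stab n pos N w'" and v: "v \<in> front n pos N (Suc k)" for s v
        proof -
          have sG: "s \<in> G" using front_stab_St[OF s] St_mem by blast
          let ?v = "inv' (x' e) (Q v)"
          have vl: "v \<in> level m (Suc N)" "pos (take n v) < Suc k" using v by (auto simp: front_def)
          have Ql: "Q v \<in> level m (Suc N)" using level_iff[OF St_mem[OF PQ(2)]] vl by simp
          have l: "?v \<in> level m (Suc N)" using level_iff[OF inv_mem[OF xeG]] Ql by simp
          have "take n ?v = take n v"
            using take_St[OF St_inv[OF xe] Ql nN'] take_St[OF PQ(2) vl(1) nN'] by simp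
          then have "?v \<in> below m (Suc N) (take n v)"
            using l take_level[OF vl(1) nN'] by (simp add: below_iff)
          moreover have "pos (take n v) < pos w'" using vl plt w(2) by simp
          ultimately have "s ?v = ?v"
            using s take_level[OF vl(1) nN'] unfolding front_stab_def by blast
          then have "inv' s ?v = ?v" using inv_eq_iff[OF sG] by simp
          moreover have "inv' (x' e \<circ> s) = inv' s \<circ> inv' (x' e)" using comp_inv[OF xeG sG] .
          ultimately show ?thesis by (simp add: commutator_def)
        qed
        have pre_level: "inv' g (inv' (x' e) (Q v)) \<in> below m (Suc N) (inv' g (take n v))"
          if v: "v \<in> level m (Suc N)" for v
        proof -
          have Ql: "Q v \<in> level m (Suc N)" using level_iff[OF St_mem[OF PQ(2)]] v by simp
          have l: "inv' (x' e) (Q v) \<in> level m (Suc N)" using level_iff[OF inv_mem[OF xeG]] Ql by simp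
          have "take n (inv' (x' e) (Q v)) = take n v"
            using take_St[OF St_inv[OF xe] Ql nN'] take_St[OF PQ(2) v nN'] by simp
          then have "inv' (x' e) (Q v) \<in> below m (Suc N) (take n v)"
            using l take_level[OF v nN'] by (simp add: below_iff)
          then show ?thesis using below_act[OF inv_mem[OF gG]] by blast
        qed
        \<comment> \<open>Strictly before \<open>w\<close> the conjugated copy is trivial as well,
          because \<open>g\<close> pulls vertices preceding \<open>w\<close> back to vertices
          preceding \<open>w'\<close>.\<close>
        have keep: "?f (?V s) = b" if s: "s \<in> front_stab n pos N w'" for s
          unfolding x'(2) upd_id
        proof (rule restrict_ext)
          fix v assume v: "v \<in> front n pos N k"
          then have vl: "v \<in> level m (Suc N)" "pos (take n v) < pos w" using w(2) by (auto simp: front_def)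
          let ?y = "inv' g (take n v)"
          have yl: "?y \<in> level m n" using level_iff[OF inv_mem[OF gG]] take_level[OF vl(1) nN'] by simp
          have "pos ?y < pos w'" using order[OF yl] vl(2) gG by simp
          then have "s (inv' g (inv' (x' e) (Q v))) = inv' g (inv' (x' e) (Q v))"
            using s pre_level[OF vl(1)] yl unfolding front_stab_def by blast
          then show "?V s v = ?V id v"
            using V[OF s] V[OF id_front_stab] v sub by auto
        qed
        let ?L = "(\<lambda>y. restrict y (below m (Suc N) w')) ` front_stab n pos N w'"
        define pick where "pick = inv_into (front_stab n pos N w') (\<lambda>y. restrict y (below m (Suc N) w'))"
        have pick: "pick q \<in> front_stab n pos N w'" "restrict (pick q) (below m (Suc N) w') = q" if "q \<in> ?L" for q
          unfolding pick_def using inv_into_into[OF that] f_inv_into_f[OF that] by auto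
        let ?h = "\<lambda>q. restrict (?V (pick q)) (front n pos N (Suc k))"
        have "inj_on ?h ?L"
        proof (rule inj_onI)
          fix p q assume p: "p \<in> ?L" and q: "q \<in> ?L" and eq: "?h p = ?h q"
          have "p y = q y" if y: "y \<in> below m (Suc N) w'" for y
          proof -
            \<comment> \<open>The vertex at which the product evaluates \<open>s\<close> exactly at
              \<open>y\<close>.\<close>
            define v where "v = inv' Q (x' e (g y))"
            have QG: "Q \<in> G" using St_mem[OF PQ(2)] .
            have gyb: "g y \<in> below m (Suc N) w" using below_act[OF gG, of y "Suc N" w'] y gw by simp
            have xf: "x' e w = w" and qf: "inv' Q w = w" using St_fix[OF xe w(1)] St_fix_inv[OF PQ(2) w(1)] by auto
            have "x' e (g y) \<in> below m (Suc N) w" using below_act[OF xeG, of "g y" "Suc N" w] gyb xf by simp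
            then have vb: "v \<in> below m (Suc N) w"
              unfolding v_def using below_act[OF inv_mem[OF QG], of "x' e (g y)" "Suc N" w] qf by simp
            have pull: "inv' g (inv' (x' e) (Q v)) = y" unfolding v_def using QG xeG gG by simp
            have vf: "v \<in> front n pos N (Suc k)" using vb fr by simp
            have "?V (pick p) v = ?V (pick q) v" using fun_cong[OF eq, of v] vf by simp
            then have "P (g (x' e (pick p y))) = P (g (x' e (pick q y)))"
              unfolding V[OF pick(1)[OF p] vf] V[OF pick(1)[OF q] vf] pull .
            then have "pick p y = pick q y"
              using eq_iff[OF St_mem[OF PQ(1)]] eq_iff[OF gG] eq_iff[OF xeG] by simp
            then show ?thesis
              using fun_cong[OF pick(2)[OF p], of y] fun_cong[OF pick(2)[OF q], of y] y by simp
          qed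
          then show "p = q" by (rule restrict_image_eqI[rotated 2]) (use p q in blast)+
        qed
        moreover have "?h ` ?L \<subseteq> {q \<in> ?A. ?f q = b}"
        proof
          fix a assume "a \<in> ?h ` ?L"
          then obtain q where q: "q \<in> ?L" "a = ?h q" by blast
          have "a \<in> ?A" unfolding q(2) upd[symmetric]
            using upd_sh[OF front_stab_St[OF pick(1)[OF q(1)]]] by (rule imageI)
          moreover have "?f a = b" unfolding q(2) comp using keep[OF pick(1)[OF q(1)]] .
          ultimately show "a \<in> {q \<in> ?A. ?f q = b}" by simp
        qed
        ultimately have "card ?L \<le> card {q \<in> ?A. ?f q = b}"
          using finA by (intro card_inj_on_le) auto
        then show ?thesis unfolding cw lead_card_def .
      qed
      then show ?thesis by (rule card_ge_fibers[OF finA AB])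
    qed
    moreover have "c w * (\<Prod>w\<in>{w \<in> level m n. pos w < k}. c w) \<le> c w * card ?B"
      by (rule mult_le_mono2[OF Suc.IH])
    ultimately show ?thesis unfolding prod_front_Suc(1)[OF w(1) inj w(2)] by linarith
  qed
qed

text \<open>The element realising the edge conjugates \<open>front_stab\<close> at \<open>w'\<close>
  into \<open>front_stab\<close> at \<open>w\<close>, by the same order condition that makes its
  commutators usable.\<close>

lemma lead_card_mono:
  assumes S: "scheme n pos t E" and nN: "n \<le> N" and e: "(w', w) \<in> E"
  shows "lead_card n pos N w' \<le> lead_card n pos N w"
proof -
  have EX: "E \<subseteq> level m n \<times> level m n" using S by (simp add: scheme_def)
  have w: "w' \<in> level m n" "w \<in> level m n" using EX e by auto
  have tG: "t w \<in> G" "t w' \<in> G" using S w by (auto simp: scheme_def)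
  define g where "g = t w \<circ> inv' (t w')"
  have gG: "g \<in> G" unfolding g_def using comp_mem[OF tG(1) inv_mem[OF tG(2)]] .
  have rt: "inv' (t w') w' = inv' (t w) w"
    and order: "\<And>y. y \<in> level m n \<Longrightarrow> pos (g y) < pos w \<Longrightarrow> pos y < pos w'"
    using S e by (auto simp: scheme_def g_def)
  have gw: "g w' = w" using rt tG by (simp add: g_def)
  let ?b = "below m (Suc N)"
  let ?L = "\<lambda>w. (\<lambda>y. restrict y (?b w)) ` front_stab n pos N w"
  let ?h = "\<lambda>q. restrict (g \<circ> q \<circ> inv' g) (?b w)"
  have pull: "inv' g v \<in> ?b w'" if "v \<in> ?b w" for v
    using below_act[OF gG, of "inv' g v" "Suc N" w'] that gG gw by simp
  have "card (?L w') \<le> card (?L w)"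
  proof (rule card_inj_on_le[OF _ _ finite_lead])
    show "inj_on ?h (?L w')"
    proof (rule inj_onI)
      fix p q assume p: "p \<in> ?L w'" and q: "q \<in> ?L w'" and eq: "?h p = ?h q"
      have "p y = q y" if "y \<in> ?b w'" for y
      proof -
        have "g y \<in> ?b w" using below_act[OF gG, of y "Suc N" w'] that gw by simp
        then have "g (p y) = g (q y)" using fun_cong[OF eq, of "g y"] gG by simp
        then show ?thesis using eq_iff[OF gG] by simp
      qed
      then show "p = q" by (rule restrict_image_eqI[rotated 2]) (use p q in blast)+
    qed
    show "?h ` ?L w' \<subseteq> ?L w"
    proof
      fix a assume "a \<in> ?h ` ?L w'"
      then obtain y where y: "y \<in> front_stab n pos N w'" "a = ?h (restrict y (?b w'))" by blast
      have "a = restrict (g \<circ> y \<circ> inv' g) (?b w)"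
        unfolding y(2) by (rule restrict_ext) (simp add: pull)
      moreover have "g \<circ> y \<circ> inv' g \<in> front_stab n pos N w"
        unfolding front_stab_def
      proof (intro CollectI conjI ballI impI)
        show "g \<circ> y \<circ> inv' g \<in> St N" using St_conj[OF gG front_stab_St[OF y(1)]] .
        fix u v assume u: "u \<in> level m n" "pos u < pos w" "v \<in> ?b u"
        have ul: "inv' g u \<in> level m n" using level_iff[OF inv_mem[OF gG]] u(1) by simp
        then have "pos (inv' g u) < pos w'" using order[OF ul] u(2) gG by simp
        moreover have "inv' g v \<in> ?b (inv' g u)" using below_act[OF inv_mem[OF gG]] u(3) by blast
        ultimately have "y (inv' g v) = inv' g v" using y(1) ul unfolding front_stab_def by blast
        then show "(g \<circ> y \<circ> inv' g) v = v" using gG by simp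
      qed
      ultimately show "a \<in> ?L w" by blast
    qed
  qed
  then show ?thesis by (simp add: lead_card_def)
qed

section \<open>Bounding leading actions by labels\<close>

definition active :: "nat \<Rightarrow> nat list set" where
  "active N = {v \<in> level m N. \<exists>y\<in>St N. \<exists>c\<in>{1..m}. y (v @ [c]) \<noteq> v @ [c]}"

text \<open>On level \<open>Suc N\<close> an element of \<open>St N\<close> is determined by its
  labels on level \<open>N\<close>, and these are trivial outside \<open>active N\<close>.\<close>

lemma lead_card_le:
  assumes H: "finite H" "\<And>g v. g \<in> G \<Longrightarrow> v \<in> tree_words m \<Longrightarrow> tree_label g v \<in> H"
    and w: "w \<in> level m n" and nN: "n \<le> N"
  shows "lead_card n pos N w \<le> card H ^ card (active N \<inter> below m N w)"
proof -
  let ?A = "active N \<inter> below m N w"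
  let ?B = "below m (Suc N) w"
  let ?L = "(\<lambda>y. restrict y ?B) ` front_stab n pos N w"
  define pick where "pick = inv_into (front_stab n pos N w) (\<lambda>y. restrict y ?B)"
  have pick: "pick q \<in> front_stab n pos N w" "restrict (pick q) ?B = q" if "q \<in> ?L" for q
    unfolding pick_def using inv_into_into[OF that] f_inv_into_f[OF that] by auto
  have pickSt: "pick q \<in> St N" if "q \<in> ?L" for q using pick(1)[OF that] front_stab_St by blast
  have "card ?L \<le> card (PiE ?A (\<lambda>_. H))"
  proof (rule card_inj_on_le)
    let ?h = "\<lambda>q. restrict (tree_label (pick q)) ?A"
    show "inj_on ?h ?L"
    proof (rule inj_onI)
      fix p q assume p: "p \<in> ?L" and q: "q \<in> ?L" and eq: "?h p = ?h q"
      have "p y = q y" if y: "y \<in> ?B" for y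
      proof -
        have yl: "y \<in> level m (Suc N)" "take n y = w" using y w by (auto simp: below_iff)
        then obtain v c where vc: "y = v @ [c]" by (cases y rule: rev_cases) (auto simp: level_def)
        have v: "v \<in> level m N" "c \<in> {1..m}" using yl vc by (auto simp: level_def)
        have vw: "v @ [c] \<in> tree_words m" using yl vc by (simp add: level_def)
        have vb: "v \<in> below m N w" using v yl(2) vc nN w by (auto simp: below_iff level_def)
        have "pick p y = pick q y"
        proof (cases "v \<in> active N")
          case True
          have "tree_label (pick p) v = tree_label (pick q) v" using fun_cong[OF eq, of v] True vb by simp
          moreover have "pick p v = v" "pick q v = v" using St_fix[OF pickSt] p q v(1) by auto
          ultimately show ?thesis
            unfolding vc using tree_label[OF aut[OF St_mem[OF pickSt[OF p]]] vw]
              tree_label[OF aut[OF St_mem[OF pickSt[OF q]]] vw] by simp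
        next
          case False
          then have "s (v @ [c]) = v @ [c]" if "s \<in> St N" for s
            using v that unfolding active_def by blast
          then show ?thesis using pickSt[OF p] pickSt[OF q] unfolding vc by metis
        qed
        then show ?thesis using fun_cong[OF pick(2)[OF p], of y] fun_cong[OF pick(2)[OF q], of y] y by simp
      qed
      then show "p = q" by (rule restrict_image_eqI[rotated 2]) (use p q in blast)+
    qed
    show "?h ` ?L \<subseteq> PiE ?A (\<lambda>_. H)"
    proof
      fix a assume "a \<in> ?h ` ?L"
      then obtain q where q: "q \<in> ?L" "a = ?h q" by blast
      have "tree_label (pick q) v \<in> H" if "v \<in> ?A" for v
        using H(2)[OF St_mem[OF pickSt[OF q(1)]]] that by (simp add: below_def level_def)
      then show "a \<in> PiE ?A (\<lambda>_. H)" using q(2) by auto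
    qed
    show "finite (PiE ?A (\<lambda>_. H))" using H(1) by (intro finite_PiE) auto
  qed
  also have "\<dots> = card H ^ card ?A" by (simp add: card_PiE)
  finally show ?thesis by (simp add: lead_card_def)
qed

end

section \<open>The logarithmic loss of a scheme\<close>

lemma ln_of_nat_mono: "0 < a \<Longrightarrow> a \<le> b \<Longrightarrow> ln (real a) \<le> ln (real b)"
  by simp

context tree_group
begin

text \<open>An active vertex below \<open>fixed a n\<close> either has left the fixed set by level
  \<open>N\<close> or has a child outside it on level \<open>Suc N\<close>. Stability of the density
  bounds each of these losses by \<epsilon>, the second one on a level \<open>m\<close> times as
  large.\<close>

lemma card_active_over_fixed:
  assumes m: "m > 0" and an: "a \<le> n" and nN: "n \<le> N"
    and st: "\<And>k. fixed_frac a n \<le> fixed_frac a k + \<epsilon>"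
  shows "real (card {v \<in> active N. take n v \<in> fixed a n}) \<le> real m ^ N * ((1 + real m) * \<epsilon>)"
proof -
  let ?A1 = "{v \<in> level m N. take n v \<in> fixed a n} - fixed a N"
  let ?A2 = "active N \<inter> fixed a N"
  let ?B = "{v \<in> level m (Suc N). take N v \<in> fixed a N} - fixed a (Suc N)"
  have "\<forall>v\<in>?A2. \<exists>c. v @ [c] \<in> ?B"
  proof
    fix v assume v: "v \<in> ?A2"
    then obtain y c where yc: "y \<in> St N" "c \<in> {1..m}" "y (v @ [c]) \<noteq> v @ [c]" and vl: "v \<in> level m N"
      by (auto simp: active_def)
    have "y \<in> St a" using yc(1) St_antimono[of a N] an nN by auto
    then have "v @ [c] \<notin> fixed a (Suc N)" using yc(3) by (auto simp: fixed_def)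
    moreover have "v @ [c] \<in> level m (Suc N)" "take N (v @ [c]) = v" using vl yc(2) by (auto simp: level_def)
    ultimately show "\<exists>c. v @ [c] \<in> ?B" using v by auto
  qed
  then obtain c where c: "\<And>v. v \<in> ?A2 \<Longrightarrow> v @ [c v] \<in> ?B" by metis
  have "card ?A2 \<le> card ?B"
  proof (rule card_inj_on_le)
    show "inj_on (\<lambda>v. v @ [c v]) ?A2" by (rule inj_onI) simp
    show "(\<lambda>v. v @ [c v]) ` ?A2 \<subseteq> ?B" using c by blast
  qed simp
  then have "real (card ?A2) \<le> real m ^ Suc N * (fixed_frac a N - fixed_frac a (Suc N))"
    unfolding card_over_fixed_frac[of N "Suc N" a, OF le_SucI[OF order_refl] m, symmetric] by simp
  also have "\<dots> \<le> real m ^ Suc N * \<epsilon>"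
    using st[of "Suc N"] fixed_frac_antimono[OF m nN, of a] by (intro mult_left_mono) auto
  finally have 2: "real (card ?A2) \<le> real m ^ Suc N * \<epsilon>" .
  have "real (card ?A1) = real m ^ N * (fixed_frac a n - fixed_frac a N)"
    by (rule card_over_fixed_frac[OF nN m])
  also have "\<dots> \<le> real m ^ N * \<epsilon>" using st[of N] by (intro mult_left_mono) auto
  finally have 1: "real (card ?A1) \<le> real m ^ N * \<epsilon>" .
  have "card {v \<in> active N. take n v \<in> fixed a n} \<le> card (?A1 \<union> ?A2)"
    by (rule card_mono) (auto simp: active_def)
  also have "\<dots> \<le> card ?A1 + card ?A2" by (rule card_Un_le)
  finally have "real (card {v \<in> active N. take n v \<in> fixed a n}) \<le> real (card ?A1) + real (card ?A2)"
    by linarith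
  also have "\<dots> \<le> real m ^ N * \<epsilon> + real m ^ Suc N * \<epsilon>" using 1 2 by linarith
  finally show ?thesis by (simp add: algebra_simps)
qed

lemma sum_best_pred_le_ln_card:
  assumes S: "scheme n pos t E" and nN: "n \<le> N" and es: "set es = E" "distinct es"
    and \<gamma>: "\<And>u' u. (u', u) \<in> E \<Longrightarrow> \<gamma> (u', u) = t u \<circ> inv' (t u')"
    and x: "\<And>e. e \<in> E \<Longrightarrow> x e \<in> St n"
  shows "(\<Sum>w\<in>level m n. best_pred E (\<lambda>w. ln (lead_card n pos N w)) w) \<le>
    ln (card (children \<gamma> es x N))"
proof -
  let ?f = "\<lambda>w. ln (real (lead_card n pos N w))"
  have EX: "E \<subseteq> level m n \<times> level m n" using S by (simp add: scheme_def)
  \<comment> \<open>Each vertex uses its best predecessor, or the factor 1 if it has none, in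
    accordance with the default of \<open>best_pred\<close>.\<close>
  have "\<exists>c. (c = 1 \<or> (\<exists>w'\<in>preds E w. c = lead_card n pos N w')) \<and> ln (real c) = best_pred E ?f w" for w
  proof (cases "preds E w = {}")
    case True
    then show ?thesis by (intro exI[of _ 1]) (simp add: best_pred_def)
  next
    case False
    have "preds E w \<subseteq> level m n" using EX by (auto simp: preds_def)
    then have "finite (preds E w)" by (rule finite_subset) simp
    then have "Max (?f ` preds E w) \<in> ?f ` preds E w" using False by (intro Max_in) auto
    then show ?thesis using False by (auto simp: best_pred_def)
  qed
  then obtain c where c: "\<And>w. c w = 1 \<or> (\<exists>w'\<in>preds E w. c w = lead_card n pos N w')"
    and lnc: "\<And>w. ln (real (c w)) = best_pred E ?f w" by metis
  have cpos: "c w > 0" for w using c[of w] lead_card_pos by auto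
  obtain K where K: "\<And>w. w \<in> level m n \<Longrightarrow> pos w < K"
    using finite_imageI[OF finite_level, of pos m n] unfolding finite_nat_set_iff_bounded by blast
  have fr: "front n pos N K = level m (Suc N)"
    using K take_level[of _ m "Suc N" n] nN by (auto simp: front_def)
  have lv: "{w \<in> level m n. pos w < K} = level m n" using K by blast
  have "(\<Prod>w\<in>level m n. c w) \<le> card (children \<gamma> es x N)"
    using card_comm_prod_front_ge[OF S nN es, where k = K and \<gamma> = \<gamma> and x = x and c = c] \<gamma> x c unfolding fr lv by blast
  moreover have "0 < (\<Prod>w\<in>level m n. c w)" using cpos by (simp add: prod_pos)
  ultimately have "ln (real (\<Prod>w\<in>level m n. c w)) \<le>
      ln (real (card (children \<gamma> es x N)))"
    by (intro ln_of_nat_mono)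
  moreover have "ln (real (\<Prod>w\<in>level m n. c w)) = (\<Sum>w\<in>level m n. best_pred E ?f w)"
    using cpos by (simp add: ln_prod lnc)
  ultimately show ?thesis by simp
qed

lemma ln_card_St_le:
  assumes S: "scheme n pos t E" and nN: "n \<le> N"
  shows "ln (card ((\<lambda>y. restrict y (level m (Suc N))) ` St N)) \<le> (\<Sum>w\<in>level m n. ln (lead_card n pos N w))"
proof -
  have inj: "inj_on pos (level m n)" using S by (simp add: scheme_def)
  obtain K where K: "\<And>w. w \<in> level m n \<Longrightarrow> pos w < K"
    using finite_imageI[OF finite_level, of pos m n] unfolding finite_nat_set_iff_bounded by blast
  have fr: "front n pos N K = level m (Suc N)"
    using K take_level[of _ m "Suc N" n] nN by (auto simp: front_def)
  have lv: "{w \<in> level m n. pos w < K} = level m n" using K by blast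
  let ?A = "(\<lambda>y. restrict y (level m (Suc N))) ` St N"
  have le: "card ?A \<le> (\<Prod>w\<in>level m n. lead_card n pos N w)"
    using card_St_front_le[OF inj nN, of K] unfolding fr lv .
  have "finite ?A" using St_mem by (intro finite_restrict_image[of _ _ "Suc N"]) auto
  moreover have "?A \<noteq> {}" using St_id by blast
  ultimately have "card ?A > 0" by (simp only: card_gt_0_iff simp_thms)
  from ln_of_nat_mono[OF this le]
  have "ln (real (card ?A)) \<le> ln (real (\<Prod>w\<in>level m n. lead_card n pos N w))" .
  also have "\<dots> = (\<Sum>w\<in>level m n. ln (lead_card n pos N w))" by (simp add: ln_prod lead_card_pos)
  finally show ?thesis .
qed

text \<open>\<open>k\<close> is the number of predecessors aimed at and \<open>10 * k\<close> the
  number of refinements. Ten refinements per predecessor suffice since \<open>2 * (7/8) ^ 10\<close>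
  is less than 1, which beats the weight \<open>2 ^ k\<close>; the excess is only of order
  \<open>sqrt (10 * k)\<close>, negligible against \<open>k\<close>.\<close>

lemma exists_small_parameters:
  fixes \<eta> :: real
  assumes "\<eta> > 0"
  shows "\<exists>k>0. 2 ^ k * (7/8) ^ (10 * k) \<le> \<eta> / 4 \<and> sqrt (10 * k) / k \<le> \<eta> / 4"
proof -
  have q: "(2 * (7/8) ^ 10 :: real) < 1" "(0::real) \<le> 2 * (7/8) ^ 10" by (simp_all add: power_divide)
  obtain k0 where k0: "(2 * (7/8) ^ 10 :: real) ^ k0 < \<eta> / 4"
    using real_arch_pow_inv[of "\<eta> / 4" "2 * (7/8) ^ 10"] q assms by auto
  \<comment> \<open>Squaring turns \<open>sqrt (10 * k) / k \<le> \<eta> / 4\<close> into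
    \<open>k \<ge> 160 / \<eta>\<^sup>2\<close>.\<close>
  obtain k1 :: nat where k1: "160 / \<eta>\<^sup>2 \<le> k1" using real_arch_simple by blast
  define k where "k = max 1 (max k0 k1)"
  have k: "k > 0" "k0 \<le> k" "160 / \<eta>\<^sup>2 \<le> k" using k1 by (auto simp: k_def)
  have "(2::real) ^ k * (7/8) ^ (10 * k) = (2 * (7/8) ^ 10) ^ k" by (simp only: power_mult power_mult_distrib)
  also have "\<dots> \<le> (2 * (7/8) ^ 10) ^ k0" using q k(2) by (intro power_decreasing) auto
  finally have 1: "(2::real) ^ k * (7/8) ^ (10 * k) \<le> \<eta> / 4" using k0 by linarith
  have "160 \<le> k * \<eta>\<^sup>2" using k(3) assms by (simp add: pos_divide_le_eq)
  then have "10 * real k \<le> (\<eta> / 4 * k)\<^sup>2"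
    using k(1) by (simp add: power2_eq_square field_simps)
  then have "sqrt (10 * k) \<le> \<eta> / 4 * k"
    using assms by (intro real_le_lsqrt) auto
  then have "sqrt (10 * k) / k \<le> \<eta> / 4" using k(1) by (simp add: pos_divide_le_eq)
  then show ?thesis using 1 k(1) by blast
qed

text \<open>The edges and the elements \<open>\<gamma>\<close> come from one level and serve all
  later \<open>N\<close>; only the functions \<open>ln\<close> of \<open>lead_card\<close> change
  with \<open>N\<close>. All errors are measured against \<open>ln (card H) * m ^ N\<close>, the
  contribution of one label from \<open>H\<close> at each vertex of level \<open>N\<close>.\<close>

lemma exists_branching:
  assumes m: "m > 0" and H: "finite H" "\<And>g v. g \<in> G \<Longrightarrow> v \<in> tree_words m \<Longrightarrow> tree_label g v \<in> H"
    and \<eta>: "\<eta> > 0"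
  shows "\<exists>n (es :: (nat list \<times> nat list) list) \<gamma>. (\<forall>e\<in>set es. \<gamma> e \<in> G) \<and>
    (\<forall>N\<ge>n. \<forall>x. (\<forall>e\<in>set es. x e \<in> St n) \<longrightarrow>
      ln (card ((\<lambda>y. restrict y (level m (Suc N))) ` St N)) - \<eta> * ln (card H) * m ^ N \<le>
      ln (card (children \<gamma> es x N)))"
proof -
  obtain k :: nat where k: "k > 0" "2 ^ k * (7/8) ^ (10 * k) \<le> \<eta> / 4" "sqrt (10 * k) / k \<le> \<eta> / 4"
    using exists_small_parameters[OF \<eta>] by blast
  \<comment> \<open>The first bound is for the active vertices below \<open>fixed a n\<close>, the
    second for the error \<open>16 * \<epsilon>\<close> of the potential, which enters with weight
    \<open>2 ^ k\<close>.\<close>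
  define \<epsilon> where "\<epsilon> = min (\<eta> / (4 * (1 + real m))) (\<eta> / (64 * 2 ^ k))"
  have e: "\<epsilon> > 0" using \<eta> by (simp add: \<epsilon>_def)
  have e1: "(1 + real m) * \<epsilon> \<le> \<eta> / 4"
  proof -
    have "(1 + real m) * \<epsilon> \<le> (1 + real m) * (\<eta> / (4 * (1 + real m)))" unfolding \<epsilon>_def by (intro mult_left_mono) auto
    also have "\<dots> = \<eta> / 4" by (simp add: field_simps)
    finally show ?thesis .
  qed
  have e2: "2 ^ k * (16 * \<epsilon>) \<le> \<eta> / 4"
  proof -
    have "2 ^ k * (16 * \<epsilon>) \<le> 2 ^ k * (16 * (\<eta> / (64 * 2 ^ k)))" unfolding \<epsilon>_def by (intro mult_left_mono) auto
    also have "\<dots> = \<eta> / 4" by simp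
    finally show ?thesis .
  qed
  obtain a n0 where a: "a \<le> n0" "\<And>n. fixed_frac a n0 \<le> fixed_frac a n + \<epsilon>"
    "\<And>k. \<exists>n\<ge>k. \<forall>n'. fixed_frac k n \<le> fixed_frac a n' + 2 * \<epsilon>"
    using fixed_frac_stabilise[OF m e] by blast
  obtain n pos t E where n: "n0 \<le> n" and S: "scheme n pos t E"
    and sq: "(\<Sum>v\<in>level m n. (excess E v)\<^sup>2) \<le> real (10 * k) * m ^ n"
    and pot: "(\<Sum>v\<in>level m n - fixed a n. (1/2) ^ card (preds E v)) \<le> ((7/8) ^ (10 * k) + 16 * \<epsilon>) * real m ^ n"
    using exists_scheme[OF m e a, of "10 * k"] by blast
  have EX: "E \<subseteq> level m n \<times> level m n" using S by (simp add: scheme_def)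
  have tG: "t u \<in> G" if "u \<in> level m n" for u using S that by (auto simp: scheme_def)
  have finE: "finite E" using EX by (rule finite_subset) simp
  obtain es where es: "set es = E" "distinct es" using finite_distinct_list[OF finE] by blast
  define \<gamma> where "\<gamma> e = t (snd e) \<circ> inv' (t (fst e))" for e
  have \<gamma>G: "\<forall>e\<in>set es. \<gamma> e \<in> G"
    unfolding \<gamma>_def es(1) using EX by (auto intro!: comp_mem inv_mem tG)
  have st: "fixed_frac a n \<le> fixed_frac a j + \<epsilon>" for j
    using a(2)[of j] fixed_frac_antimono[OF m n, of a] by linarith
  have H1: "card H \<ge> 1"
  proof -
    have "tree_label id [] \<in> H" using H(2)[OF id_mem] by simp
    then show ?thesis using H(1) by (metis One_nat_def Suc_leI card_gt_0_iff empty_iff)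
  qed
  define b where "b = ln (real (card H))"
  have b: "b \<ge> 0" using H1 by (simp add: b_def)
  have "ln (card ((\<lambda>y. restrict y (level m (Suc N))) ` St N)) - \<eta> * ln (card H) * m ^ N \<le>
      ln (card (children \<gamma> es x N))"
    if nN: "n \<le> N" and x: "\<forall>e\<in>set es. x e \<in> St n" for N x
  proof -
    define f where "f w = ln (real (lead_card n pos N w))" for w
    \<comment> \<open>The trivial bound: one label from \<open>H\<close> for each vertex of level
      \<open>N\<close> below \<open>w\<close>.\<close>
    define C where "C = b * real m ^ (N - n)"
    have pw: "real m ^ N = real m ^ (N - n) * real m ^ n" using nN by (simp add: power_add[symmetric])
    have f0: "0 \<le> f w" for w using lead_card_pos[of n pos N w] by (simp add: f_def)
    have f_le: "f w \<le> b * card (active N \<inter> below m N w)" if "w \<in> level m n" for w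
    proof -
      have "f w \<le> ln (real (card H ^ card (active N \<inter> below m N w)))"
        unfolding f_def by (intro ln_of_nat_mono lead_card_pos lead_card_le H that nN)
      then show ?thesis using H1 by (simp add: ln_realpow b_def mult.commute)
    qed
    have fC: "f w \<le> C" if w: "w \<in> level m n" for w
    proof -
      have "card (active N \<inter> below m N w) \<le> m ^ (N - n)"
        using card_mono[OF finite_below, of "active N \<inter> below m N w" m N w] card_below[OF w nN] by simp
      then have "real (card (active N \<inter> below m N w)) \<le> real m ^ (N - n)" by (simp flip: of_nat_power)
      then show ?thesis using f_le[OF w] mult_left_mono[OF _ b] unfolding C_def by (meson order_trans)
    qed
    have mono: "f w' \<le> f w" if "(w', w) \<in> E" for w w'
      using lead_card_mono[OF S nN that] lead_card_pos[of n pos N] by (simp add: f_def)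
    have loss: "(\<Sum>u\<in>level m n. f u - best_pred E f u) \<le>
      (\<Sum>u\<in>fixed a n. f u) + C * 2 ^ k * (\<Sum>u\<in>level m n - fixed a n. (1/2) ^ card (preds E u)) +
        C / k * sqrt (real (10 * k)) * card (level m n)"
      by (rule sum_loss_le) (use EX f0 fC mono fixed_level sq k(1) b in \<open>auto simp: C_def card_level\<close>)
    have bl: "below m N u = {v \<in> level m N. take n v = u}" if "u \<in> fixed a n" for u
      using that fixed_level below_iff by blast
    have "(\<Sum>u\<in>fixed a n. f u) \<le> (\<Sum>u\<in>fixed a n. b * card (active N \<inter> below m N u))"
      using f_le fixed_level by (intro sum_mono) blast
    also have "\<dots> = b * real (\<Sum>u\<in>fixed a n. card (active N \<inter> below m N u))" by (simp add: sum_distrib_left)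
    also have "(\<Sum>u\<in>fixed a n. card (active N \<inter> below m N u)) = card (\<Union>u\<in>fixed a n. active N \<inter> below m N u)"
    proof (rule card_UN_disjoint[symmetric])
      show "\<forall>i\<in>fixed a n. \<forall>j\<in>fixed a n. i \<noteq> j \<longrightarrow> active N \<inter> below m N i \<inter> (active N \<inter> below m N j) = {}"
        by (auto simp: bl)
    qed auto
    also have "(\<Union>u\<in>fixed a n. active N \<inter> below m N u) = {v \<in> active N. take n v \<in> fixed a n}"
      by (auto simp: bl active_def)
    also have "b * real (card {v \<in> active N. take n v \<in> fixed a n}) \<le> b * (real m ^ N * (\<eta> / 4))"
    proof (rule mult_left_mono[OF _ b])
      have "real (card {v \<in> active N. take n v \<in> fixed a n}) \<le> real m ^ N * ((1 + real m) * \<epsilon>)"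
        using a(1) n by (intro card_active_over_fixed[OF m _ nN st]) simp
      also have "\<dots> \<le> real m ^ N * (\<eta> / 4)" using e1 by (intro mult_left_mono) auto
      finally show "real (card {v \<in> active N. take n v \<in> fixed a n}) \<le> real m ^ N * (\<eta> / 4)" .
    qed
    finally have 1: "(\<Sum>u\<in>fixed a n. f u) \<le> b * real m ^ N * (\<eta> / 4)" by simp
    have "C * 2 ^ k * (\<Sum>u\<in>level m n - fixed a n. (1/2) ^ card (preds E u)) \<le>
        C * 2 ^ k * (((7/8) ^ (10 * k) + 16 * \<epsilon>) * real m ^ n)"
      using b by (intro mult_left_mono[OF pot]) (simp add: C_def)
    also have "\<dots> = b * real m ^ N * (2 ^ k * (7/8) ^ (10 * k) + 2 ^ k * (16 * \<epsilon>))"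
      by (simp add: C_def pw algebra_simps)
    also have "\<dots> \<le> b * real m ^ N * (\<eta> / 4 + \<eta> / 4)"
      using k(2) e2 b by (intro mult_left_mono add_mono) auto
    finally have 2: "C * 2 ^ k * (\<Sum>u\<in>level m n - fixed a n. (1/2) ^ card (preds E u)) \<le>
        b * real m ^ N * (\<eta> / 2)" by simp
    have "C / k * sqrt (real (10 * k)) * card (level m n) = b * real m ^ N * (sqrt (10 * k) / k)"
      by (simp add: C_def card_level pw)
    also have "\<dots> \<le> b * real m ^ N * (\<eta> / 4)" using k(3) b by (intro mult_left_mono) auto
    finally have 3: "C / k * sqrt (real (10 * k)) * card (level m n) \<le> b * real m ^ N * (\<eta> / 4)" .
    have "(\<Sum>u\<in>level m n. f u - best_pred E f u) \<le>
        b * real m ^ N * (\<eta> / 4) + b * real m ^ N * (\<eta> / 2) + b * real m ^ N * (\<eta> / 4)"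
      using loss 1 2 3 by linarith
    also have "\<dots> = b * real m ^ N * \<eta>" by simp
    finally have "(\<Sum>u\<in>level m n. f u - best_pred E f u) \<le> b * real m ^ N * \<eta>" .
    then have "(\<Sum>u\<in>level m n. f u) - b * real m ^ N * \<eta> \<le> (\<Sum>u\<in>level m n. best_pred E f u)"
      by (simp add: sum_subtractf)
    moreover have "(\<Sum>u\<in>level m n. best_pred E f u) \<le>
        ln (card (children \<gamma> es x N))"
      unfolding f_def using x es by (intro sum_best_pred_le_ln_card[OF S nN es]) (auto simp: \<gamma>_def)
    moreover have "ln (card ((\<lambda>y. restrict y (level m (Suc N))) ` St N)) \<le> (\<Sum>u\<in>level m n. f u)"
      unfolding f_def by (rule ln_card_St_le[OF S nN])
    ultimately show ?thesis by (simp add: b_def mult.commute mult.left_commute)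
  qed
  then show ?thesis using \<gamma>G by blast
qed

end

section \<open>Points outside a light cover\<close>

lemma tree_automorphism_limit:
  assumes F: "\<And>n. tree_automorphism m (F n)"
    and lim: "\<And>n v. length v \<le> n \<Longrightarrow> F n v = g v"
  shows "tree_automorphism m g"
proof -
  have gF: "g v = F n v" if "length v \<le> n" for n v using lim[OF that] by simp
  have inj: "inj g"
  proof (rule injI)
    fix u v assume "g u = g v"
    then have "F (max (length u) (length v)) u = F (max (length u) (length v)) v"
      using gF[of u "max (length u) (length v)"] gF[of v "max (length u) (length v)"] by simp
    moreover have "inj (F (max (length u) (length v)))"
      using F permutes_inj unfolding tree_automorphism_def by blast
    ultimately show "u = v" by (simp add: inj_eq)
  qed
  have img: "g ` tree_words m = tree_words m"
  proof (intro equalityI subsetI)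
    fix w assume "w \<in> g ` tree_words m"
    then obtain v where "v \<in> tree_words m" "w = F (length v) v" using gF[OF order_refl] by blast
    then show "w \<in> tree_words m" using tree_automorphism_words[OF F] by blast
  next
    fix w assume w: "w \<in> tree_words m"
    have "F (length w) permutes tree_words m" using F by (simp add: tree_automorphism_def)
    then obtain v where v: "v \<in> tree_words m" "F (length w) v = w"
      using w by (metis imageE permutes_image)
    then have "length v = length w" using tree_automorphism_length[OF F, of "length w" v] by simp
    then have "g v = w" using gF[of v "length w"] v(2) by simp
    then show "w \<in> g ` tree_words m" using v(1) by blast
  qed
  have outside: "g v = v" if "v \<notin> tree_words m" for v
    using gF[of v "length v"] tree_automorphism_outside[OF F that] by simp
  have "bij_betw g (tree_words m) (tree_words m)"
    unfolding bij_betw_def using inj_on_subset[OF inj subset_UNIV] img by blast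
  then have "g permutes tree_words m" using outside by (rule bij_imp_permutes)
  moreover have "g [] = []" using gF[of "[]" 0] F by (simp add: tree_automorphism_def)
  moreover have "tree_adj (g u) (g v) \<longleftrightarrow> tree_adj u v" if uv: "u \<in> tree_words m" "v \<in> tree_words m" for u v
  proof -
    let ?n = "max (length u) (length v)"
    have "tree_adj (F ?n u) (F ?n v) \<longleftrightarrow> tree_adj u v"
      using F[of ?n] uv unfolding tree_automorphism_def by blast
    then show ?thesis using gF[of u ?n] gF[of v ?n] by simp
  qed
  ultimately show ?thesis by (simp add: tree_automorphism_def)
qed

context tree_group
begin

lemma St_subset: "St n \<subseteq> G"
  by (simp add: level_stab_def)

lemma St_short:
  assumes y: "y \<in> St k" and v: "length v \<le> k"
  shows "y v = v"
proof (cases "v \<in> tree_words m")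
  case True
  then show ?thesis
    using St_antimono[OF v] y by (auto simp: level_def intro!: St_fix[of y "length v"])
next
  case False
  then show ?thesis using tree_automorphism_outside[OF aut[OF St_mem[OF y]]] by blast
qed

section \<open>Orders of the finite quotients and the choice of a branch\<close>

definition level_order :: "nat \<Rightarrow> nat" where
  "level_order n = card ((\<lambda>g. restrict g (level m n)) ` G)"

lemma level_order_pos: "level_order n > 0"
proof -
  have "finite ((\<lambda>g. restrict g (level m n)) ` G)" by (rule finite_restrict_image) auto
  moreover have "(\<lambda>g. restrict g (level m n)) ` G \<noteq> {}" using id_mem by blast
  ultimately show ?thesis unfolding level_order_def by (simp only: card_gt_0_iff simp_thms)
qed

lemma restrict_level_mono:
  assumes gh: "g \<in> G" "h \<in> G" and eq: "restrict g (level m n) = restrict h (level m n)" and k: "k \<le> n"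
  shows "restrict g (level m k) = restrict h (level m k)"
proof -
  have "inv' h \<circ> g \<in> St n"
  proof (rule St_I)
    fix v assume "v \<in> level m n"
    then have "g v = h v" using fun_cong[OF eq, of v] by simp
    then show "(inv' h \<circ> g) v = v" using gh by simp
  qed (use gh comp_mem inv_mem in blast)
  then have "inv' h \<circ> g \<in> St k" using St_antimono[OF k] by blast
  then have "inv' h (g v) = v" if "v \<in> level m k" for v using St_fix[of "inv' h \<circ> g" k v] that by simp
  then have "g v = h v" if "v \<in> level m k" for v using gh that inv_eq_iff by metis
  then show ?thesis by (intro restrict_ext)
qed

lemma level_order_Suc_le:
  "level_order (Suc n) \<le> card ((\<lambda>y. restrict y (level m (Suc n))) ` St n) * level_order n"
proof -
  let ?A = "(\<lambda>g. restrict g (level m (Suc n))) ` G"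
  let ?S = "(\<lambda>y. restrict y (level m (Suc n))) ` St n"
  define rep where "rep = inv_into G (\<lambda>g. restrict g (level m (Suc n)))"
  have rep: "rep a \<in> G" "restrict (rep a) (level m (Suc n)) = a" if "a \<in> ?A" for a
    unfolding rep_def using inv_into_into[OF that] f_inv_into_f[OF that] by auto
  have finA: "finite ?A" by (rule finite_restrict_image) auto
  have finS: "finite ?S" by (rule finite_restrict_image[OF St_subset order_refl])
  let ?f = "\<lambda>a. restrict (rep a) (level m n)"
  have f_eq: "?f (restrict g (level m (Suc n))) = restrict g (level m n)" if "g \<in> G" for g
  proof -
    have a: "restrict g (level m (Suc n)) \<in> ?A" using that by (rule imageI)
    show ?thesis by (rule restrict_level_mono[OF rep(1)[OF a] that rep(2)[OF a]]) simp
  qed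
  have "?f ` ?A = (\<lambda>g. restrict g (level m n)) ` G" unfolding image_image by (rule image_cong[OF refl f_eq])
  moreover have "card {a \<in> ?A. ?f a = b} \<le> card ?S" if "b \<in> (\<lambda>g. restrict g (level m n)) ` G" for b
  proof -
    from that obtain g0 where g0: "g0 \<in> G" "b = restrict g0 (level m n)" by blast
    show ?thesis
    proof (rule card_inj_on_le[OF _ _ finS])
      let ?h = "\<lambda>a. restrict (inv' g0 \<circ> rep a) (level m (Suc n))"
      show "inj_on ?h {a \<in> ?A. ?f a = b}"
      proof (rule inj_onI)
        fix p q assume p: "p \<in> {a \<in> ?A. ?f a = b}" and q: "q \<in> {a \<in> ?A. ?f a = b}" and eq: "?h p = ?h q"
        have "rep p v = rep q v" if "v \<in> level m (Suc n)" for v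
          using fun_cong[OF eq, of v] that eq_iff[OF inv_mem[OF g0(1)]] by simp
        then have "restrict (rep p) (level m (Suc n)) = restrict (rep q) (level m (Suc n))"
          by (intro restrict_ext)
        then show "p = q" using rep(2)[of p] rep(2)[of q] p q by simp
      qed
      show "?h ` {a \<in> ?A. ?f a = b} \<subseteq> ?S"
      proof
        fix z assume "z \<in> ?h ` {a \<in> ?A. ?f a = b}"
        then obtain a where a: "a \<in> ?A" "?f a = b" "z = ?h a" by blast
        have "inv' g0 \<circ> rep a \<in> St n"
        proof (rule St_I)
          fix v assume "v \<in> level m n"
          then have "rep a v = g0 v" using fun_cong[OF a(2), of v] g0(2) by simp
          then show "(inv' g0 \<circ> rep a) v = v" using g0(1) by simp
        qed (use comp_mem inv_mem g0 rep a in blast)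
        then show "z \<in> ?S" using a(3) by blast
      qed
    qed
  qed
  ultimately show ?thesis unfolding level_order_def by (rule card_le_fibers[OF finA])
qed

text \<open>Choosing, at each level, a child which meets less than its share of the weight of the cover
  leads to a point outside the cover.\<close>

lemma branch_avoid:
  fixes C :: "nat \<Rightarrow> (nat list \<Rightarrow> nat list) set" and l :: "nat \<Rightarrow> nat" and es :: "'e list"
  assumes closed: "\<And>g. tree_automorphism m g \<Longrightarrow> (\<And>k. \<exists>h\<in>G. \<forall>v\<in>level m k. h v = g v) \<Longrightarrow> g \<in> G"
    and \<gamma>: "\<And>e. e \<in> set es \<Longrightarrow> \<gamma> e \<in> G"
    and c: "\<And>N. n \<le> N \<Longrightarrow> c N > (0::real)"
    and cle: "\<And>N x. n \<le> N \<Longrightarrow> (\<And>e. e \<in> set es \<Longrightarrow> x e \<in> St n) \<Longrightarrow>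
      c N \<le> card (children \<gamma> es x N)"
    and nl: "\<And>i. n \<le> l i" and CG: "\<And>i. C i \<subseteq> K" and K: "tree_group m K" and GK: "G \<subseteq> K"
    and agree: "\<And>i g h. g \<in> C i \<Longrightarrow> h \<in> C i \<Longrightarrow> restrict g (level m (l i)) = restrict h (level m (l i))"
    and small: "(\<Sum>i. ennreal (1 / (\<Prod>j\<in>{n..<l i}. c j))) < 1"
  shows "\<exists>x. (\<forall>e\<in>set es. x e \<in> G) \<and> comm_prod \<gamma> x es \<notin> (\<Union>i. C i)"
proof -
  interpret K: tree_group m K by (rule K)
  \<comment> \<open>If every node of level \<open>j\<close> has \<open>c j\<close> children, an
    equal distribution of the total weight 1 gives the share \<open>1 / w N\<close> to a node of
    level \<open>N\<close>.\<close>
  define w where "w N = (\<Prod>j\<in>{n..<N}. c j)" for N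
  have wpos: "w N > 0" for N unfolding w_def using c by (intro prod_pos) auto
  have wSuc: "w (Suc N) = w N * c N" if "n \<le> N" for N using that by (simp add: w_def)
  \<comment> \<open>\<open>wt N q\<close> is the weight of the cover still to be avoided below the
    node \<open>q\<close>. A set counts as long as its own level has not been passed, and only at
    nodes that it meets; since its elements agree, there is just one such node on each
    level.\<close>
  define bel where "bel i N q \<longleftrightarrow> N \<le> l i \<and> (\<exists>g\<in>C i. restrict g (level m N) = q)" for i N q
  define wt where "wt N q = (\<Sum>i. if bel i N q then ennreal (1 / w (l i)) else 0)" for N q
  let ?V = "\<lambda>x N. restrict (comm_prod \<gamma> x es) (level m N)"
  have bel_unique: "q = q'" if b: "bel i N q" "bel i N q'" for i N q q'
  proof -
    obtain g h where gh: "g \<in> C i" "restrict g (level m N) = q" "h \<in> C i" "restrict h (level m N) = q'"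
      and N: "N \<le> l i" using b by (auto simp: bel_def)
    show ?thesis
      using K.restrict_level_mono[OF _ _ agree[OF gh(1,3)] N] gh CG by blast
  qed
  have shSt: "x' e \<in> St n" if "n \<le> N" "\<forall>e\<in>set es. x e \<in> St n" "x' \<in> shifts es x N" "e \<in> set es" for x x' e N
    using that St_comp St_antimono[OF that(1)] unfolding shifts_def by fastforce
  have step: "\<exists>x'\<in>shifts es x N. wt (Suc N) (?V x' (Suc N)) < ennreal (1 / w (Suc N))"
    if N: "n \<le> N" and x: "\<forall>e\<in>set es. x e \<in> St n" and lt: "wt N (?V x N) < ennreal (1 / w N)" for N x
  proof (rule ccontr)
    assume neg: "\<not> ?thesis"
    let ?Q = "(\<lambda>x'. ?V x' (Suc N)) ` shifts es x N"
    have VG: "comm_prod \<gamma> x' es \<in> G" if "x' \<in> shifts es x N" for x'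
      using shSt[OF N x that] \<gamma> St_mem by (intro comm_prod_mem) auto
    have finQ: "finite ?Q"
    proof -
      have "finite ((\<lambda>g. restrict g (level m (Suc N))) ` (\<lambda>x'. comm_prod \<gamma> x' es) ` shifts es x N)"
        by (rule finite_restrict_image[of _ _ "Suc N"]) (use VG in blast)+
      then show ?thesis by (simp only: image_image)
    qed
    have V_N: "?V x' N = ?V x N" if "x' \<in> shifts es x N" for x'
    proof (rule restrict_ext)
      fix v assume v: "v \<in> level m N"
      show "comm_prod \<gamma> x' es v = comm_prod \<gamma> x es v"
      proof (rule comm_prod_agree[OF _ _ v])
        show "\<gamma> e \<in> G \<and> x' e \<in> G \<and> x e \<in> G" if "e \<in> set es" for e
          using \<gamma>[OF that] shSt[OF N x \<open>x' \<in> shifts es x N\<close> that] x that St_mem by blast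
        fix e u assume e: "e \<in> set es" "u \<in> level m N"
        then obtain y where y: "y \<in> St N" "x' e = x e \<circ> y" using \<open>x' \<in> shifts es x N\<close> by (auto simp: shifts_def)
        then show "x' e u = x e u" using St_fix[OF y(1) e(2)] by simp
      qed
    qed
    have bel_Suc: "bel i N (?V x N)" if b: "bel i (Suc N) q" and q: "q \<in> ?Q" for i q
    proof -
      obtain x' where x': "x' \<in> shifts es x N" "q = ?V x' (Suc N)" using q by blast
      obtain g where g: "g \<in> C i" "restrict g (level m (Suc N)) = q" and "Suc N \<le> l i"
        using b by (auto simp: bel_def)
      have "restrict g (level m N) = ?V x' N"
      proof (rule K.restrict_level_mono)
        show "g \<in> K" "comm_prod \<gamma> x' es \<in> K" using g(1) CG VG[OF x'(1)] GK by auto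
        show "restrict g (level m (Suc N)) = ?V x' (Suc N)" using g(2) x'(2) by simp
      qed simp
      then show ?thesis using g(1) \<open>Suc N \<le> l i\<close> V_N[OF x'(1)] unfolding bel_def by auto
    qed
    have ge: "ennreal (1 / w (Suc N)) \<le> wt (Suc N) q" if "q \<in> ?Q" for q using neg that by force
    \<comment> \<open>If all children were heavy, their shares, at least \<open>c N\<close> of them,
      would add up to the share of the parent; but each set of the cover weighs on at most one
      child.\<close>
    have "ennreal (1 / w N) \<le> ennreal (card ?Q * (1 / w (Suc N)))"
    proof (rule ennreal_leI)
      have "1 / w N = c N * (1 / w (Suc N))" using wSuc[OF N] c[OF N] by simp
      also have "\<dots> \<le> card ?Q * (1 / w (Suc N))"
        using cle[OF N, of x] x wpos[of "Suc N"] by (intro mult_right_mono) auto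
      finally show "1 / w N \<le> card ?Q * (1 / w (Suc N))" .
    qed
    also have "\<dots> = (\<Sum>q\<in>?Q. ennreal (1 / w (Suc N)))"
      using wpos[of "Suc N"]
      by (subst ennreal_mult) (simp_all add: ennreal_of_nat_eq_real_of_nat less_imp_le)
    also have "\<dots> \<le> (\<Sum>q\<in>?Q. wt (Suc N) q)" by (rule sum_mono) (rule ge)
    also have "\<dots> = (\<Sum>i. \<Sum>q\<in>?Q. if bel i (Suc N) q then ennreal (1 / w (l i)) else 0)"
      unfolding wt_def by (rule suminf_sum[symmetric]) simp
    also have "\<dots> \<le> wt N (?V x N)"
      unfolding wt_def
    proof (rule suminf_le)
      fix i
      show "(\<Sum>q\<in>?Q. if bel i (Suc N) q then ennreal (1 / w (l i)) else 0) \<le>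
          (if bel i N (?V x N) then ennreal (1 / w (l i)) else 0)"
      proof (cases "\<exists>q\<in>?Q. bel i (Suc N) q")
        case True
        then obtain q0 where q0: "q0 \<in> ?Q" "bel i (Suc N) q0" by blast
        have "(\<Sum>q\<in>?Q. if bel i (Suc N) q then ennreal (1 / w (l i)) else 0) =
            (\<Sum>q\<in>?Q. if q = q0 then ennreal (1 / w (l i)) else 0)"
          using bel_unique q0 by (intro sum.cong) auto
        also have "\<dots> = ennreal (1 / w (l i))" using finQ q0(1) by simp
        finally show ?thesis using bel_Suc[OF q0(2,1)] by simp
      next
        case False
        then have "(\<Sum>q\<in>?Q. if bel i (Suc N) q then ennreal (1 / w (l i)) else 0) = 0"
          by (intro sum.neutral) auto
        then show ?thesis by simp
      qed
    qed simp_all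
    finally show False using lt by simp
  qed
  \<comment> \<open>The arguments \<open>x\<close> are chosen and not the products, so that each
    \<open>x e\<close> converges separately, in the closed group \<open>G\<close>.\<close>
  define P where "P k x \<longleftrightarrow> (\<forall>e\<in>set es. x e \<in> St n) \<and> wt (n + k) (?V x (n + k)) < ennreal (1 / w (n + k))" for k x
  have "\<exists>f. \<forall>k. P k (f k) \<and> f (Suc k) \<in> shifts es (f k) (n + k)"
  proof (rule dependent_nat_choice)
    have "wt n q \<le> (\<Sum>i. ennreal (1 / w (l i)))" for q
      unfolding wt_def by (rule suminf_le) auto
    then have "wt n q < 1" for q using small unfolding w_def by (rule le_less_trans)
    then show "\<exists>x. P 0 x" unfolding P_def by (intro exI[of _ "\<lambda>_. id"]) (simp add: w_def)
  next
    fix x k assume "P k x"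
    then obtain x' where x': "x' \<in> shifts es x (n + k)"
      "wt (Suc (n + k)) (?V x' (Suc (n + k))) < ennreal (1 / w (Suc (n + k)))"
      using step[of "n + k" x] by (auto simp: P_def)
    moreover have "\<forall>e\<in>set es. x' e \<in> St n"
      using shSt[OF le_add1 _ x'(1)] \<open>P k x\<close> by (auto simp: P_def)
    ultimately show "\<exists>y. P (Suc k) y \<and> y \<in> shifts es x (n + k)" by (auto simp: P_def)
  qed
  then obtain f where f: "\<And>k. P k (f k)" "\<And>k. f (Suc k) \<in> shifts es (f k) (n + k)" by blast
  have fG: "f k e \<in> G" if "e \<in> set es" for k e using f(1)[of k] that St_mem by (auto simp: P_def)
  \<comment> \<open>Shifts by \<open>St (n + k)\<close> do not affect words of length up to
    \<open>n + k\<close>, so the value at \<open>v\<close> is final from step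
    \<open>length v\<close> on.\<close>
  define x where "x e v = f (length v) e v" for e v
  have stable: "f (k + d) e v = f k e v" if e: "e \<in> set es" and v: "length v \<le> n + k" for k d e v
  proof (induction d)
    case (Suc d)
    obtain y where y: "y \<in> St (n + (k + d))" "f (Suc (k + d)) e = f (k + d) e \<circ> y"
      using f(2)[of "k + d"] e by (auto simp: shifts_def)
    have "y v = v" using St_short[OF y(1)] v by simp
    then show ?case using Suc y(2) by simp
  qed simp
  have x_eq: "f k e v = x e v" if e: "e \<in> set es" and v: "length v \<le> n + k" for k e v
  proof (cases "length v \<le> k")
    case True
    then have k: "k = length v + (k - length v)" by simp
    show ?thesis
      unfolding x_def by (subst k, rule stable[OF e]) simp
  next
    case False
    then have k: "length v = k + (length v - k)" by simp
    have "f (length v) e v = f k e v" by (subst k, rule stable[OF e v])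
    then show ?thesis unfolding x_def by (rule sym)
  qed
  have xG: "x e \<in> G" if e: "e \<in> set es" for e
  proof (rule closed)
    show "tree_automorphism m (x e)"
    proof (rule tree_automorphism_limit)
      show "tree_automorphism m (f k e)" for k by (rule aut[OF fG[OF e]])
      show "f k e v = x e v" if "length v \<le> k" for k v by (rule x_eq[OF e]) (use that in linarith)
    qed
    show "\<exists>h\<in>G. \<forall>v\<in>level m k. h v = x e v" for k
    proof (intro bexI ballI)
      fix v assume "v \<in> level m k"
      then have "length v \<le> n + k" by (simp add: level_def)
      then show "f k e v = x e v" by (rule x_eq[OF e])
    qed (rule fG[OF e])
  qed
  have "comm_prod \<gamma> x es \<notin> C i" for i
  proof
    assume i: "comm_prod \<gamma> x es \<in> C i"
    define k where "k = l i - n"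
    have k: "l i = n + k" using nl[of i] by (simp add: k_def)
    have "?V (f k) (l i) = ?V x (l i)"
    proof (rule restrict_ext)
      fix v assume v: "v \<in> level m (l i)"
      show "comm_prod \<gamma> (f k) es v = comm_prod \<gamma> x es v"
      proof (rule comm_prod_agree[OF _ _ v])
        show "\<gamma> e \<in> G \<and> f k e \<in> G \<and> x e \<in> G" if "e \<in> set es" for e
          using \<gamma> fG xG that by blast
        show "f k e u = x e u" if "e \<in> set es" "u \<in> level m (l i)" for e u
          using that(2) by (intro x_eq[OF that(1)]) (simp add: level_def k)
      qed
    qed
    then have b: "bel i (l i) (?V (f k) (l i))" using i by (auto simp: bel_def)
    \<comment> \<open>At its own level \<open>l i\<close> the set \<open>C i\<close> alone already
      has the full weight \<open>1 / w (l i)\<close>.\<close>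
    let ?a = "\<lambda>i'. if bel i' (l i) (?V (f k) (l i)) then ennreal (1 / w (l i')) else 0"
    have "?a i = sum ?a {i}" by simp
    also have "\<dots> \<le> (\<Sum>i'. ?a i')" by (rule sum_le_suminf) auto
    also have "\<dots> = wt (l i) (?V (f k) (l i))" by (simp add: wt_def)
    also have "\<dots> < ennreal (1 / w (l i))" using f(1)[of k] by (simp add: P_def k)
    finally show False using b by simp
  qed
  then show ?thesis using xG by blast
qed

end

section \<open>The iterated wreath product\<close>

lemma mult_iter_wreath [simp]: "g \<otimes>\<^bsub>iter_wreath m H\<^esub> h = h \<circ> g"
  by (simp add: iter_wreath_def AutT_def)

lemma one_iter_wreath [simp]: "\<one>\<^bsub>iter_wreath m H\<^esub> = id"
  by (simp add: iter_wreath_def AutT_def)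

lemma inv_iter_wreath:
  assumes H: "subgroup H (sym_group m)" and g: "g \<in> carrier (iter_wreath m H)"
  shows "inv\<^bsub>iter_wreath m H\<^esub> g = inv' g"
proof -
  have "iter_wreath m H = (AutT m)\<lparr>carrier := carrier (iter_wreath m H)\<rparr>"
    by (simp add: iter_wreath_def)
  then have "inv\<^bsub>iter_wreath m H\<^esub> g = inv\<^bsub>AutT m\<^esub> g"
    using group.m_inv_consistent[OF group_AutT subgroup_iter_wreath[OF H] g] by simp
  also have "\<dots> = inv' g" using g by (intro inv_AutT) (simp add: iter_wreath_def)
  finally show ?thesis .
qed

lemma tree_group_subgroup:
  assumes H: "subgroup H (sym_group m)" and K: "subgroup K (iter_wreath m H)"
  shows "tree_group m K"
proof
  have KW: "g \<in> carrier (iter_wreath m H)" if "g \<in> K" for g using subgroup.mem_carrier[OF K that] .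
  show "tree_automorphism m g" if "g \<in> K" for g using KW[OF that] by (simp add: iter_wreath_def AutT_def)
  show "id \<in> K" using subgroup.one_closed[OF K] by simp
  show "g \<circ> h \<in> K" if "g \<in> K" "h \<in> K" for g h using subgroup.m_closed[OF K that(2,1)] by simp
  show "inv' g \<in> K" if "g \<in> K" for g
    using subgroup.m_inv_closed[OF K that] inv_iter_wreath[OF H KW[OF that]] by simp
qed

lemma tree_group_iter_wreath:
  "subgroup H (sym_group m) \<Longrightarrow> tree_group m (carrier (iter_wreath m H))"
  using tree_group_subgroup group.subgroup_self[OF group_iter_wreath] by blast

lemma (in tree_group) level_stab_iff:
  assumes "g \<in> G" "h \<in> G"
  shows "inv' h \<circ> g \<in> St n \<longleftrightarrow> restrict g (level m n) = restrict h (level m n)"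
proof
  assume a: "inv' h \<circ> g \<in> St n"
  show "restrict g (level m n) = restrict h (level m n)"
  proof (rule restrict_ext)
    fix v assume "v \<in> level m n"
    then have "inv' h (g v) = v" using St_fix[OF a] by simp
    then show "g v = h v" using inv_eq_iff[OF assms(2)] by simp
  qed
next
  assume eq: "restrict g (level m n) = restrict h (level m n)"
  show "inv' h \<circ> g \<in> St n"
  proof (rule St_I)
    show "inv' h \<circ> g \<in> G" using assms comp_mem inv_mem by blast
    fix v assume "v \<in> level m n"
    then have "g v = h v" using fun_cong[OF eq, of v] by simp
    then show "(inv' h \<circ> g) v = v" using assms(2) by simp
  qed
qed

lemma level_index_eq:
  assumes H: "subgroup H (sym_group m)"
  shows "level_index m H n = tree_group.level_order m (carrier (iter_wreath m H)) n"
proof -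
  let ?W = "carrier (iter_wreath m H)"
  interpret W: tree_group m ?W by (rule tree_group_iter_wreath[OF H])
  let ?r = "\<lambda>g. restrict g (level m n)"
  have coset: "W.St n #>\<^bsub>iter_wreath m H\<^esub> a = {b \<in> ?W. ?r b = ?r a}" if a: "a \<in> ?W" for a
  proof (intro equalityI subsetI)
    fix b assume "b \<in> W.St n #>\<^bsub>iter_wreath m H\<^esub> a"
    then obtain y where y: "y \<in> W.St n" "b = a \<circ> y" by (auto simp: r_coset_def)
    have b: "b \<in> ?W" using y W.St_mem[OF y(1)] a W.comp_mem by blast
    have "inv' a \<circ> b = y" using y(2) a by (auto simp: fun_eq_iff)
    then show "b \<in> {b \<in> ?W. ?r b = ?r a}" using W.level_stab_iff[OF b a] y(1) b by simp
  next
    fix b assume "b \<in> {b \<in> ?W. ?r b = ?r a}"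
    then have b: "b \<in> ?W" "inv' a \<circ> b \<in> W.St n" using W.level_stab_iff[OF _ a] by auto
    have "b = a \<circ> (inv' a \<circ> b)" using a by (auto simp: fun_eq_iff)
    then show "b \<in> W.St n #>\<^bsub>iter_wreath m H\<^esub> a" using b(2) unfolding r_coset_def by auto
  qed
  have "rcosets\<^bsub>iter_wreath m H\<^esub> W.St n = (\<lambda>q. {b \<in> ?W. ?r b = q}) ` ?r ` ?W"
    unfolding RCOSETS_def image_image using coset by auto
  moreover have "inj_on (\<lambda>q. {b \<in> ?W. ?r b = q}) (?r ` ?W)"
  proof (rule inj_onI)
    fix p q assume p: "p \<in> ?r ` ?W" and eq: "{b \<in> ?W. ?r b = p} = {b \<in> ?W. ?r b = q}"
    obtain g where "g \<in> ?W" "?r g = p" using p by blast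
    then have "g \<in> {b \<in> ?W. ?r b = q}" unfolding eq[symmetric] by simp
    then show "p = q" using \<open>?r g = p\<close> by simp
  qed
  ultimately show ?thesis unfolding level_index_def W.level_order_def by (simp only: card_image)
qed

section \<open>Automorphisms with prescribed labels on a single level\<close>

definition level_perm ::
  "nat \<Rightarrow> nat \<Rightarrow> (nat list \<Rightarrow> nat \<Rightarrow> nat) \<Rightarrow> nat list \<Rightarrow> nat list" where
  "level_perm m n p w = (if w \<in> tree_words m \<and> n < length w
     then take n w @ p (take n w) (w ! n) # drop (Suc n) w else w)"

lemma length_level_perm [simp]: "length (level_perm m n p w) = length w"
  by (auto simp: level_perm_def)

lemma level_perm_fix: "length w \<le> n \<Longrightarrow> level_perm m n p w = w"
  by (simp add: level_perm_def)

lemma level_perm_words: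
  assumes p: "\<And>v. p v permutes {1..m}" and w: "w \<in> tree_words m"
  shows "level_perm m n p w \<in> tree_words m"
proof (cases "n < length w")
  case True
  have "w ! n \<in> {1..m}" using w True unfolding tree_words_def by force
  then have "p (take n w) (w ! n) \<in> {1..m}" using permutes_in_image[OF p] by blast
  moreover have "drop (Suc n) w \<in> tree_words m"
    using w set_drop_subset[of "Suc n" w] by (auto simp: tree_words_def)
  ultimately show ?thesis using w True take_tree_words[OF w] by (simp add: level_perm_def)
qed (use w in \<open>simp add: level_perm_def\<close>)

lemma level_perm_comp:
  assumes q: "\<And>v. q v permutes {1..m}"
  shows "level_perm m n p (level_perm m n q w) = level_perm m n (\<lambda>v. p v \<circ> q v) w"
proof (cases "w \<in> tree_words m \<and> n < length w")
  case True
  define u where "u = level_perm m n q w"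
  have u: "u = take n w @ q (take n w) (w ! n) # drop (Suc n) w"
    unfolding u_def level_perm_def if_P[OF True] ..
  have "u \<in> tree_words m" unfolding u_def by (rule level_perm_words[OF q conjunct1[OF True]])
  moreover have "n < length u" unfolding u_def using True by simp
  ultimately have "level_perm m n p u = take n u @ p (take n u) (u ! n) # drop (Suc n) u"
    by (simp only: level_perm_def simp_thms if_True)
  moreover have "take n u = take n w" "drop (Suc n) u = drop (Suc n) w" "u ! n = q (take n w) (w ! n)"
    using True by (simp_all add: u nth_append)
  moreover have "level_perm m n (\<lambda>v. p v \<circ> q v) w = take n w @ p (take n w) (q (take n w) (w ! n)) # drop (Suc n) w"
    unfolding level_perm_def if_P[OF True] by simp
  ultimately show ?thesis by (simp only: u_def)
next
  case False
  then have *: "level_perm m n f w = w" for f unfolding level_perm_def by (rule if_not_P)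
  show ?thesis by (simp only: *)
qed

lemma level_perm_id: "level_perm m n (\<lambda>_. id) w = w"
  by (simp add: level_perm_def id_take_nth_drop[symmetric])

lemma level_perm_child:
  assumes "w @ [x] \<in> tree_words m"
  shows "level_perm m n p (w @ [x]) = level_perm m n p w @ [if length w = n then p w x else x]"
  using assms by (cases "length w" n rule: linorder_cases) (auto simp: level_perm_def nth_append)

lemma level_perm_automorphism:
  assumes p: "\<And>v. p v permutes {1..m}"
  shows "tree_automorphism m (level_perm m n p)"
proof -
  let ?s = "level_perm m n p" and ?i = "level_perm m n (\<lambda>v. inv' (p v))"
  have ip: "inv' (p v) permutes {1..m}" for v using permutes_inv[OF p] .
  have si: "?s (?i w) = w" for w
  proof -
    have "p v \<circ> inv' (p v) = id" for v using permutes_inv_o(1)[OF p] .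
    then show ?thesis unfolding level_perm_comp[OF ip] using level_perm_id by simp
  qed
  have inv_s: "?i (?s w) = w" for w
  proof -
    have "inv' (p v) \<circ> p v = id" for v using permutes_inv_o(2)[OF p] .
    then show ?thesis unfolding level_perm_comp[OF p] using level_perm_id by simp
  qed
  have "bij_betw ?s (tree_words m) (tree_words m)"
  proof (rule bij_betw_byWitness[where f' = ?i])
    show "?s ` tree_words m \<subseteq> tree_words m" by (rule image_subsetI) (rule level_perm_words[OF p])
    show "?i ` tree_words m \<subseteq> tree_words m" by (rule image_subsetI) (rule level_perm_words[OF ip])
  qed (simp_all only: si inv_s simp_thms Ball_def)
  moreover have "?s w = w" if "w \<notin> tree_words m" for w using that by (simp add: level_perm_def)
  ultimately have perm: "?s permutes tree_words m" by (rule bij_imp_permutes)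
  have words: "?s w \<in> tree_words m" if "w \<in> tree_words m" for w by (rule level_perm_words[OF p that])
  have adj: "tree_adj (level_perm m n q u) (level_perm m n q v)"
    if "u \<in> tree_words m" "v \<in> tree_words m" "tree_adj u v" for q u v
  proof -
    from that(3) consider x where "v = u @ [x]" | x where "u = v @ [x]" by (auto simp: tree_adj_def)
    then show ?thesis
    proof cases
      case 1
      then show ?thesis using level_perm_child[of u x m n q] that(2) by (auto simp: tree_adj_def)
    next
      case 2
      then show ?thesis using level_perm_child[of v x m n q] that(1) by (auto simp: tree_adj_def)
    qed
  qed
  have "tree_adj (?s u) (?s v) \<longleftrightarrow> tree_adj u v" if "u \<in> tree_words m" "v \<in> tree_words m" for u v
    using adj[OF that, where q = p]
      adj[OF words[OF that(1)] words[OF that(2)], where q = "\<lambda>v. inv' (p v)"]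
    unfolding inv_s by (rule iffI[rotated])
  then show ?thesis using perm by (simp add: tree_automorphism_def level_perm_fix)
qed

lemma tree_label_level_perm:
  assumes p: "\<And>v. p v permutes {1..m}" and v: "v \<in> tree_words m"
  shows "tree_label (level_perm m n p) v = (if length v = n then p v else id)"
proof
  fix x
  show "tree_label (level_perm m n p) v x = (if length v = n then p v else id) x"
  proof (cases "x \<in> {1..m}")
    case True
    then have "v @ [x] \<in> tree_words m" using v by simp
    from level_perm_child[OF this, of n p] show ?thesis
      by (simp add: tree_label_def tree_section_def)
  next
    case False
    then have "v @ [x] \<notin> tree_words m" by simp
    then have "level_perm m n p (v @ [x]) = v @ [x]"
      unfolding level_perm_def by (simp only: simp_thms if_False)
    then show ?thesis using permutes_not_in[OF p False] by (simp add: tree_label_def tree_section_def)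
  qed
qed

lemma sym_group_subgroupD:
  assumes H: "subgroup H (sym_group m)"
  shows "p \<in> H \<Longrightarrow> p permutes {1..m}" and "id \<in> H" and "finite H"
proof -
  show p: "p permutes {1..m}" if "p \<in> H" for p
    using subgroup.mem_carrier[OF H that] by (simp add: sym_group_def)
  show "id \<in> H" using subgroup.one_closed[OF H] by (simp add: sym_group_def)
  have "H \<subseteq> {p. p permutes {1..m}}" using p by blast
  then show "finite H" by (rule finite_subset) (simp add: finite_permutations)
qed

lemma level_perm_iter_wreath:
  assumes H: "subgroup H (sym_group m)" and p: "\<And>v. p v \<in> H"
  shows "level_perm m n p \<in> carrier (iter_wreath m H)"
proof -
  have pp: "p v permutes {1..m}" for v using sym_group_subgroupD(1)[OF H p] .
  show ?thesis
    using level_perm_automorphism[of p, OF pp] tree_label_level_perm[of p, OF pp] p sym_group_subgroupD(2)[OF H]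
    by (simp add: iter_wreath_def AutT_def)
qed

text \<open>Labels from \<open>H\<close> can be prescribed freely on level \<open>n\<close>;
  precomposing representatives of the actions on level \<open>n\<close> with such elements gives
  pairwise distinct actions on level \<open>Suc n\<close>.\<close>

lemma level_index_Suc_ge:
  assumes H: "subgroup H (sym_group m)"
  shows "card H ^ (m ^ n) * level_index m H n \<le> level_index m H (Suc n)"
proof -
  let ?W = "carrier (iter_wreath m H)"
  interpret W: tree_group m ?W by (rule tree_group_iter_wreath[OF H])
  let ?r = "\<lambda>g n. restrict g (level m n)"
  let ?P = "PiE (level m n) (\<lambda>_. H)" and ?B = "(\<lambda>g. ?r g n) ` ?W"
  define ex where "ex p v = (if v \<in> level m n then p v else id)" for p :: "nat list \<Rightarrow> nat \<Rightarrow> nat" and v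
  define rep where "rep = inv_into ?W (\<lambda>g. ?r g n)"
  have rep: "rep b \<in> ?W" "?r (rep b) n = b" if "b \<in> ?B" for b
    unfolding rep_def using inv_into_into[OF that] f_inv_into_f[OF that] by auto
  have exH: "ex p v \<in> H" if "p \<in> ?P" for p v using that sym_group_subgroupD(2)[OF H] by (auto simp: ex_def)
  define s where "s p = level_perm m n (ex p)" for p
  have sW: "s p \<in> ?W" if "p \<in> ?P" for p unfolding s_def using level_perm_iter_wreath[OF H exH[OF that]] .
  have sfix: "s p v = v" if "v \<in> level m n" for p v using that by (simp add: s_def level_perm_fix level_def)
  let ?h = "\<lambda>(p, b). ?r (rep b \<circ> s p) (Suc n)"
  have "card (?P \<times> ?B) \<le> card ((\<lambda>g. ?r g (Suc n)) ` ?W)"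
  proof (rule card_inj_on_le)
    show "?h ` (?P \<times> ?B) \<subseteq> (\<lambda>g. ?r g (Suc n)) ` ?W"
    proof
      fix a assume "a \<in> ?h ` (?P \<times> ?B)"
      then obtain p b where pb: "p \<in> ?P" "b \<in> ?B" "a = ?r (rep b \<circ> s p) (Suc n)" by auto
      have "rep b \<circ> s p \<in> ?W" using W.comp_mem[OF rep(1)[OF pb(2)] sW[OF pb(1)]] .
      then show "a \<in> (\<lambda>g. ?r g (Suc n)) ` ?W" unfolding pb(3) by (rule imageI)
    qed
    show "finite ((\<lambda>g. ?r g (Suc n)) ` ?W)" by (rule W.finite_restrict_image[OF order_refl order_refl])
    show "inj_on ?h (?P \<times> ?B)"
    proof (rule inj_onI)
      fix x y assume x: "x \<in> ?P \<times> ?B" and y: "y \<in> ?P \<times> ?B" and eq: "?h x = ?h y"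
      obtain p b where xb: "x = (p, b)" "p \<in> ?P" "b \<in> ?B" using x by blast
      obtain q d where yb: "y = (q, d)" "q \<in> ?P" "d \<in> ?B" using y by blast
      have eq': "?r (rep b \<circ> s p) (Suc n) = ?r (rep d \<circ> s q) (Suc n)" using eq xb yb by simp
      have low: "?r (rep b' \<circ> s p') n = b'" if "b' \<in> ?B" for b' p'
      proof -
        have "?r (rep b' \<circ> s p') n = ?r (rep b') n" by (rule restrict_ext) (simp add: sfix)
        then show ?thesis using rep(2)[OF that] by simp
      qed
      have "?r (rep b \<circ> s p) n = ?r (rep d \<circ> s q) n"
        using W.comp_mem[OF rep(1) sW] xb yb by (intro W.restrict_level_mono[OF _ _ eq']) auto
      then have bd: "b = d" using low xb yb by metis
      have "p v = q v" if v: "v \<in> level m n" for v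
      proof
        fix i
        show "p v i = q v i"
        proof (cases "i \<in> {1..m}")
          case True
          then have vi: "v @ [i] \<in> level m (Suc n)" "v @ [i] \<in> tree_words m" "length v = n"
            using v by (auto simp: level_def)
          have "rep b (s p (v @ [i])) = rep b (s q (v @ [i]))"
            using fun_cong[OF eq', of "v @ [i]"] vi(1) bd by simp
          then have "s p (v @ [i]) = s q (v @ [i])" using W.eq_iff[OF rep(1)[OF xb(3)]] by blast
          then show ?thesis
            unfolding s_def level_perm_child[OF vi(2)] using vi(3) v by (simp add: ex_def)
        next
          case False
          have "p v permutes {1..m}" "q v permutes {1..m}"
            using sym_group_subgroupD(1)[OF H] xb(2) yb(2) v by auto
          then show ?thesis using permutes_not_in[OF _ False] by metis
        qed
      qed
      then have "p = q" using xb(2) yb(2) by (intro PiE_ext[of p _ _ q]) auto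
      then show "x = y" using xb yb bd by simp
    qed
  qed
  moreover have "card ?P = card H ^ (m ^ n)" by (simp add: card_PiE card_level)
  ultimately show ?thesis
    unfolding level_index_eq[OF H] W.level_order_def card_cartesian_product by simp
qed

text \<open>With each automorphism an open set contains all automorphisms that agree with it on some
  level. The complement of \<open>K\<close> is open, so it cannot contain a limit of elements of
  \<open>K\<close>.\<close>

lemma closed_limit:
  assumes K: "tree_group m K" and cl: "closedin (AutT_topology m) K"
    and g: "tree_automorphism m g" and lim: "\<And>k. \<exists>h\<in>K. \<forall>v\<in>level m k. h v = g v"
  shows "g \<in> K"
proof (rule ccontr)
  assume gK: "g \<notin> K"
  let ?A = "carrier (AutT m)"
  let ?S = "{x <#\<^bsub>AutT m\<^esub> level_stab m ?A n | x n. x \<in> ?A}"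
  have A: "tree_group m ?A"
  proof
    show "g \<circ> h \<in> ?A" if "g \<in> ?A" "h \<in> ?A" for g h
      using tree_automorphism_comp[of m h g] that by (simp add: AutT_def)
    show "inv' g \<in> ?A" if "g \<in> ?A" for g using tree_automorphism_inv[of m g] that by (simp add: AutT_def)
    show "id \<in> ?A" by (simp add: AutT_def tree_automorphism_def permutes_id)
  qed (simp add: AutT_def)
  interpret A: tree_group m ?A by (rule A)
  interpret K: tree_group m K by (rule K)
  have KA: "K \<subseteq> ?A" using K.aut by (auto simp: AutT_def)
  have gA: "g \<in> ?A" using g by (simp add: AutT_def)
  \<comment> \<open>The product of \<open>AutT\<close> is read from left to right, so a left coset
    consists of the maps that apply \<open>x\<close> first.\<close>
  have coset: "x <#\<^bsub>AutT m\<^esub> level_stab m ?A n = {y \<circ> x | y. y \<in> A.St n}" for x n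
    by (auto simp: l_coset_def AutT_def)
  have top: "topspace (AutT_topology m) = ?A"
  proof -
    have "x \<in> \<Union>?S" if x: "x \<in> ?A" for x
    proof -
      have "id \<circ> x \<in> {y \<circ> x | y. y \<in> A.St 0}" using A.St_id by blast
      then have "x \<in> x <#\<^bsub>AutT m\<^esub> level_stab m ?A 0" unfolding coset by simp
      then show ?thesis using x by blast
    qed
    moreover have "\<Union>?S \<subseteq> ?A" unfolding coset using A.comp_mem A.St_mem by blast
    ultimately show ?thesis unfolding AutT_topology_def topology_generated_by_topspace by blast
  qed
  \<comment> \<open>Induction over the generated topology; for an intersection the deeper of the two
    levels serves.\<close>
  have nbhd: "\<exists>k. \<forall>h\<in>?A. (\<forall>v\<in>level m k. h v = x v) \<longrightarrow> h \<in> U"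
    if "generate_topology_on ?S U" "x \<in> U" "x \<in> ?A" for U x
    using that
  proof (induction U arbitrary: x)
    case Empty then show ?case by simp
  next
    case (Int U V)
    have x: "x \<in> U" "x \<in> V" "x \<in> ?A" using Int.prems by auto
    obtain k where k: "\<forall>h\<in>?A. (\<forall>v\<in>level m k. h v = x v) \<longrightarrow> h \<in> U"
      using Int.IH(1)[OF x(1,3)] by blast
    obtain l where l: "\<forall>h\<in>?A. (\<forall>v\<in>level m l. h v = x v) \<longrightarrow> h \<in> V"
      using Int.IH(2)[OF x(2,3)] by blast
    have "h \<in> U \<inter> V" if h: "h \<in> ?A" "\<forall>v\<in>level m (max k l). h v = x v" for h
    proof -
      have eq: "restrict h (level m (max k l)) = restrict x (level m (max k l))"
        using h(2) by (intro restrict_ext) blast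
      have low: "h v = x v" if "v \<in> level m j" "j \<le> max k l" for v j
        using fun_cong[OF A.restrict_level_mono[OF h(1) x(3) eq that(2)], of v] that(1) by simp
      have "\<forall>v\<in>level m k. h v = x v" "\<forall>v\<in>level m l. h v = x v"
        using low[OF _ max.cobounded1] low[OF _ max.cobounded2] by auto
      then show ?thesis using k l h(1) by blast
    qed
    then show ?case by blast
  next
    case (UN S)
    then obtain V where V: "V \<in> S" "x \<in> V" by blast
    from UN.IH[OF V UN.prems(2)] obtain k where
      k: "\<forall>h\<in>?A. (\<forall>v\<in>level m k. h v = x v) \<longrightarrow> h \<in> V" by blast
    have "\<forall>h\<in>?A. (\<forall>v\<in>level m k. h v = x v) \<longrightarrow> h \<in> \<Union>S" using k V(1) by blast
    then show ?case by (rule exI)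
  next
    case (Basis s)
    then obtain y n where s: "s = y <#\<^bsub>AutT m\<^esub> level_stab m ?A n" "y \<in> ?A" by blast
    then obtain z where z: "z \<in> A.St n" "x = z \<circ> y" using Basis.prems(1) coset by auto
    have "h \<in> s" if h: "h \<in> ?A" "\<forall>v\<in>level m n. h v = x v" for h
    proof -
      have "h \<circ> inv' y \<in> A.St n"
      proof (rule A.St_I)
        show "h \<circ> inv' y \<in> ?A" using h(1) s(2) A.comp_mem A.inv_mem by blast
        fix v assume v: "v \<in> level m n"
        have iv: "inv' y v \<in> level m n" using A.level_iff[OF A.inv_mem[OF s(2)]] v by simp
        then have "h (inv' y v) = z (y (inv' y v))" using h(2) z(2) by simp
        then show "(h \<circ> inv' y) v = v" using A.St_fix[OF z(1) v] s(2) by simp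
      qed
      moreover have "h = (h \<circ> inv' y) \<circ> y" using s(2) by (auto simp: fun_eq_iff)
      ultimately show ?thesis unfolding s(1) coset by blast
    qed
    then show ?case by blast
  qed
  have "openin (AutT_topology m) (?A - K)" using cl top by (simp add: closedin_def)
  then have "generate_topology_on ?S (?A - K)"
    unfolding AutT_topology_def by (simp add: openin_topology_generated_by_iff)
  then obtain k where k: "\<forall>h\<in>?A. (\<forall>v\<in>level m k. h v = g v) \<longrightarrow> h \<in> ?A - K"
    using nbhd gA gK by blast
  obtain h where "h \<in> K" "\<forall>v\<in>level m k. h v = g v" using lim by blast
  then show False using k KA by blast
qed

section \<open>Hausdorff measure on the iterated wreath product\<close>

lemma ediam_empty [simp]: "ediam d {} = 0"
  by (simp add: ediam_def bot_ennreal)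

lemma le_ediam: "x \<in> U \<Longrightarrow> y \<in> U \<Longrightarrow> ennreal (d x y) \<le> ediam d U"
  unfolding ediam_def by (rule SUP_upper2[where i = x], assumption, rule SUP_upper2[where i = y]) auto

lemma ediam_le: "(\<And>x y. x \<in> U \<Longrightarrow> y \<in> U \<Longrightarrow> d x y \<le> r) \<Longrightarrow> ediam d U \<le> ennreal r"
  unfolding ediam_def by (intro SUP_least ennreal_leI)

lemma hausdorff_measure_mono:
  assumes "A \<subseteq> B"
  shows "hausdorff_measure M d s A \<le> hausdorff_measure M d s B"
  unfolding hausdorff_measure_def hausdorff_premeasure_def
  by (intro SUP_mono' INF_superset_mono) (use assms in auto)

text \<open>The dimension is an infimum, so an arbitrarily small increase of the exponent costs
  nothing.\<close>

lemma hausdorff_dim_leI: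
  assumes "\<And>s t. 0 < s \<Longrightarrow> hausdorff_measure M d s B = 0 \<Longrightarrow> s < t \<Longrightarrow> hausdorff_measure M d t A = 0"
  shows "hausdorff_dim M d A \<le> hausdorff_dim M d B"
  unfolding hausdorff_dim_def
proof (rule INF_greatest)
  fix s assume s: "s \<in> {s. 0 < s \<and> hausdorff_measure M d s B = 0}"
  show "(INF s\<in>{s. 0 < s \<and> hausdorff_measure M d s A = 0}. ereal s) \<le> ereal s"
  proof (rule ereal_le_epsilon2)
    fix e :: real assume e: "0 < e"
    have "hausdorff_measure M d (s + e) A = 0" using assms[of s "s + e"] s e by simp
    then have "(INF s\<in>{s. 0 < s \<and> hausdorff_measure M d s A = 0}. ereal s) \<le> ereal (s + e)"
      using s e by (intro INF_lower) simp
    then show "(INF s\<in>{s. 0 < s \<and> hausdorff_measure M d s A = 0}. ereal s) \<le> ereal s + ereal e" by simp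
  qed
qed

section \<open>Indices and distances for a nontrivial group of labels\<close>

locale wreath =
  fixes m :: nat and H :: "(nat \<Rightarrow> nat) set"
  assumes m: "m \<ge> 2" and H: "subgroup H (sym_group m)" and card_H: "card H \<ge> 2"
begin

abbreviation W :: "(nat list \<Rightarrow> nat list) set" where "W \<equiv> carrier (iter_wreath m H)"

abbreviation index :: "nat \<Rightarrow> real" where "index n \<equiv> real (level_index m H n)"

sublocale W: tree_group m W by (rule tree_group_iter_wreath[OF H])

lemma index_ge_1: "index n \<ge> 1"
  using W.level_order_pos[of n] by (simp add: level_index_eq[OF H])

lemma index_pos: "index n > 0"
  using index_ge_1[of n] by linarith

lemma ln_index_Suc_ge: "ln (card H) * m ^ n + ln (index n) \<le> ln (index (Suc n))"
proof -
  have pos: "0 < card H ^ (m ^ n) * level_index m H n" using index_pos[of n] card_H by simp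
  have "ln (real (card H ^ (m ^ n) * level_index m H n)) \<le> ln (index (Suc n))"
    by (rule ln_of_nat_mono[OF pos level_index_Suc_ge[OF H]])
  moreover have "ln (real (card H ^ (m ^ n) * level_index m H n)) = ln (card H) * m ^ n + ln (index n)"
    using index_pos[of n] card_H by (simp add: ln_mult ln_realpow)
  ultimately show ?thesis by simp
qed

text \<open>A nontrivial \<open>H\<close> contributes a factor of at least 2 on every level, so that
  distances determine the level of agreement.\<close>

lemma two_index_le: "2 * index n \<le> index (Suc n)"
proof -
  have "2 \<le> card H ^ (m ^ n)"
  proof -
    have "card H ^ 1 \<le> card H ^ (m ^ n)" using card_H m by (intro power_increasing) auto
    then show ?thesis using card_H by simp
  qed
  then have "2 * level_index m H n \<le> card H ^ (m ^ n) * level_index m H n" by (rule mult_le_mono1)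
  also have "\<dots> \<le> level_index m H (Suc n)" by (rule level_index_Suc_ge[OF H])
  finally have "real (2 * level_index m H n) \<le> index (Suc n)" by (rule of_nat_mono)
  then show ?thesis by simp
qed

lemma index_strict_mono: "n < k \<Longrightarrow> index n < index k"
proof (rule lift_Suc_mono_less[of index])
  show "index n < index (Suc n)" for n using two_index_le[of n] index_pos[of n] by linarith
qed

lemma index_mono: "n \<le> k \<Longrightarrow> index n \<le> index k"
  using index_strict_mono[of n k] by (cases "n = k") auto

lemma index_at_top: "filterlim index at_top sequentially"
proof -
  have "real n \<le> index n" for n
  proof (induction n)
    case (Suc n) then show ?case using two_index_le[of n] index_ge_1[of n] by simp
  qed simp
  then show ?thesis
    by (intro filterlim_at_top_mono[OF filterlim_real_sequentially] always_eventually) simp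
qed

lemma index_powr_tendsto: "s > 0 \<Longrightarrow> (\<lambda>n. index n powr - s) \<longlonglongrightarrow> 0"
  using tendsto_neg_powr[OF _ index_at_top, of "- s"] by simp

lemma wreath_dist_eq:
  assumes "g \<in> W" "h \<in> W"
  shows "wreath_dist m H g h =
    (INF n\<in>{n. restrict g (level m n) = restrict h (level m n)}. 1 / index n)"
  using assms by (simp add: wreath_dist_def inv_iter_wreath[OF H] W.level_stab_iff)

lemma wreath_dist_le:
  assumes "g \<in> W" "h \<in> W" "restrict g (level m n) = restrict h (level m n)"
  shows "wreath_dist m H g h \<le> 1 / index n"
  unfolding wreath_dist_eq[OF assms(1,2)]
proof (rule cINF_lower)
  show "bdd_below ((\<lambda>n. 1 / index n) ` {n. restrict g (level m n) = restrict h (level m n)})"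
    by (rule bdd_belowI2[of _ 0]) simp
qed (use assms in simp)

lemma restrict_level_0:
  assumes gh: "g \<in> W" "h \<in> W"
  shows "restrict g (level m 0) = restrict h (level m 0)"
proof (rule restrict_ext)
  fix v assume "v \<in> level m 0"
  then have "length (g v) = 0" "length (h v) = 0" using gh W.length_eq by (auto simp: level_def)
  then show "g v = h v" by simp
qed

text \<open>The distance is governed by the deepest level of agreement, which is at most
  \<open>n\<close> when the actions differ on level \<open>Suc n\<close>.\<close>

lemma wreath_dist_ge:
  assumes gh: "g \<in> W" "h \<in> W" and ne: "restrict g (level m (Suc n)) \<noteq> restrict h (level m (Suc n))"
  shows "1 / index n \<le> wreath_dist m H g h"
  unfolding wreath_dist_eq[OF gh]
proof (rule cINF_greatest)
  have "restrict g (level m 0) = restrict h (level m 0)" by (rule restrict_level_0[OF gh])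
  then show "{n. restrict g (level m n) = restrict h (level m n)} \<noteq> {}" by blast
  fix k assume "k \<in> {n. restrict g (level m n) = restrict h (level m n)}"
  then have "\<not> Suc n \<le> k" using W.restrict_level_mono[OF gh] ne by blast
  then have "index k \<le> index n" using index_mono by simp
  then show "1 / index n \<le> 1 / index k" using index_pos by (intro divide_left_mono) auto
qed

text \<open>One cylinder of diameter at most \<open>1 / index n\<close> for each action of
  \<open>K\<close> on level \<open>n\<close> gives total weight at most
  \<open>index n powr (s - t)\<close>. Infinitely many good levels suffice, as a cover uses just one
  of them.\<close>

lemma hausdorff_measure_eq_0:
  assumes K: "tree_group m K" "K \<subseteq> W" and s: "0 < s" "s < t"
    and small: "\<And>n0. \<exists>n\<ge>n0. real (tree_group.level_order m K n) \<le> index n powr s"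
  shows "hausdorff_measure W (wreath_dist m H) t K = 0"
proof -
  interpret K: tree_group m K by (rule K)
  have "hausdorff_premeasure W (wreath_dist m H) t \<delta> K = 0" if \<delta>: "\<delta> > 0" for \<delta>
  proof -
    have "hausdorff_premeasure W (wreath_dist m H) t \<delta> K \<le> 0 + ennreal e" if e: "e > 0" for e
    proof -
      have "\<forall>\<^sub>F n in sequentially. index n powr - (t - s) < e"
        using index_powr_tendsto[of "t - s"] s e by (intro order_tendstoD(2)) auto
      moreover have "\<forall>\<^sub>F n in sequentially. index n powr - 1 < \<delta>"
        using index_powr_tendsto[of 1] \<delta> by (intro order_tendstoD(2)) auto
      ultimately have "\<forall>\<^sub>F n in sequentially. index n powr - (t - s) < e \<and> index n powr - 1 < \<delta>"
        by (rule eventually_conj)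
      then obtain n0 where n0: "\<And>n. n \<ge> n0 \<Longrightarrow> index n powr - (t - s) < e \<and> index n powr - 1 < \<delta>"
        unfolding eventually_sequentially by blast
      obtain n where n: "n \<ge> n0" "real (K.level_order n) \<le> index n powr s" using small by blast
      let ?r = "\<lambda>g. restrict g (level m n)"
      let ?Q = "?r ` K" and ?N = "K.level_order n"
      have finQ: "finite ?Q" by (rule K.finite_restrict_image[OF order_refl order_refl])
      obtain q where q: "bij_betw q {0..<?N} ?Q"
        using ex_bij_betw_nat_finite[OF finQ] unfolding K.level_order_def by blast
      \<comment> \<open>Covers are sequences, so the finite list of cylinders is padded with empty
        sets, of diameter 0.\<close>
      define C where "C i = (if i < ?N then {g \<in> W. ?r g = q i} else {})" for i
      have diam: "ediam (wreath_dist m H) (C i) \<le> ennreal (1 / index n)" for i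
        by (rule ediam_le, rule wreath_dist_le) (auto simp: C_def split: if_splits)
      have cover: "K \<subseteq> (\<Union>i. C i)"
      proof
        fix g assume g: "g \<in> K"
        then have "?r g \<in> q ` {0..<?N}" using q by (simp add: bij_betw_def)
        then obtain i where "i < ?N" "q i = ?r g" by auto
        then have "g \<in> C i" using g K(2) by (auto simp: C_def)
        then show "g \<in> (\<Union>i. C i)" by blast
      qed
      have "1 / index n < \<delta>" using n0[OF n(1)] index_pos[of n] by (simp add: powr_minus_divide)
      then have le\<delta>: "ediam (wreath_dist m H) (C i) \<le> ennreal \<delta>" for i
        using diam[of i] by (meson ennreal_leI less_imp_le order_trans)
      have "hausdorff_premeasure W (wreath_dist m H) t \<delta> K \<le>
          (\<Sum>i. ennreal (enn2real (ediam (wreath_dist m H) (C i)) powr t))"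
        unfolding hausdorff_premeasure_def
        by (rule INF_lower) (use cover le\<delta> in \<open>auto simp: C_def\<close>)
      also have "\<dots> = (\<Sum>i<?N. ennreal (enn2real (ediam (wreath_dist m H) (C i)) powr t))"
        by (rule suminf_finite) (auto simp: C_def)
      also have "\<dots> \<le> (\<Sum>i<?N. ennreal ((1 / index n) powr t))"
      proof (rule sum_mono, rule ennreal_leI, rule powr_mono2)
        show "enn2real (ediam (wreath_dist m H) (C i)) \<le> 1 / index n" for i
          using enn2real_mono[OF diam[of i]] by simp
      qed (use s in auto)
      also have "\<dots> = ennreal (real ?N * (1 / index n) powr t)"
        by (subst ennreal_mult) (simp_all add: ennreal_of_nat_eq_real_of_nat)
      also have "\<dots> \<le> ennreal e"
      proof (rule ennreal_leI)
        have "real ?N * (1 / index n) powr t \<le> index n powr s * (1 / index n) powr t"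
          using n(2) by (rule mult_right_mono) simp
        also have "\<dots> = index n powr - (t - s)"
          using index_pos[of n] by (simp add: powr_divide powr_diff powr_minus_divide)
        also have "\<dots> \<le> e" using n0[OF n(1)] by simp
        finally show "real ?N * (1 / index n) powr t \<le> e" .
      qed
      finally show ?thesis by simp
    qed
    then have "hausdorff_premeasure W (wreath_dist m H) t \<delta> K \<le> 0" by (rule ennreal_le_epsilon)
    then show ?thesis by simp
  qed
  then have "hausdorff_measure W (wreath_dist m H) t K \<le> 0"
    unfolding hausdorff_measure_def by (intro SUP_least) simp
  then show ?thesis by simp
qed

text \<open>A set whose elements first differ on level \<open>Suc k\<close> has diameter at least
  \<open>1 / index k\<close>, so it can be assigned level \<open>k\<close> at no cost. A set without
  any difference may have diameter 0; it gets a level so deep that the weight is below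
  \<theta>.\<close>

lemma level_of_set:
  assumes C: "C \<subseteq> W" and s: "s > 0" and d: "ediam (wreath_dist m H) C \<le> ennreal \<delta>"
    and \<delta>: "0 < \<delta>" "\<delta> < 1 / index n0" and \<theta>: "\<theta> > 0"
  shows "\<exists>k\<ge>n0. (\<forall>g\<in>C. \<forall>h\<in>C. restrict g (level m k) = restrict h (level m k)) \<and>
    index k powr - s \<le> enn2real (ediam (wreath_dist m H) C) powr s + \<theta>"
proof (cases "\<forall>k. \<forall>g\<in>C. \<forall>h\<in>C. restrict g (level m k) = restrict h (level m k)")
  case True
  have "\<forall>\<^sub>F k in sequentially. index k powr - s < \<theta>"
    using index_powr_tendsto[OF s] \<theta> by (intro order_tendstoD(2)) auto
  then obtain k0 where k0: "\<And>k. k \<ge> k0 \<Longrightarrow> index k powr - s < \<theta>"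
    unfolding eventually_sequentially by blast
  have "index (max k0 n0) powr - s < \<theta>" by (rule k0) simp
  moreover have "0 \<le> enn2real (ediam (wreath_dist m H) C) powr s" by simp
  ultimately have "index (max k0 n0) powr - s \<le> enn2real (ediam (wreath_dist m H) C) powr s + \<theta>" by linarith
  moreover have "\<forall>g\<in>C. \<forall>h\<in>C. restrict g (level m (max k0 n0)) = restrict h (level m (max k0 n0))"
    by (rule spec[OF True])
  ultimately show ?thesis using max.cobounded2[of n0 k0] by blast
next
  case False
  let ?P = "\<lambda>k. \<exists>g\<in>C. \<exists>h\<in>C. restrict g (level m k) \<noteq> restrict h (level m k)"
  have ex: "\<exists>k. ?P k" using False by blast
  define l where "l = (LEAST k. ?P k)"
  have l: "?P l" unfolding l_def by (rule LeastI_ex[OF ex])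
  have lmin: "\<not> ?P k" if "k < l" for k using not_less_Least[OF that[unfolded l_def]] .
  obtain g h where gh: "g \<in> C" "h \<in> C" "restrict g (level m l) \<noteq> restrict h (level m l)" using l by blast
  have ghW: "g \<in> W" "h \<in> W" using gh C by auto
  have "l \<noteq> 0"
  proof
    assume "l = 0"
    have "restrict g (level m 0) = restrict h (level m 0)" by (rule restrict_level_0[OF ghW])
    then show False using gh(3) \<open>l = 0\<close> by simp
  qed
  then obtain k where k: "l = Suc k" by (cases l) auto
  let ?d = "enn2real (ediam (wreath_dist m H) C)"
  have fin: "ediam (wreath_dist m H) C < \<infinity>" using d by (rule le_less_trans) simp
  have "ennreal (1 / index k) \<le> ediam (wreath_dist m H) C"
    using ennreal_leI[OF wreath_dist_ge[OF ghW]] gh(3) le_ediam[OF gh(1,2)] unfolding k by (meson order_trans)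
  then have "enn2real (ennreal (1 / index k)) \<le> ?d" using fin unfolding infinity_ennreal_def by (rule enn2real_mono)
  then have ge: "1 / index k \<le> ?d" by simp
  have "?d \<le> \<delta>" using enn2real_mono[OF d] \<delta> by simp
  \<comment> \<open>A small diameter forces agreement beyond level \<open>n0\<close>.\<close>
  then have "1 / index k < 1 / index n0" using ge \<delta>(2) by linarith
  then have "index n0 < index k" using index_pos[of k] index_pos[of n0] by (simp add: field_simps)
  then have "n0 \<le> k" using index_mono[of k n0] by (meson leI less_imp_le not_le)
  moreover have "index k powr - s \<le> ?d powr s + \<theta>"
  proof -
    have "index k powr - s = (1 / index k) powr s" using index_pos[of k] by (simp add: powr_divide powr_minus_divide)
    also have "\<dots> \<le> ?d powr s" using ge s index_pos[of k] by (intro powr_mono2) auto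
    finally show ?thesis using \<theta> by simp
  qed
  moreover have "\<forall>g\<in>C. \<forall>h\<in>C. restrict g (level m k) = restrict h (level m k)" using lmin[of k] k by blast
  ultimately show ?thesis by blast
qed

lemma exists_level_cover:
  assumes null: "hausdorff_measure W (wreath_dist m H) s A = 0" and s: "s > 0" and e: "e > 0"
  shows "\<exists>C l. A \<subseteq> (\<Union>i. C i) \<and> (\<forall>i. C i \<subseteq> W \<and> n0 \<le> l i \<and>
      (\<forall>g\<in>C i. \<forall>h\<in>C i. restrict g (level m (l i)) = restrict h (level m (l i)))) \<and>
    (\<Sum>i. ennreal (index (l i) powr - s)) \<le> ennreal e"
proof -
  define \<delta> where "\<delta> = 1 / (2 * index n0)"
  have \<delta>: "0 < \<delta>" "\<delta> < 1 / index n0" using index_pos[of n0] by (simp_all add: \<delta>_def field_simps)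
  let ?D = "ediam (wreath_dist m H)"
  have "hausdorff_premeasure W (wreath_dist m H) s \<delta> A \<le> hausdorff_measure W (wreath_dist m H) s A"
    unfolding hausdorff_measure_def using \<delta>(1) by (intro SUP_upper) simp
  then have "hausdorff_premeasure W (wreath_dist m H) s \<delta> A < ennreal (e / 2)"
    using null e by (simp add: ennreal_lessI)
  then obtain C where C: "A \<subseteq> (\<Union>i. C i)" "\<And>i. C i \<subseteq> W" "\<And>i. ?D (C i) \<le> ennreal \<delta>"
    and sum: "(\<Sum>i. ennreal (enn2real (?D (C i)) powr s)) < ennreal (e / 2)"
    unfolding hausdorff_premeasure_def INF_less_iff by blast
  \<comment> \<open>The surcharges add up to \<open>e / 2\<close>; the other half is left for the
    cover itself.\<close>
  define \<theta> where "\<theta> i = e / 2 * (1/2) ^ Suc i" for i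
  have \<theta>: "\<theta> i > 0" for i using e by (simp add: \<theta>_def)
  have "\<forall>i. \<exists>k\<ge>n0. (\<forall>g\<in>C i. \<forall>h\<in>C i. restrict g (level m k) = restrict h (level m k)) \<and>
    index k powr - s \<le> enn2real (?D (C i)) powr s + \<theta> i"
    using level_of_set[OF C(2) s C(3) \<delta> \<theta>] by blast
  then obtain l where l: "\<And>i. n0 \<le> l i"
    "\<And>i. \<forall>g\<in>C i. \<forall>h\<in>C i. restrict g (level m (l i)) = restrict h (level m (l i))"
    "\<And>i. index (l i) powr - s \<le> enn2real (?D (C i)) powr s + \<theta> i"
    by metis
  have "(\<Sum>i. ennreal (index (l i) powr - s)) \<le> (\<Sum>i. ennreal (enn2real (?D (C i)) powr s) + ennreal (\<theta> i))"
  proof (rule suminf_le)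
    fix i
    have "ennreal (index (l i) powr - s) \<le> ennreal (enn2real (?D (C i)) powr s + \<theta> i)"
      by (rule ennreal_leI[OF l(3)])
    also have "\<dots> = ennreal (enn2real (?D (C i)) powr s) + ennreal (\<theta> i)"
      using \<theta>[of i] by (intro ennreal_plus) auto
    finally show "ennreal (index (l i) powr - s) \<le> ennreal (enn2real (?D (C i)) powr s) + ennreal (\<theta> i)" .
  qed simp_all
  also have "\<dots> = (\<Sum>i. ennreal (enn2real (?D (C i)) powr s)) + (\<Sum>i. ennreal (\<theta> i))"
    by (rule suminf_add[symmetric]) simp_all
  also have "(\<Sum>i. ennreal (\<theta> i)) = ennreal (e / 2)"
  proof (rule suminf_ennreal_eq)
    show "\<theta> sums (e / 2)" unfolding \<theta>_def using sums_mult[OF power_half_series, of "e / 2"] by simp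
  qed (use \<theta> in \<open>auto intro: less_imp_le\<close>)
  also have "(\<Sum>i. ennreal (enn2real (?D (C i)) powr s)) + ennreal (e / 2) \<le> ennreal (e / 2) + ennreal (e / 2)"
    using sum by (intro add_right_mono) simp
  also have "\<dots> = ennreal e" using e by (simp flip: ennreal_plus)
  finally have "(\<Sum>i. ennreal (index (l i) powr - s)) \<le> ennreal e" .
  then show ?thesis using C l by (intro exI[of _ C] exI[of _ l]) blast
qed

end

text \<open>A lower bound for the logarithm of this number can be exponentiated only if the number
  is positive.\<close>

lemma (in tree_group) card_children_pos:
  assumes "\<And>e. e \<in> set es \<Longrightarrow> \<gamma> e \<in> G \<and> x e \<in> G"
  shows "0 < card (children \<gamma> es x N)"
proof -
  have "x' e \<in> G" if x': "x' \<in> shifts es x N" and e: "e \<in> set es" for x' e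
  proof -
    obtain y where y: "y \<in> St N" "x' e = x e \<circ> y" using x' e unfolding shifts_def by blast
    show ?thesis unfolding y(2) using comp_mem St_mem[OF y(1)] assms[OF e] by blast
  qed
  then have "comm_prod \<gamma> x' es \<in> G" if "x' \<in> shifts es x N" for x'
    using that assms by (intro comm_prod_mem) blast
  then have "finite ((\<lambda>g. restrict g (level m (Suc N))) ` (\<lambda>x'. comm_prod \<gamma> x' es) ` shifts es x N)"
    by (intro finite_restrict_image[OF _ order_refl] image_subsetI)
  moreover have "x \<in> shifts es x N" by (auto simp: shifts_def intro!: bexI[OF _ St_id])
  ultimately show ?thesis unfolding image_image card_gt_0_iff by blast
qed

section \<open>Comparing a closed group with its derived subgroup\<close>

context wreath
begin

lemma derived_comm_prod:
  assumes G: "subgroup G (iter_wreath m H)" and mem: "\<And>e. e \<in> set es \<Longrightarrow> \<gamma> e \<in> G \<and> x e \<in> G"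
  shows "comm_prod \<gamma> x es \<in> derived (iter_wreath m H) G"
  using mem
proof (induction es)
  case Nil
  show ?case
    using generate.one[of "iter_wreath m H" "derived_set (iter_wreath m H) G"] by (simp add: derived_def id_def)
next
  case (Cons e es)
  interpret G: tree_group m G by (rule tree_group_subgroup[OF H G])
  have GW: "g \<in> W" if "g \<in> G" for g using subgroup.mem_carrier[OF G that] .
  have ge: "\<gamma> e \<in> G" "x e \<in> G" using Cons.prems by auto
  then have ig: "inv' (\<gamma> e) \<in> G" "inv' (x e) \<in> G" using G.inv_mem by auto
  \<comment> \<open>With the product read from left to right this is the usual commutator of
    \<open>inv' (x e)\<close> and \<open>inv' (\<gamma> e)\<close>.\<close>
  have "commutator (\<gamma> e) (x e) = inv' (x e) \<otimes>\<^bsub>iter_wreath m H\<^esub> inv' (\<gamma> e)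
      \<otimes>\<^bsub>iter_wreath m H\<^esub> inv\<^bsub>iter_wreath m H\<^esub> (inv' (x e)) \<otimes>\<^bsub>iter_wreath m H\<^esub> inv\<^bsub>iter_wreath m H\<^esub> (inv' (\<gamma> e))"
    using ge ig GW by (simp add: commutator_def inv_iter_wreath[OF H] comp_assoc)
  then have "commutator (\<gamma> e) (x e) \<in> derived_set (iter_wreath m H) G" using ig by blast
  then have "commutator (\<gamma> e) (x e) \<in> derived (iter_wreath m H) G"
    unfolding derived_def by (rule generate.incl)
  moreover have "comm_prod \<gamma> x es \<in> derived (iter_wreath m H) G" using Cons by simp
  ultimately have "comm_prod \<gamma> x es \<otimes>\<^bsub>iter_wreath m H\<^esub> commutator (\<gamma> e) (x e) \<in> derived (iter_wreath m H) G"
    unfolding derived_def by (rule generate.eng[rotated])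
  then show ?case by (simp only: mult_iter_wreath comm_prod.simps)
qed

text \<open>Suppose the orders of the quotients of \<open>G\<close> exceed
  \<open>index n powr u\<close> on all deep levels. The branching loses at most a factor
  \<open>index N powr (u - s)\<close> up to level \<open>N\<close>, since \<open>index\<close> grows
  by at least the factor \<open>card H ^ (m ^ j)\<close> at each level \<open>j\<close>; so
  \<open>1 / w N\<close> is at most a constant times \<open>index N powr - s\<close>. A light cover
  of the derived subgroup at exponent \<open>s\<close> then misses one of the products. Hence small
  quotients occur on arbitrarily deep levels, and cylinders give measure 0 above
  \<open>u\<close>.\<close>

lemma hausdorff_measure_derived:
  assumes G: "subgroup G (iter_wreath m H)" and cl: "closedin (AutT_topology m) G"
    and s: "0 < s" "s < t"
    and null: "hausdorff_measure W (wreath_dist m H) s (derived (iter_wreath m H) G) = 0"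
  shows "hausdorff_measure W (wreath_dist m H) t G = 0"
proof -
  have tG: "tree_group m G" by (rule tree_group_subgroup[OF H G])
  interpret G: tree_group m G by (rule tG)
  have GW: "G \<subseteq> W" using subgroup.subset[OF G] .
  \<comment> \<open>Room on both sides: \<open>u - s\<close> pays for the loss in the branching,
    \<open>t - u\<close> for the cover by cylinders.\<close>
  define u where "u = (s + t) / 2"
  have u: "s < u" "u < t" using s by (simp_all add: u_def)
  have "\<exists>n\<ge>n1. real (G.level_order n) \<le> index n powr u" for n1
  proof (rule ccontr)
    assume "\<not> ?thesis"
    then have big: "index n powr u < real (G.level_order n)" if "n \<ge> n1" for n using that by force
    define b where "b = ln (real (card H))"
    define M where "M N = card ((\<lambda>y. restrict y (level m (Suc N))) ` G.St N)" for N
    have lab: "tree_label g v \<in> H" if "g \<in> G" "v \<in> tree_words m" for g v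
      using that GW by (auto simp: iter_wreath_def)
    have "\<exists>n (es :: (nat list \<times> nat list) list) \<gamma>. (\<forall>e\<in>set es. \<gamma> e \<in> G) \<and>
      (\<forall>N\<ge>n. \<forall>x. (\<forall>e\<in>set es. x e \<in> G.St n) \<longrightarrow> ln (M N) - (u - s) * b * m ^ N \<le>
        ln (card (G.children \<gamma> es x N)))"
      unfolding b_def M_def
      by (rule G.exists_branching[OF _ sym_group_subgroupD(3)[OF H] lab]) (use m u in auto)
    then obtain n \<gamma> and es :: "(nat list \<times> nat list) list" where \<gamma>: "\<forall>e\<in>set es. \<gamma> e \<in> G"
      and br: "\<forall>N\<ge>n. \<forall>x. (\<forall>e\<in>set es. x e \<in> G.St n) \<longrightarrow> ln (M N) - (u - s) * b * m ^ N \<le>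
        ln (card (G.children \<gamma> es x N))"
      by blast
    define c where "c N = exp (ln (M N) - (u - s) * b * m ^ N)" for N
    have cle: "c N \<le> card (G.children \<gamma> es x N)"
      if "n \<le> N" "\<And>e. e \<in> set es \<Longrightarrow> x e \<in> G.St n" for N x
    proof -
      let ?k = "card (G.children \<gamma> es x N)"
      have "0 < ?k" by (rule G.card_children_pos) (use \<gamma> that(2) G.St_mem in blast)
      moreover have "c N \<le> exp (ln ?k)" unfolding c_def using br that by simp
      ultimately show ?thesis by simp
    qed
    define w where "w N = (\<Prod>j\<in>{n..<N}. c j)" for N
    have wpos: "w N > 0" for N unfolding w_def by (rule prod_pos) (simp add: c_def)
    have Mpos: "M N > 0" for N
      using G.level_order_Suc_le[of N] G.level_order_pos[of "Suc N"] unfolding M_def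
      by (metis less_le_trans mult_is_0 not_gr_zero)
    have ln_order: "ln (G.level_order N) \<le> ln (G.level_order n) + (\<Sum>j\<in>{n..<N}. ln (M j))" if "n \<le> N" for N
      using that
    proof (induction N rule: dec_induct)
      case (step N)
      have "ln (real (G.level_order (Suc N))) \<le> ln (real (M N * G.level_order N))"
        by (rule ln_of_nat_mono[OF G.level_order_pos]) (use G.level_order_Suc_le[of N] in \<open>simp add: M_def\<close>)
      also have "\<dots> = ln (M N) + ln (G.level_order N)"
        using Mpos[of N] G.level_order_pos[of N] by (simp add: ln_mult)
      finally show ?case using step by simp
    qed simp
    have ln_index: "(\<Sum>j\<in>{n..<N}. b * m ^ j) \<le> ln (index N)" if "n \<le> N" for N
      using that
    proof (induction N rule: dec_induct)
      case base
      show ?case using index_ge_1 by simp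
    next
      case (step N)
      then show ?case using ln_index_Suc_ge[of N] by (simp add: b_def)
    qed
    define k where "k = real (G.level_order n)"
    have k: "k > 0" using G.level_order_pos[of n] by (simp add: k_def)
    have weight: "1 / w N \<le> k * index N powr - s" if N: "max n n1 \<le> N" for N
    proof -
      have nN: "n \<le> N" using N by simp
      have "(u - s) * (\<Sum>j\<in>{n..<N}. b * m ^ j) \<le> (u - s) * ln (index N)"
        using ln_index[OF nN] u(1) by (intro mult_left_mono) auto
      then have "(ln (G.level_order N) - ln k) - (u - s) * ln (index N) \<le>
          (\<Sum>j\<in>{n..<N}. ln (M j)) - (u - s) * (\<Sum>j\<in>{n..<N}. b * m ^ j)"
        using ln_order[OF nN] unfolding k_def by linarith
      also have "\<dots> = (\<Sum>j\<in>{n..<N}. ln (M j) - (u - s) * b * m ^ j)"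
        by (simp add: sum_subtractf sum_distrib_left mult.assoc)
      also have "\<dots> = ln (w N)"
        unfolding w_def by (subst ln_prod) (simp_all add: c_def)
      finally have lw: "ln (G.level_order N) - ln k - (u - s) * ln (index N) \<le> ln (w N)" .
      have "ln (index N powr u) \<le> ln (real (G.level_order N))"
        using big[of N] N index_pos[of N] by (intro ln_mono) auto
      then have "u * ln (index N) \<le> ln (real (G.level_order N))" using index_pos[of N] by (simp add: ln_powr)
      then have "s * ln (index N) - ln k \<le> ln (w N)" using lw by (simp add: algebra_simps)
      then have "exp (- ln (w N)) \<le> exp (ln k + - s * ln (index N))" by simp
      also have "\<dots> = k * index N powr - s" using k index_pos[of N] by (simp only: exp_add exp_ln powr_def if_False) simp
      also have "exp (- ln (w N)) = 1 / w N" using wpos[of N] by (simp add: exp_minus inverse_eq_divide)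
      finally show ?thesis .
    qed
    \<comment> \<open>The constant \<open>k\<close> stems from the levels before \<open>n\<close>;
      this choice brings the total weight of the cover down to 1/2.\<close>
    have k2: "0 < 1 / (2 * k)" using k by simp
    obtain C l where C: "derived (iter_wreath m H) G \<subseteq> (\<Union>i. C i)"
      and Cl: "\<And>i. C i \<subseteq> W" "\<And>i. max n n1 \<le> l i"
        "\<And>i. \<forall>g\<in>C i. \<forall>h\<in>C i. restrict g (level m (l i)) = restrict h (level m (l i))"
      and sum: "(\<Sum>i. ennreal (index (l i) powr - s)) \<le> ennreal (1 / (2 * k))"
      using exists_level_cover[OF null s(1) k2, of "max n n1"] by blast
    have "\<exists>x. (\<forall>e\<in>set es. x e \<in> G) \<and> comm_prod \<gamma> x es \<notin> (\<Union>i. C i)"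
    proof (rule G.branch_avoid[where n = n and c = c and l = l and K = W])
      show "g \<in> G" if "tree_automorphism m g" "\<And>k. \<exists>h\<in>G. \<forall>v\<in>level m k. h v = g v" for g
        by (rule closed_limit[OF tG cl that])
      show "\<gamma> e \<in> G" if "e \<in> set es" for e using \<gamma> that by blast
      show "0 < c N" for N by (simp add: c_def)
      show "c N \<le> card (G.children \<gamma> es x N)"
        if "n \<le> N" "\<And>e. e \<in> set es \<Longrightarrow> x e \<in> G.St n" for N x by (rule cle[OF that])
      show "n \<le> l i" for i using Cl(2)[of i] by simp
      show "C i \<subseteq> W" for i by (rule Cl(1))
      show "tree_group m W" by (rule W.tree_group_axioms)
      show "G \<subseteq> W" by (rule GW)
      show "restrict g (level m (l i)) = restrict h (level m (l i))" if "g \<in> C i" "h \<in> C i" for i g h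
        using Cl(3) that by blast
      have "(\<Sum>i. ennreal (1 / (\<Prod>j\<in>{n..<l i}. c j))) \<le> (\<Sum>i. ennreal k * ennreal (index (l i) powr - s))"
      proof (rule suminf_le)
        fix i
        have "ennreal (1 / (\<Prod>j\<in>{n..<l i}. c j)) \<le> ennreal (k * index (l i) powr - s)"
          using weight[OF Cl(2)] unfolding w_def by (rule ennreal_leI)
        then show "ennreal (1 / (\<Prod>j\<in>{n..<l i}. c j)) \<le> ennreal k * ennreal (index (l i) powr - s)"
          using k by (simp add: ennreal_mult)
      qed simp_all
      also have "\<dots> = ennreal k * (\<Sum>i. ennreal (index (l i) powr - s))" by (rule ennreal_suminf_cmult)
      also have "\<dots> \<le> ennreal k * ennreal (1 / (2 * k))" by (rule mult_left_mono[OF sum]) simp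
      also have "\<dots> = ennreal (1 / 2)" using k by (simp flip: ennreal_mult)
      also have "ennreal (1 / 2) < ennreal 1" by (rule ennreal_lessI) simp_all
      finally show "(\<Sum>i. ennreal (1 / (\<Prod>j\<in>{n..<l i}. c j))) < 1" by simp
    qed
    then obtain x where "\<forall>e\<in>set es. x e \<in> G" "comm_prod \<gamma> x es \<notin> (\<Union>i. C i)" by blast
    moreover have "comm_prod \<gamma> x es \<in> derived (iter_wreath m H) G"
      using \<gamma> calculation(1) by (intro derived_comm_prod[OF G]) blast
    ultimately show False using C by blast
  qed
  then show ?thesis using s u by (intro hausdorff_measure_eq_0[OF tG GW, of u]) auto
qed

end

text \<open>An automorphism with only trivial labels is the identity. This case is separate because
  all indices are 1 and distances then carry no information.\<close>

lemma derived_trivial_labels: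
  assumes H: "subgroup H (sym_group m)" "card H < 2" and G: "subgroup G (iter_wreath m H)"
  shows "derived (iter_wreath m H) G = G"
proof -
  have "card {id :: nat \<Rightarrow> nat} \<le> card H"
    using sym_group_subgroupD(2,3)[OF H(1)] by (intro card_mono) auto
  then have "card H = 1" using H(2) by simp
  then have H_id: "H = {id}" using sym_group_subgroupD(2)[OF H(1)] by (auto simp: card_1_singleton_iff)
  have triv: "g = id" if "g \<in> carrier (iter_wreath m H)" for g
  proof
    fix v
    have g: "tree_automorphism m g" and lab: "tree_label g v = id" if "v \<in> tree_words m" for v
      using \<open>g \<in> carrier (iter_wreath m H)\<close> that by (auto simp: iter_wreath_def AutT_def H_id)
    have g: "tree_automorphism m g" using that by (simp add: iter_wreath_def AutT_def)
    have "v \<in> tree_words m \<Longrightarrow> g v = v"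
    proof (induction v rule: rev_induct)
      case Nil then show ?case using g by (simp add: tree_automorphism_def)
    next
      case (snoc x v)
      then show ?case using tree_label[OF g snoc.prems] lab[of v] by simp
    qed
    then show "g v = id v" using tree_automorphism_outside[OF g] by (cases "v \<in> tree_words m") auto
  qed
  have "G = {id}" using triv subgroup.mem_carrier[OF G] subgroup.one_closed[OF G] by auto
  moreover have "derived (iter_wreath m H) G \<subseteq> G"
    using group.derived_incl[OF group_iter_wreath[OF H(1)] order_refl G] .
  moreover have "id \<in> derived (iter_wreath m H) G"
    using generate.one[of "iter_wreath m H" "derived_set (iter_wreath m H) G"] by (simp add: derived_def)
  ultimately show ?thesis by blast
qed

theorem theorem2:
  fixes m :: nat and H :: "(nat \<Rightarrow> nat) set" and G :: "(nat list \<Rightarrow> nat list) set"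
  assumes "m \<ge> 2"
    and "subgroup H (sym_group m)"
    and "subgroup G (iter_wreath m H)"
    and "closedin (AutT_topology m) G"
  shows "wreath_hdim m H G = wreath_hdim m H (derived (iter_wreath m H) G)"
proof (cases "card H < 2")
  case True
  then show ?thesis using derived_trivial_labels[OF assms(2) True assms(3)] by simp
next
  case False
  interpret wreath m H by (rule wreath.intro[OF assms(1,2)]) (use False in simp)
  have sub: "derived (iter_wreath m H) G \<subseteq> G"
    using group.derived_incl[OF group_iter_wreath[OF assms(2)] order_refl assms(3)] .
  show ?thesis
  proof (rule antisym)
    show "wreath_hdim m H G \<le> wreath_hdim m H (derived (iter_wreath m H) G)"
      unfolding wreath_hdim_def
      using hausdorff_measure_derived[OF assms(3,4)] by (rule hausdorff_dim_leI)
    have "hausdorff_measure W (wreath_dist m H) s (derived (iter_wreath m H) G) = 0"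
      if "hausdorff_measure W (wreath_dist m H) s G = 0" for s
      using hausdorff_measure_mono[OF sub, of W "wreath_dist m H" s] that by simp
    then show "wreath_hdim m H (derived (iter_wreath m H) G) \<le> wreath_hdim m H G"
      unfolding wreath_hdim_def hausdorff_dim_def by (intro INF_superset_mono) auto
  qed
qed

end
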